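(* Let $k$ be a positive integer and let $\mu,\nu\in\mathcal{G}_k$ be such that $\mu\boxtimes\nu=\nu\boxtimes\mu$. Then the $LS$-transforms satisfy $$LS_{\mu\boxtimes\nu}=LS_\mu+LS_\nu .$$
   Context: Distributions. A non-commutative probability space is a pair $(\mathcal{A},\varphi)$ with $\mathcal{A}$ a unital algebra over $\mathbb{C}$ and $\varphi:\mathcal{A}\to\mathbb{C}$ linear with $\varphi(1_{\mathcal{A}})=1$. The distribution of $(a_1,\dots,a_k)\in\mathcal{A}^k$ is the linear functional $\mu$ on $\mathbb{C}\langle X_1,\dots,X_k\rangle$ (non-commutative polynomials) with $\mu(X_{i_1}\cdots X_{i_n})=\varphi(a_{i_1}\cdots a_{i_n})$ for all $n\ge 0$ and all indices. $\mathcal{D}_{\mathrm{alg}}(k)$ is the set of all linear functionals $\mu$ on $\mathbb{C}\langle X_1,\dots,X_k\rangle$ with $\mu(1)=1$ (each is the distribution of some $k$-tuple). Unital subalgebras $\mathcal{A}_1,\mathcal{A}_2$ of $\mathcal{A}$ are freely independent if $\varphi(c_1\cdots c_n)=0$ whenever $c_j\in\mathcal{A}_{i_j}$, $\varphi(c_j)=0$ and $i_j\ne i_{j+1}$; sets are freely independent if the unital subalgebras they generate are. Free multiplicative convolution $\boxtimes$ on $\mathcal{D}_{\mathrm{alg}}(k)$ is the well-defined operation such that if $(a_1,\dots,a_k)$ has distribution $\mu$, $(b_1,\dots,b_k)$ has distribution $\nu$, and $\{a_1,\dots,a_k\}$ is freely independent from $\{b_1,\dots,b_k\}$, then $(a_1b_1,\dots,a_kb_k)$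 has distribution $\mu\boxtimes\nu$. The set $\mathcal{G}_k=\{\mu\in\mathcal{D}_{\mathrm{alg}}(k)\mid\mu(X_i)=1,\ 1\le i\le k\}$ is a group under $\boxtimes$. Words and non-crossing partitions. $[k]^*$ is the set of finite words over $\{1,\dots,k\}$, $|w|$ is the length of $w$. For $w=(i_1,\dots,i_n)$ and $B=\{b_1<\dots<b_m\}\subseteq\{1,\dots,n\}$, $w|B:=(i_{b_1},\dots,i_{b_m})$. $NC(n)$ is the lattice of non-crossing partitions of $\{1,\dots,n\}$ ordered by reversed refinement, with minimum $0_n$ (all blocks singletons) and maximum $1_n$ (one block). For $\pi\in NC(n)$, $P_\pi$ is the permutation of $\{1,\dots,n\}$ which maps cyclically $b_1\mapsto b_2\mapsto\cdots\mapsto b_m\mapsto b_1$ on every block $\{b_1<\dots<b_m\}$ of $\pi$. The Kreweras complement $K(\pi)\in NC(n)$ is determined by $P_{K(\pi)}=P_\pi^{-1}P_{1_n}$ (composition of maps). $R$-transform. For a power series $f$ with vanishing constant term in non-commuting indeterminates $z_1,\dots,z_k$, $\mathrm{Cf}_w(f)$ is the coefficient of $z_w:=z_{i_1}\cdots z_{i_n}$ in $f$ ($w=(i_1,\dots,i_n)$, $n\ge1$), and $\mathrm{Cf}_{w;\pi}(f):=\prod_{B\text{ block of }\pi}\mathrm{Cf}_{w|B}(f)$ for $\pi\in NC(n)$. $R_\mu$ is the unique such series with $\mu(X_{i_1}\cdots X_{i_n})=\sum_{\pi\in NC(n)}\mathrm{Cf}_{(i_1,\dots,i_n);\pi}(R_\mu)$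 for all $n\ge1$ and all indices. The Hopf algebra $\mathcal{Y}^{(k)}$. As an algebra, $\mathcal{Y}^{(k)}=\mathbb{C}[Y_w\mid w\in[k]^*,|w|\ge2]$ (commutative polynomials). Put $Y_w:=1$ if $|w|=1$, and $Y_{w;\pi}:=\prod_{A\text{ block of }\pi}Y_{w|A}$ for $|w|=n$, $\pi\in NC(n)$. The comultiplication $\Delta$ is the unital algebra homomorphism with $\Delta(Y_w)=\sum_{\pi\in NC(n)}Y_{w;\pi}\otimes Y_{w;K(\pi)}$ for $|w|=n\ge2$, and the counit $\varepsilon$ is the unital algebra homomorphism with $\varepsilon(Y_w)=0$ for $|w|\ge2$. With these, $\mathcal{Y}^{(k)}$ is a graded connected Hopf algebra, $Y_w$ being homogeneous of degree $|w|-1$. The convolution of linear functionals $\xi,\eta$ on $\mathcal{Y}^{(k)}$ is $\xi\eta:=(\xi\otimes\eta)\circ\Delta$. For a linear functional $\eta$ with $\eta(1)=1$, $\log\eta:=-\sum_{\ell=1}^\infty\frac1\ell(\varepsilon-\eta)^\ell$ (convolution powers; on each homogeneous component only finitely many terms are non-zero). $LS$-transform. For $\mu\in\mathcal{G}_k$, $\chi_\mu:\mathcal{Y}^{(k)}\to\mathbb{C}$ is the unital algebra homomorphism with $\chi_\mu(Y_w)=\mathrm{Cf}_w(R_\mu)$ for all $|w|\ge2$, and the $LS$-transform of $\mu$ is the power series in non-commuting indeterminates $LS_\mu(z_1,\dots,z_k):=\sum_{w\in[k]^*,|w|\ge2}\big((\log\chi_\mu)(Y_w)\big)z_w$. *)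

theory Defs
  imports
    Complex_Main
    "HOL-Library.Poly_Mapping"
    "HOL-Library.Product_Plus"
    "HOL-Library.Disjoint_Sets"
begin

text \<open>
  The letters \<open>1, \<dots>, k\<close> are the elements of a finite type \<open>'k\<close> with \<open>k = CARD('k)\<close>, words are
  lists, and \<open>\<complex>\<langle>X\<^sub>1, \<dots>, X\<^sub>k\<rangle>\<close> is the monoid algebra over \<open>\<complex>\<close> of the free monoid on \<open>'k\<close>.
\<close>

text \<open>The free monoid, written additively because \<open>poly_mapping\<close> expects additive exponents.\<close>

datatype 'k nc_monom = NCMonom (letters: "'k list")

instantiation nc_monom :: (type) monoid_add
begin

definition "0 = NCMonom []"

definition "m + n = NCMonom (letters m @ letters n)"

instance
  by standard (auto simp: zero_nc_monom_def plus_nc_monom_def)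

end

type_synonym 'k nc_poly = "'k nc_monom \<Rightarrow>\<^sub>0 complex"

definition pm_scale :: "complex \<Rightarrow> ('m \<Rightarrow>\<^sub>0 complex) \<Rightarrow> ('m \<Rightarrow>\<^sub>0 complex)" where
  "pm_scale c = Poly_Mapping.map ((*) c)"

definition X_word :: "'k list \<Rightarrow> 'k nc_poly" where
  "X_word w = Poly_Mapping.single (NCMonom w) 1"

locale complex_algebra = vector_space scale
  for scale :: "complex \<Rightarrow> 'a::ring_1 \<Rightarrow> 'a" +
  assumes scale_mult_left: "scale c x * y = scale c (x * y)"
    and scale_mult_right: "x * scale c y = scale c (x * y)"

locale nc_prob_space = complex_algebra scale + Vector_Spaces.linear scale "(*)" \<phi>
  for scale :: "complex \<Rightarrow> 'a::ring_1 \<Rightarrow> 'a" and \<phi> :: "'a \<Rightarrow> complex" +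
  assumes unit: "\<phi> 1 = 1"

definition distribution :: "('a::ring_1 \<Rightarrow> complex) \<Rightarrow> ('k \<Rightarrow> 'a) \<Rightarrow> 'k nc_poly \<Rightarrow> complex" where
  "distribution \<phi> a p =
     (\<Sum>m\<in>Poly_Mapping.keys p. Poly_Mapping.lookup p m * \<phi> (prod_list (map a (letters m))))"

definition D_alg :: "('k nc_poly \<Rightarrow> complex) set" where
  "D_alg = {\<mu>. Vector_Spaces.linear pm_scale (*) \<mu> \<and> \<mu> 1 = 1}"

definition unital_subalgebra :: "(complex \<Rightarrow> 'a::ring_1 \<Rightarrow> 'a) \<Rightarrow> 'a set \<Rightarrow> bool" where
  "unital_subalgebra scale S \<longleftrightarrow>
     1 \<in> S \<and> (\<forall>x\<in>S. \<forall>y\<in>S. x + y \<in> S \<and> x * y \<in> S) \<and> (\<forall>c. \<forall>x\<in>S. scale c x \<in> S)"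

text \<open>
  The list \<open>cs\<close> is the sequence of pairs \<open>(i\<^sub>j, c\<^sub>j)\<close>; the index \<open>i\<^sub>j\<close> of the subalgebra is a Boolean.
\<close>

definition free_subalgebras :: "('a::ring_1 \<Rightarrow> complex) \<Rightarrow> 'a set \<Rightarrow> 'a set \<Rightarrow> bool" where
  "free_subalgebras \<phi> A\<^sub>1 A\<^sub>2 \<longleftrightarrow>
     (\<forall>cs :: (bool \<times> 'a) list.
        cs \<noteq> [] \<longrightarrow>
        (\<forall>(i, c) \<in> set cs. c \<in> (if i then A\<^sub>1 else A\<^sub>2) \<and> \<phi> c = 0) \<longrightarrow>
        (\<forall>j. Suc j < length cs \<longrightarrow> fst (cs ! j) \<noteq> fst (cs ! Suc j)) \<longrightarrow>
        \<phi> (prod_list (map snd cs)) = 0)"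

definition freely_independent ::
    "(complex \<Rightarrow> 'a::ring_1 \<Rightarrow> 'a) \<Rightarrow> ('a \<Rightarrow> complex) \<Rightarrow> 'a set \<Rightarrow> 'a set \<Rightarrow> bool" where
  "freely_independent scale \<phi> S T \<longleftrightarrow>
     free_subalgebras \<phi> (unital_subalgebra scale hull S) (unital_subalgebra scale hull T)"

text \<open>
  A realization of \<open>(\<mu>, \<nu>)\<close> by free tuples. In the definition of \<open>\<boxtimes>\<close> below the ambient algebra has to be
  of one fixed type; it is the free algebra on the \<open>2k\<close> letters \<open>'k + 'k\<close>. This loses no
  generality: by \<open>free_realization_pullback\<close>, a realization in an arbitrary non-commutative
  probability space pulls back to one there, with the same distribution of the product tuple.
\<close>

definition free_realization ::
    "(complex \<Rightarrow> 'a::ring_1 \<Rightarrow> 'a) \<Rightarrow> ('a \<Rightarrow> complex) \<Rightarrow> ('k \<Rightarrow> 'a) \<Rightarrow> ('k \<Rightarrow> 'a) \<Rightarrow>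
     ('k nc_poly \<Rightarrow> complex) \<Rightarrow> ('k nc_poly \<Rightarrow> complex) \<Rightarrow> bool" where
  "free_realization scale \<phi> a b \<mu> \<nu> \<longleftrightarrow>
     nc_prob_space scale \<phi> \<and> distribution \<phi> a = \<mu> \<and> distribution \<phi> b = \<nu> \<and>
     freely_independent scale \<phi> (range a) (range b)"

lemma poly_mapping_add_induct [case_names single sum]:
  fixes p :: "'m \<Rightarrow>\<^sub>0 'c::comm_monoid_add"
  assumes single: "\<And>k v. P (Poly_Mapping.single k v)"
    and sum: "\<And>f g. P f \<Longrightarrow> P g \<Longrightarrow> P (f + g)"
  shows "P p"
proof (induction p rule: update_induct)
  case const
  then show ?case using single[of undefined 0] by simp
next
  case (update f a b)
  then have "Poly_Mapping.update a b f = f + Poly_Mapping.single a b"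
    by (intro poly_mapping_eqI) (auto simp: lookup_update lookup_add lookup_single in_keys_iff)
  then show ?case using update single sum by simp
qed

lemma lookup_pm_scale: "Poly_Mapping.lookup (pm_scale c p) m = c * Poly_Mapping.lookup p m"
  by (simp add: pm_scale_def Poly_Mapping.map.rep_eq when_def)

lemma pm_scale_conv_mult:
  fixes p :: "'m::monoid_add \<Rightarrow>\<^sub>0 complex"
  shows "pm_scale c p = Poly_Mapping.single 0 c * p"
  by (simp add: pm_scale_def Poly_Mapping.mult_map_scale_conv_mult)

lemma complex_algebra_pm_scale:
  "complex_algebra (pm_scale :: complex \<Rightarrow> 'k nc_poly \<Rightarrow> 'k nc_poly)"
proof
  fix c d :: complex and p q :: "'k nc_poly"
  show "pm_scale c (p + q) = pm_scale c p + pm_scale c q"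
    and "pm_scale (c + d) p = pm_scale c p + pm_scale d p"
    and "pm_scale c (pm_scale d p) = pm_scale (c * d) p"
    and "pm_scale 1 p = p"
    by (rule poly_mapping_eqI; simp add: lookup_pm_scale lookup_add algebra_simps)+
  show "pm_scale c p * q = pm_scale c (p * q)"
    by (simp add: pm_scale_conv_mult mult.assoc)
  have comm: "p * Poly_Mapping.single 0 c = Poly_Mapping.single 0 c * p" for p :: "'k nc_poly"
  proof (induction p rule: poly_mapping_add_induct)
    case (single k v)
    then show ?case by (simp add: mult_single mult.commute)
  next
    case (sum f g)
    then show ?case by (simp add: distrib_left distrib_right)
  qed
  show "p * pm_scale c q = pm_scale c (p * q)"
    by (simp add: pm_scale_conv_mult mult.assoc[symmetric] comm)
qed

definition nc_eval :: "(complex \<Rightarrow> 'a::ring_1 \<Rightarrow> 'a) \<Rightarrow> ('k \<Rightarrow> 'a) \<Rightarrow> 'k nc_poly \<Rightarrow> 'a" where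
  "nc_eval scale a p =
     (\<Sum>m\<in>Poly_Mapping.keys p. scale (Poly_Mapping.lookup p m) (prod_list (map a (letters m))))"

lemma one_nc_poly: "(1 :: 'k nc_poly) = X_word []"
  by (simp add: X_word_def zero_nc_monom_def[symmetric])

context complex_algebra
begin

lemma nc_eval_superset:
  assumes "finite S" "Poly_Mapping.keys p \<subseteq> S"
  shows "nc_eval scale a p =
    (\<Sum>m\<in>S. scale (Poly_Mapping.lookup p m) (prod_list (map a (letters m))))"
  unfolding nc_eval_def
  by (rule sum.mono_neutral_left) (use assms in \<open>auto simp: in_keys_iff\<close>)

lemma nc_eval_add: "nc_eval scale a (p + q) = nc_eval scale a p + nc_eval scale a q"
proof -
  let ?S = "Poly_Mapping.keys p \<union> Poly_Mapping.keys q"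
  have "Poly_Mapping.keys (p + q) \<subseteq> ?S"
    by (rule keys_add)
  then show ?thesis
    by (simp add: nc_eval_superset[of ?S] lookup_add scale_left_distrib sum.distrib)
qed

lemma nc_eval_single:
  "nc_eval scale a (Poly_Mapping.single m c) = scale c (prod_list (map a (letters m)))"
  by (simp add: nc_eval_def)

lemma nc_eval_X_word: "nc_eval scale a (X_word w) = prod_list (map a w)"
  by (simp add: X_word_def nc_eval_single)

lemma nc_eval_1: "nc_eval scale a 1 = 1"
  by (simp add: one_nc_poly nc_eval_X_word)

lemma nc_eval_mult: "nc_eval scale a (p * q) = nc_eval scale a p * nc_eval scale a q"
proof (induction p rule: poly_mapping_add_induct)
  case (single k v)
  show ?case
  proof (induction q rule: poly_mapping_add_induct)
    case (single l u)
    then show ?case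
      by (simp add: mult_single nc_eval_single plus_nc_monom_def scale_mult_left scale_mult_right)
  next
    case (sum f g)
    then show ?case by (simp add: distrib_left nc_eval_add)
  qed
next
  case (sum f g)
  then show ?case by (simp add: distrib_right nc_eval_add)
qed

lemma nc_eval_prod_list:
  "nc_eval scale a (prod_list ps) = prod_list (map (nc_eval scale a) ps)"
  by (induction ps) (simp_all add: nc_eval_1 nc_eval_mult)

lemma nc_eval_scale: "nc_eval scale a (pm_scale c p) = scale c (nc_eval scale a p)"
  by (simp add: pm_scale_conv_mult nc_eval_mult nc_eval_single zero_nc_monom_def scale_mult_left)

end

context nc_prob_space
begin

lemma distribution_eq: "distribution \<phi> a p = \<phi> (nc_eval scale a p)"
  by (simp add: distribution_def nc_eval_def sum scale)

lemma nc_prob_space_distribution: "nc_prob_space pm_scale (distribution \<phi> a)"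
proof -
  interpret F: complex_algebra "pm_scale :: complex \<Rightarrow> 'c nc_poly \<Rightarrow> 'c nc_poly"
    by (rule complex_algebra_pm_scale)
  show ?thesis
    by unfold_locales (simp_all add: distribution_eq nc_eval_add nc_eval_scale nc_eval_1 add scale unit)
qed

lemma free_realization_pullback:
  fixes a b :: "'k \<Rightarrow> 'a" and x y :: "'k \<Rightarrow> ('k + 'k) nc_poly"
  assumes "free_realization scale \<phi> a b \<mu> \<nu>"
  defines "x \<equiv> (\<lambda>i. X_word [Inl i])" and "y \<equiv> (\<lambda>i. X_word [Inr i])"
  defines "\<psi> \<equiv> distribution \<phi> (case_sum a b)"
  shows "free_realization pm_scale \<psi> x y \<mu> \<nu>"
    and "distribution \<psi> (\<lambda>i. x i * y i) = distribution \<phi> (\<lambda>i. a i * b i)"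
proof -
  let ?e = "nc_eval scale (case_sum a b)"
  have \<psi>: "\<psi> p = \<phi> (?e p)" for p
    by (simp add: \<psi>_def distribution_eq)
  have ex: "?e (x i) = a i" and ey: "?e (y i) = b i" for i
    by (simp_all add: x_def y_def nc_eval_X_word)
  have pull: "distribution \<psi> z = distribution \<phi> (\<lambda>i. ?e (z i))" for z :: "'k \<Rightarrow> ('k + 'k) nc_poly"
    by (rule ext) (simp add: distribution_def \<psi> nc_eval_prod_list comp_def)
  show "distribution \<psi> (\<lambda>i. x i * y i) = distribution \<phi> (\<lambda>i. a i * b i)"
    by (simp add: pull nc_eval_mult ex ey)
  have hull: "?e c \<in> unital_subalgebra scale hull (?e ` S)"
    if "c \<in> unital_subalgebra pm_scale hull S" for c S
    using that
  proof (rule hull_induct)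
    show "unital_subalgebra pm_scale {c. ?e c \<in> unital_subalgebra scale hull (?e ` S)}"
    proof -
      have "unital_subalgebra scale (unital_subalgebra scale hull (?e ` S))"
        by (rule hull_in) (auto simp: unital_subalgebra_def)
      then show ?thesis
        by (auto simp: unital_subalgebra_def nc_eval_1 nc_eval_add nc_eval_mult nc_eval_scale)
    qed
  qed (auto intro: hull_inc)
  have rx: "?e ` range x = range a" and ry: "?e ` range y = range b"
    by (simp_all add: image_image ex ey)
  have "freely_independent pm_scale \<psi> (range x) (range y)"
    unfolding freely_independent_def free_subalgebras_def
  proof (intro allI impI)
    fix cs :: "(bool \<times> ('k + 'k) nc_poly) list"
    assume cs: "cs \<noteq> []"
      "\<forall>(i, c)\<in>set cs. c \<in> (if i then unital_subalgebra pm_scale hull range x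
         else unital_subalgebra pm_scale hull range y) \<and> \<psi> c = 0"
      "\<forall>j. Suc j < length cs \<longrightarrow> fst (cs ! j) \<noteq> fst (cs ! Suc j)"
    let ?ds = "map (\<lambda>(i, c). (i, ?e c)) cs"
    have free: "free_subalgebras \<phi> (unital_subalgebra scale hull (range a))
        (unital_subalgebra scale hull (range b))"
      using assms(1) by (simp add: free_realization_def freely_independent_def)
    have "\<phi> (prod_list (map snd ?ds)) = 0"
    proof (rule free[unfolded free_subalgebras_def, rule_format])
      show "?ds \<noteq> []" using cs(1) by simp
      show "case z of (i, c) \<Rightarrow> c \<in> (if i then unital_subalgebra scale hull range a
          else unital_subalgebra scale hull range b) \<and> \<phi> c = 0" if "z \<in> set ?ds" for z
        using that cs(2) hull[of _ "range x"] hull[of _ "range y"]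
        by (fastforce simp: rx ry \<psi> split: if_splits)
      show "fst (?ds ! j) \<noteq> fst (?ds ! Suc j)" if "Suc j < length ?ds" for j
        using that cs(3) by (simp add: case_prod_beta)
    qed
    then show "\<psi> (prod_list (map snd cs)) = 0"
      by (simp add: \<psi> nc_eval_prod_list comp_def case_prod_beta)
  qed
  then show "free_realization pm_scale \<psi> x y \<mu> \<nu>"
    using assms(1) nc_prob_space_distribution[of "case_sum a b"]
    by (simp add: free_realization_def \<psi>_def[symmetric] pull ex ey)
qed

end

definition free_mult_conv ::
    "('k nc_poly \<Rightarrow> complex) \<Rightarrow> ('k nc_poly \<Rightarrow> complex) \<Rightarrow> 'k nc_poly \<Rightarrow> complex"
    (infixl \<open>\<boxtimes>\<close> 70) where
  "\<mu> \<boxtimes> \<nu> =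
     (THE \<rho>. \<forall>\<phi> (a :: 'k \<Rightarrow> ('k + 'k) nc_poly) b.
        free_realization pm_scale \<phi> a b \<mu> \<nu> \<longrightarrow> distribution \<phi> (\<lambda>i. a i * b i) = \<rho>)"

definition G_group :: "('k nc_poly \<Rightarrow> complex) set" where
  "G_group = {\<mu> \<in> D_alg. \<forall>i. \<mu> (X_word [i]) = 1}"

text \<open>
  Positions are numbered from \<open>0\<close>, so partitions are of \<open>{..<n}\<close> and \<open>w|B\<close> is \<open>nths w B\<close>.
\<close>

definition noncrossing :: "nat set set \<Rightarrow> bool" where
  "noncrossing \<pi> \<longleftrightarrow>
     (\<forall>A\<in>\<pi>. \<forall>B\<in>\<pi>. \<forall>a b c d.
        a < b \<and> b < c \<and> c < d \<and> a \<in> A \<and> c \<in> A \<and> b \<in> B \<and> d \<in> B \<longrightarrow> A = B)"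

definition NC :: "nat \<Rightarrow> nat set set set" where
  "NC n = {\<pi>. partition_on {..<n} \<pi> \<and> noncrossing \<pi>}"

text \<open>The permutation \<open>P\<^sub>\<pi>\<close>, extended by the identity to all of \<^typ>\<open>nat\<close>.\<close>

definition part_perm :: "nat set set \<Rightarrow> nat \<Rightarrow> nat" where
  "part_perm \<pi> i =
     (if i \<in> \<Union>\<pi> then
        let B = (THE B. B \<in> \<pi> \<and> i \<in> B)
        in if \<exists>j\<in>B. i < j then Min {j \<in> B. i < j} else Min B
      else i)"

definition kreweras :: "nat \<Rightarrow> nat set set \<Rightarrow> nat set set" where
  "kreweras n \<pi> =
     (THE \<sigma>. \<sigma> \<in> NC n \<and> part_perm \<sigma> = inv (part_perm \<pi>) \<circ> part_perm {{..<n}})"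

text \<open>A power series in non-commuting indeterminates is its coefficient function on words.\<close>

type_synonym 'k nc_series = "'k list \<Rightarrow> complex"

definition Cf_part :: "'k list \<Rightarrow> nat set set \<Rightarrow> 'k nc_series \<Rightarrow> complex" where
  "Cf_part w \<pi> f = (\<Prod>B\<in>\<pi>. f (nths w B))"

definition R_transform :: "('k nc_poly \<Rightarrow> complex) \<Rightarrow> 'k nc_series" where
  "R_transform \<mu> =
     (THE f. f [] = 0 \<and>
        (\<forall>w. w \<noteq> [] \<longrightarrow> \<mu> (X_word w) = (\<Sum>\<pi>\<in>NC (length w). Cf_part w \<pi> f)))"

typedef 'k long_word = "{w :: 'k list. 2 \<le> length w}"
  by (rule exI[of _ "[undefined, undefined]"]) simp

type_synonym 'k monom = "'k long_word \<Rightarrow>\<^sub>0 nat"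

type_synonym 'k Y_alg = "'k monom \<Rightarrow>\<^sub>0 complex"

text \<open>
  The tensor square of a monoid algebra is the monoid algebra of the product monoid, the pair of
  monomials \<open>(m, n)\<close> standing for \<open>m \<otimes> n\<close>.
\<close>

type_synonym 'k Y_tensor = "('k monom \<times> 'k monom) \<Rightarrow>\<^sub>0 complex"

definition tensor :: "'k Y_alg \<Rightarrow> 'k Y_alg \<Rightarrow> 'k Y_tensor" where
  "tensor p q =
     (\<Sum>m\<in>Poly_Mapping.keys p. \<Sum>n\<in>Poly_Mapping.keys q.
        Poly_Mapping.single (m, n) (Poly_Mapping.lookup p m * Poly_Mapping.lookup q n))"

definition tensor_functional ::
    "('k Y_alg \<Rightarrow> complex) \<Rightarrow> ('k Y_alg \<Rightarrow> complex) \<Rightarrow> 'k Y_tensor \<Rightarrow> complex" where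
  "tensor_functional \<xi> \<eta> t =
     (\<Sum>(m, n)\<in>Poly_Mapping.keys t.
        Poly_Mapping.lookup t (m, n) * \<xi> (Poly_Mapping.single m 1) * \<eta> (Poly_Mapping.single n 1))"

definition Y :: "'k list \<Rightarrow> 'k Y_alg" where
  "Y w = (if 2 \<le> length w
          then Poly_Mapping.single (Poly_Mapping.single (Abs_long_word w) 1) 1 else 1)"

definition Y_part :: "'k list \<Rightarrow> nat set set \<Rightarrow> 'k Y_alg" where
  "Y_part w \<pi> = (\<Prod>A\<in>\<pi>. Y (nths w A))"

text \<open>
  The unital algebra homomorphism with \<open>Y\<^sub>w \<mapsto> f w\<close>; \<open>\<iota>\<close> embeds the scalars into the target algebra.
\<close>

definition Y_hom :: "(complex \<Rightarrow> 'b::comm_ring_1) \<Rightarrow> ('k list \<Rightarrow> 'b) \<Rightarrow> 'k Y_alg \<Rightarrow> 'b" where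
  "Y_hom \<iota> f p =
     (\<Sum>m\<in>Poly_Mapping.keys p. \<iota> (Poly_Mapping.lookup p m) *
        (\<Prod>x\<in>Poly_Mapping.keys m. f (Rep_long_word x) ^ Poly_Mapping.lookup m x))"

definition comult :: "'k Y_alg \<Rightarrow> 'k Y_tensor" where
  "comult = Y_hom (Poly_Mapping.single 0)
     (\<lambda>w. \<Sum>\<pi>\<in>NC (length w). tensor (Y_part w \<pi>) (Y_part w (kreweras (length w) \<pi>)))"

definition counit :: "'k Y_alg \<Rightarrow> complex" where
  "counit = Y_hom id (\<lambda>w. 0)"

definition convolution ::
    "('k Y_alg \<Rightarrow> complex) \<Rightarrow> ('k Y_alg \<Rightarrow> complex) \<Rightarrow> 'k Y_alg \<Rightarrow> complex" where
  "convolution \<xi> \<eta> = tensor_functional \<xi> \<eta> \<circ> comult"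

primrec conv_power :: "('k Y_alg \<Rightarrow> complex) \<Rightarrow> nat \<Rightarrow> 'k Y_alg \<Rightarrow> complex" where
  "conv_power \<xi> 0 = counit"
| "conv_power \<xi> (Suc l) = convolution \<xi> (conv_power \<xi> l)"

text \<open>
  For linear \<open>\<eta>\<close> with \<open>\<eta> 1 = 1\<close>, only finitely many terms of the series are non-zero at each \<open>p\<close>.
\<close>

definition conv_log :: "('k Y_alg \<Rightarrow> complex) \<Rightarrow> 'k Y_alg \<Rightarrow> complex" where
  "conv_log \<eta> p =
     - suminf (\<lambda>l. 1 / of_nat (Suc l) * conv_power (\<lambda>q. counit q - \<eta> q) (Suc l) p)"

definition chi :: "('k nc_poly \<Rightarrow> complex) \<Rightarrow> 'k Y_alg \<Rightarrow> complex" where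
  "chi \<mu> = Y_hom id (R_transform \<mu>)"

definition LS :: "('k nc_poly \<Rightarrow> complex) \<Rightarrow> 'k nc_series" where
  "LS \<mu> w = (if 2 \<le> length w then conv_log (chi \<mu>) (Y w) else 0)"

end

theory Submission
  imports Defs "HOL-Computational_Algebra.Polynomial"
begin

text \<open>
For a tuple with free cumulants \<open>f\<close> write \<open>f\<^bsup>n\<^esup>\<close> for the \<open>n\<close>-th power of \<open>f\<close> under boxed convolution. Convolution of
characters of \<open>\<Y>\<close> is boxed convolution of the series that define them, so for fixed \<open>w\<close> the numbers
\<open>(\<epsilon> - \<chi>)\<^sup>l(Y\<^sub>w)\<close> are iterated differences of the sequence \<open>n \<mapsto> f\<^bsup>n\<^esup>(w)\<close>. This sequence is a polynomial \<open>p\<^sub>w\<close> in \<open>n\<close>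
(\<open>box_power_poly\<close>), and the logarithmic series of differences is Newton's formula for the derivative;
hence \<open>LS(w) = p\<^sub>w'(0)\<close> (\<open>LS_eq_derivative\<close>).

If \<open>f\<close> and \<open>g\<close> commute, then the \<open>n\<close>-th power of their boxed convolution is the boxed convolution of
\<open>f\<^bsup>n\<^esup>\<close> and \<open>g\<^bsup>n\<^esup>\<close>. Spelled out at \<open>w\<close>, this is the diagonal value at \<open>(n, n)\<close> of a polynomial in two
variables whose restrictions to the axes are \<open>p\<^sub>w\<close> and \<open>q\<^sub>w\<close>. The derivative along the diagonal at the
origin is the sum of the two partial derivatives, which is the theorem.

What has to be supplied is the dictionary between \<open>\<boxtimes>\<close> and boxed convolution:
\<open>free_mult_conv_with_cumulants\<close> says that the cumulants of a product of free tuples are the boxed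
convolution of the cumulants. Both sides are handled as power series in non-commuting variables,
and identities between such series are proved by comparing constant terms and left derivatives.

  \<^item> Moments come from cumulants through operators on a full Fock space. In this model families of letters
    without mixed cumulants are visibly free (\<open>free_coloured\<close>), which gives free realizations for any
    number of tuples; freeness determines joint moments by centering, so each realization computes
    \<open>\<boxtimes>\<close> (\<open>free_mult_conv_eq\<close>). Associativity of boxed convolution is then inherited from that of the
    product of three free tuples.

  \<^item> Non-crossing partitions are encoded by binary trees in such a way that a partition and its Kreweras
    complement are both read off by recursion on the tree (\<open>kreweras_tree_part\<close>, \<open>bij_betw_tree_part\<close>). Sums over
    non-crossing partitions become recursive, and the boxed convolution satisfies a closed system of
    differential equations (\<open>deriv_box_ext\<close>).

  \<^item> The moments of a product of free tuples satisfy a system of the same kind, and its solution can be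
    written down in terms of the boxed convolution (\<open>mom_mix_interleave\<close>).
\<close>

section \<open>Power series in non-commuting variables\<close>

text \<open>
A copy of the function type, so that multiplication can be the Cauchy product along concatenation
of words.
\<close>

datatype 'k ser = Ser (cf: "'k nc_series")

lemma ser_eqI: "(\<And>w. cf A w = cf B w) \<Longrightarrow> A = B"
  by (cases A; cases B) auto

text \<open>
Since \<open>A = A\<^sub>0 + (\<Sum>i. z\<^sub>i * deriv i A)\<close>, a series is determined by its constant term and its left
derivatives.
\<close>

definition deriv :: "'k \<Rightarrow> 'k ser \<Rightarrow> 'k ser" where
  "deriv i A = Ser (\<lambda>w. cf A (i # w))"

lemma cf_deriv [simp]: "cf (deriv i A) w = cf A (i # w)"
  by (simp add: deriv_def)

definition cst :: "complex \<Rightarrow> 'k ser" where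
  "cst c = Ser (\<lambda>w. if w = [] then c else 0)"

lemma cf_cst: "cf (cst c) w = (if w = [] then c else 0)"
  by (simp add: cst_def)

instantiation ser :: (type) "{zero, one, plus, minus, uminus, times}"
begin

definition "0 = Ser (\<lambda>w. 0)"
definition "1 = cst 1"
definition "A + B = Ser (\<lambda>w. cf A w + cf B w)"
definition "A - B = Ser (\<lambda>w. cf A w - cf B w)"
definition "- A = Ser (\<lambda>w. - cf A w)"
definition "A * B = Ser (\<lambda>w. \<Sum>k\<le>length w. cf A (take k w) * cf B (drop k w))"

instance ..

end

lemma cf_zero [simp]: "cf 0 w = 0"
  and cf_one: "cf 1 w = (if w = [] then 1 else 0)"
  and cf_add [simp]: "cf (A + B) w = cf A w + cf B w"
  and cf_minus [simp]: "cf (A - B) w = cf A w - cf B w"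
  and cf_uminus [simp]: "cf (- A) w = - cf A w"
  by (simp_all add: zero_ser_def one_ser_def plus_ser_def minus_ser_def uminus_ser_def cf_cst)

lemma cf_mult: "cf (A * B) w = (\<Sum>k\<le>length w. cf A (take k w) * cf B (drop k w))"
  by (simp add: times_ser_def)

lemma cf_mult_Nil [simp]: "cf (A * B) [] = cf A [] * cf B []"
  by (simp add: cf_mult)

lemma cf_mult_Cons:
  "cf (A * B) (i # w) = cf A [] * cf B (i # w) + cf (deriv i A * B) w"
  by (simp add: cf_mult sum.atMost_Suc_shift del: sum.atMost_Suc)

lemma mult_add_left: "(A + B) * C = A * C + B * (C :: 'k ser)"
  and mult_add_right: "A * (B + C) = A * B + A * (C :: 'k ser)"
  by (rule ser_eqI; simp add: cf_mult sum.distrib algebra_simps)+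

lemma cf_cst_mult [simp]: "cf (cst c * A) w = c * cf A w"
proof (cases w)
  case (Cons i v)
  have "deriv i (cst c) = 0"
    by (rule ser_eqI) (simp add: cf_cst)
  then show ?thesis
    by (simp add: Cons cf_mult_Cons) (simp add: cf_cst cf_mult)
qed (simp add: cf_cst)

lemma cf_mult_cst [simp]: "cf (A * cst c) w = c * cf A w"
  by (induction w arbitrary: A) (simp_all add: cf_mult_Cons, simp_all add: cf_cst)

lemma deriv_mult: "deriv i (A * B) = deriv i A * B + cst (cf A []) * deriv i B"
  by (rule ser_eqI) (simp add: cf_mult_Cons)

text \<open>
Cutting a word into three pieces by two different orders of cutting: removing the first letter of the
word reduces both sides by the Leibniz rule to shorter words.
\<close>

lemma mult_assoc_aux: "cf (A * B * C) w = cf (A * (B * C)) w" for A :: "'k ser"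
proof (induction w arbitrary: A B C)
  case (Cons i w)
  show ?case
    by (simp add: cf_mult_Cons deriv_mult mult_add_left Cons.IH algebra_simps)
qed simp

instance ser :: (type) ring_1
proof
  fix A B C :: "'a ser"
  show "A * B * C = A * (B * C)"
    by (rule ser_eqI) (rule mult_assoc_aux)
  show "1 * A = A" "A * 1 = A"
    by (rule ser_eqI, simp add: one_ser_def)+
  show "(0 :: 'a ser) \<noteq> 1"
    by (metis cf_one cf_zero zero_neq_one)
  show "(A + B) * C = A * C + B * C" "A * (B + C) = A * B + A * C"
    by (fact mult_add_left mult_add_right)+
qed (rule ser_eqI; simp)+

lemma cf_sum [simp]: "cf (sum A S) w = (\<Sum>x\<in>S. cf (A x) w)"
  by (induction S rule: infinite_finite_induct) simp_all

lemma cst_commute: "A * cst c = cst c * A"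
  by (rule ser_eqI) simp

lemma cst_mult: "cst a * cst b = cst (a * b)"
  by (rule ser_eqI) (simp, simp add: cf_cst)

lemma cst_0 [simp]: "cst 0 = 0" and cst_1 [simp]: "cst 1 = 1"
  by (rule ser_eqI; simp add: cf_cst cf_one)+

lemma cf_one_Nil [simp]: "cf 1 [] = 1"
  and cf_cst_Nil [simp]: "cf (cst c) [] = c"
  by (simp_all add: cf_one cf_cst)

lemma deriv_add [simp]: "deriv i (A + B) = deriv i A + deriv i B"
  and deriv_minus [simp]: "deriv i (A - B) = deriv i A - deriv i B"
  and deriv_cst [simp]: "deriv i (cst c) = 0"
  and deriv_one [simp]: "deriv i 1 = 0"
  and deriv_zero [simp]: "deriv i 0 = 0"
  and deriv_sum [simp]: "deriv i (sum F S) = (\<Sum>x\<in>S. deriv i (F x))"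
  and deriv_cst_mult [simp]: "deriv i (cst c * A) = cst c * deriv i A"
  by (rule ser_eqI; simp add: cf_cst cf_one)+

definition var :: "'k \<Rightarrow> 'k ser" where
  "var i = Ser (\<lambda>w. if w = [i] then 1 else 0)"

lemma cf_var_Nil [simp]: "cf (var i) [] = 0"
  by (simp add: var_def)

lemma deriv_var [simp]: "deriv i (var j) = (if i = j then 1 else 0)"
  by (rule ser_eqI) (simp add: var_def cf_one)

lemma deriv_mult_var: "deriv i (A * var x * B) = deriv i A * var x * B + (if i = x then cst (cf A []) * B else 0)"
  by (simp add: deriv_mult mult.assoc)

lemma cf_mult_var:
  "cf (A * var x * B) w = (\<Sum>k<length w. if w ! k = x then cf A (take k w) * cf B (drop (Suc k) w) else 0)"
proof (induction w arbitrary: A)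
  case (Cons i w)
  have "cf (A * var x * B) (i # w) = cf (deriv i (A * var x * B)) w"
    by simp
  also have "\<dots> = cf (deriv i A * var x * B) w + (if i = x then cf A [] * cf B w else 0)"
    by (simp add: deriv_mult_var)
  finally show ?case
    by (simp add: Cons.IH sum.lessThan_Suc_shift cong: if_cong del: sum.lessThan_Suc)
qed simp

text \<open>
Equality of two series defined by a system of equations between left derivatives is shown by
induction on the length of words; \<open>agree_Suc\<close> is the step of this induction, and the congruence rules
let the induction hypothesis act below sums and products.
\<close>

definition agree :: "nat \<Rightarrow> 'k ser \<Rightarrow> 'k ser \<Rightarrow> bool" where
  "agree n A B \<longleftrightarrow> (\<forall>w. length w \<le> n \<longrightarrow> cf A w = cf B w)"

lemma agree_refl [simp, intro]: "agree n A A"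
  by (simp add: agree_def)

lemma agree_all: "(\<And>n. agree n A B) \<Longrightarrow> A = B"
  unfolding agree_def by (rule ser_eqI) blast

lemma agree_add: "agree n A B \<Longrightarrow> agree n C D \<Longrightarrow> agree n (A + C) (B + D)"
  and agree_minus: "agree n A B \<Longrightarrow> agree n C D \<Longrightarrow> agree n (A - C) (B - D)"
  by (simp_all add: agree_def)

lemma agree_mult: "agree n A B \<Longrightarrow> agree n C D \<Longrightarrow> agree n (A * C) (B * D)"
  unfolding agree_def cf_mult by (auto intro!: sum.cong)

lemma agree_sum: "(\<And>x. x \<in> S \<Longrightarrow> agree n (A x) (B x)) \<Longrightarrow> agree n (sum A S) (sum B S)"
  unfolding agree_def by (auto intro!: sum.cong)

lemma agree_0: "agree 0 A B \<longleftrightarrow> cf A [] = cf B []"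
  by (simp add: agree_def)

lemma agree_Suc: "agree (Suc n) A B \<longleftrightarrow> cf A [] = cf B [] \<and> (\<forall>i. agree n (deriv i A) (deriv i B))"
  unfolding agree_def
proof (intro iffI conjI allI impI)
  fix w :: "'a list"
  assume *: "cf A [] = cf B [] \<and>
    (\<forall>i w. length w \<le> n \<longrightarrow> cf (deriv i A) w = cf (deriv i B) w)" "length w \<le> Suc n"
  then show "cf A w = cf B w" by (cases w) auto
qed auto

text \<open>
A variable between two factors takes up one letter of each word, so the factors are needed only up to
the smaller length.
\<close>

lemma agree_mult_var:
  assumes "agree n A A'" "agree n B B'"
  shows "agree (Suc n) (A * var x * B) (A' * var x * B')"
  using assms unfolding agree_def cf_mult_var by (auto intro!: sum.cong)

lemmas agree_intros = agree_add agree_minus agree_mult agree_sum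

text \<open>
The series \<open>f(z\<^sub>1 Y\<^sub>1, \<dots>, z\<^sub>k Y\<^sub>k)\<close>. The recursion equation is the chain rule for left derivatives,
see \<open>deriv_subst\<close>; the factor \<open>z\<^sub>i\<close> in front of \<open>Y\<^sub>i\<close> is what makes the substitution well-founded.
\<close>

function subst_fun :: "('k list \<Rightarrow> complex) \<Rightarrow> ('k \<Rightarrow> 'k ser) \<Rightarrow> 'k list \<Rightarrow> complex" where
  "subst_fun f Z [] = f []"
| "subst_fun f Z (i # w) =
     (\<Sum>k\<le>length w. cf (Z i) (take k w) * subst_fun (\<lambda>u. f (i # u)) Z (drop k w))"
  by pat_completeness auto
termination
  by (relation "measure (\<lambda>(f, Z, w). length w)") auto

definition subst :: "'k ser \<Rightarrow> ('k \<Rightarrow> 'k ser) \<Rightarrow> 'k ser" where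
  "subst A Z = Ser (subst_fun (cf A) Z)"

lemma cf_subst_Nil [simp]: "cf (subst A Z) [] = cf A []"
  by (simp add: subst_def)

lemma deriv_subst: "deriv i (subst A Z) = Z i * subst (deriv i A) Z"
  by (rule ser_eqI) (simp add: subst_def cf_mult deriv_def)

lemma subst_add: "subst (A + B) Z = subst A Z + subst B Z"
proof (rule agree_all)
  show "agree n (subst (A + B) Z) (subst A Z + subst B Z)" for n
    by (induction n arbitrary: A B)
      (auto simp: agree_0 agree_Suc deriv_subst distrib_left[symmetric] intro!: agree_mult)
qed

lemma subst_cst_mult: "subst (cst c * A) Z = cst c * subst A Z"
proof (rule agree_all)
  show "agree n (subst (cst c * A) Z) (cst c * subst A Z)" for n
  proof (induction n arbitrary: A)
    case (Suc n)
    have "cst c * (Z i * B) = Z i * (cst c * B)" for i B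
      by (simp add: mult.assoc[symmetric] cst_commute)
    with Suc.IH show ?case
      by (auto simp: agree_Suc deriv_subst intro!: agree_mult)
  qed (auto simp: agree_0)
qed

lemma subst_minus: "subst (A - B) Z = subst A Z - subst B Z"
proof -
  have "subst (A - B) Z + subst B Z = subst A Z"
    by (simp flip: subst_add)
  then show ?thesis by (simp add: algebra_simps)
qed

lemma subst_0 [simp]: "subst 0 Z = 0"
  using subst_add[of 0 0 Z] by simp

lemma subst_cst [simp]: "subst (cst c) Z = cst c"
proof (rule agree_all)
  show "agree n (subst (cst c) Z) (cst c)" for n
    by (cases n) (auto simp: agree_0 agree_Suc deriv_subst)
qed

lemma subst_mult: "subst (A * B) Z = subst A Z * subst B Z"
proof (rule agree_all)
  show "agree n (subst (A * B) Z) (subst A Z * subst B Z)" for n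
  proof (induction n arbitrary: A B)
    case (Suc n)
    have "agree n (deriv i (subst (A * B) Z)) (deriv i (subst A Z * subst B Z))" for i
    proof -
      have "deriv i (subst (A * B) Z) =
          Z i * subst (deriv i A * B) Z + cst (cf A []) * (Z i * subst (deriv i B) Z)"
        by (simp add: deriv_subst deriv_mult subst_add subst_cst_mult distrib_left
            mult.assoc[symmetric] cst_commute)
      moreover have "deriv i (subst A Z * subst B Z) =
          Z i * (subst (deriv i A) Z * subst B Z) + cst (cf A []) * (Z i * subst (deriv i B) Z)"
        by (simp add: deriv_subst deriv_mult mult.assoc)
      ultimately show ?thesis
        using Suc.IH by (auto intro!: agree_intros)
    qed
    then show ?case by (simp add: agree_Suc)
  qed (simp add: agree_0)
qed

section \<open>Linear functionals on monoid algebras\<close>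

definition lin_ext :: "('m \<Rightarrow> complex) \<Rightarrow> ('m \<Rightarrow>\<^sub>0 complex) \<Rightarrow> complex" where
  "lin_ext v p = (\<Sum>m\<in>Poly_Mapping.keys p. Poly_Mapping.lookup p m * v m)"

lemma lin_ext_superset:
  assumes "finite S" "Poly_Mapping.keys p \<subseteq> S"
  shows "lin_ext v p = (\<Sum>m\<in>S. Poly_Mapping.lookup p m * v m)"
  unfolding lin_ext_def
  by (rule sum.mono_neutral_left) (use assms in \<open>auto simp: in_keys_iff\<close>)

lemma lin_ext_add: "lin_ext v (p + q) = lin_ext v p + lin_ext v q"
proof -
  let ?S = "Poly_Mapping.keys p \<union> Poly_Mapping.keys q"
  have "Poly_Mapping.keys (p + q) \<subseteq> ?S"
    by (rule keys_add)
  then show ?thesis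
    by (simp add: lin_ext_superset[of ?S] lookup_add sum.distrib algebra_simps)
qed

lemma lin_ext_single [simp]: "lin_ext v (Poly_Mapping.single m c) = c * v m"
  by (simp add: lin_ext_def)

lemma lin_ext_0 [simp]: "lin_ext v 0 = 0"
  by (simp add: lin_ext_def)

lemma lin_ext_scale: "lin_ext v (pm_scale c p) = c * lin_ext v p"
proof (induction p rule: poly_mapping_add_induct)
  case (single k x)
  have "pm_scale c (Poly_Mapping.single k x) = Poly_Mapping.single k (c * x)"
    by (rule poly_mapping_eqI) (simp add: lookup_pm_scale lookup_single when_def)
  then show ?case by simp
next
  case (sum f g)
  have "pm_scale c (f + g) = pm_scale c f + pm_scale c g"
    by (rule poly_mapping_eqI) (simp add: lookup_pm_scale lookup_add algebra_simps)
  then show ?case using sum by (simp add: lin_ext_add algebra_simps)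
qed

lemma lin_ext_sum: "lin_ext v (sum f S) = (\<Sum>x\<in>S. lin_ext v (f x))"
  by (induction S rule: infinite_finite_induct) (simp_all add: lin_ext_add)

lemma lin_ext_mult:
  fixes v :: "'m::monoid_add \<Rightarrow> complex"
  assumes "\<And>m n. v (m + n) = v m * v n"
  shows "lin_ext v (p * q) = lin_ext v p * lin_ext v q"
proof (induction p rule: poly_mapping_add_induct)
  case (single k c)
  show ?case
    by (induction q rule: poly_mapping_add_induct)
      (simp_all add: mult_single assms distrib_left lin_ext_add)
qed (simp add: distrib_right lin_ext_add)

lemma linear_pm_scale_iff:
  fixes \<mu> :: "'k nc_poly \<Rightarrow> complex"
  shows "Vector_Spaces.linear pm_scale (*) \<mu> \<longleftrightarrow>
    (\<forall>p q. \<mu> (p + q) = \<mu> p + \<mu> q) \<and> (\<forall>c p. \<mu> (pm_scale c p) = c * \<mu> p)"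
proof -
  interpret complex_algebra "pm_scale :: complex \<Rightarrow> 'k nc_poly \<Rightarrow> 'k nc_poly"
    by (rule complex_algebra_pm_scale)
  have "vector_space (pm_scale :: complex \<Rightarrow> 'k nc_poly \<Rightarrow> 'k nc_poly)"
    "vector_space ((*) :: complex \<Rightarrow> complex \<Rightarrow> complex)"
    by unfold_locales (auto simp: algebra_simps)
  then show ?thesis
    by (auto simp: Vector_Spaces.linear_iff)
qed

lemma linear_eq_lin_ext:
  fixes \<mu> :: "'k nc_poly \<Rightarrow> complex"
  assumes "Vector_Spaces.linear pm_scale (*) \<mu>"
  shows "\<mu> p = lin_ext (\<lambda>m. \<mu> (X_word (letters m))) p"
proof (induction p rule: poly_mapping_add_induct)
  case (single k c)
  have "Poly_Mapping.single k c = pm_scale c (X_word (letters k))"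
    by (rule poly_mapping_eqI) (simp add: lookup_pm_scale X_word_def lookup_single when_def)
  then show ?case using assms by (simp add: linear_pm_scale_iff lin_ext_scale X_word_def)
next
  case (sum f g)
  then show ?case using assms by (simp add: lin_ext_add linear_pm_scale_iff)
qed

lemma linear_functional_eqI:
  fixes \<mu> \<nu> :: "'k nc_poly \<Rightarrow> complex"
  assumes "Vector_Spaces.linear pm_scale (*) \<mu>" "Vector_Spaces.linear pm_scale (*) \<nu>"
    and "\<And>w. \<mu> (X_word w) = \<nu> (X_word w)"
  shows "\<mu> = \<nu>"
proof
  show "\<mu> p = \<nu> p" for p
    unfolding linear_eq_lin_ext[OF assms(1), of p] linear_eq_lin_ext[OF assms(2), of p] assms(3) ..
qed

definition functional :: "'k ser \<Rightarrow> 'k nc_poly \<Rightarrow> complex" where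
  "functional M = lin_ext (\<lambda>m. cf M (letters m))"

lemma functional_X_word [simp]: "functional M (X_word w) = cf M w"
  by (simp add: functional_def X_word_def)

lemma linear_functional: "Vector_Spaces.linear pm_scale (*) (functional M)"
  by (simp add: linear_pm_scale_iff functional_def lin_ext_add lin_ext_scale)

lemma nc_prob_space_functional:
  assumes "cf M [] = 1"
  shows "nc_prob_space pm_scale (functional M)"
  unfolding nc_prob_space_def nc_prob_space_axioms_def
  using complex_algebra_pm_scale linear_functional assms by (auto simp: one_nc_poly)

lemma X_word_append: "X_word u * X_word v = X_word (u @ v)"
  by (simp add: X_word_def mult_single plus_nc_monom_def)

lemma prod_list_X_word: "prod_list (map (\<lambda>x. X_word (f x)) w) = X_word (concat (map f w))"
  by (induction w) (simp_all add: one_nc_poly X_word_append)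

lemma distribution_functional:
  "distribution (functional M) (\<lambda>i. X_word (f i)) = functional (Ser (\<lambda>w. cf M (concat (map f w))))"
  by (rule ext) (simp add: distribution_def functional_def lin_ext_def prod_list_X_word,
      simp add: X_word_def)

lemma distribution_X_word: "distribution \<phi> a (X_word w) = \<phi> (prod_list (map a w))"
  by (simp add: distribution_def X_word_def)

section \<open>Moments from cumulants on the full Fock space\<close>

text \<open>
On the full Fock space with basis the words over \<open>'c\<close>, the canonical operator of the letter \<open>j\<close> is
\<open>v \<mapsto> j v + (\<Sum>v = p q. R(j p) q)\<close>: it creates \<open>j\<close> or annihilates a prefix. Operators act here from the right
on linear functionals, and the functional \<open>F\<close> is recorded by the series of its values at basis words.
No finiteness of support is needed for this, and \<open>fock R F w\<close> is \<open>F\<close> composed with the product of the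
operators of the letters of \<open>w\<close>.
\<close>

definition fock_step :: "'c ser \<Rightarrow> 'c ser \<Rightarrow> 'c \<Rightarrow> 'c ser" where
  "fock_step R F j = deriv j F + deriv j R * F"

definition fock :: "'c ser \<Rightarrow> 'c ser \<Rightarrow> 'c list \<Rightarrow> 'c ser" where
  "fock R = foldl (fock_step R)"

lemma fock_Nil [simp]: "fock R F [] = F"
  and fock_Cons [simp]: "fock R F (j # w) = fock R (fock_step R F j) w"
  and fock_append: "fock R F (u @ w) = fock R (fock R F u) w"
  by (simp_all add: fock_def)

lemma fock_add: "fock R (F + G) w = fock R F w + fock R G w"
proof (induction w arbitrary: F G)
  case (Cons j w)
  have "fock_step R (F + G) j = fock_step R F j + fock_step R G j"
    by (simp add: fock_step_def algebra_simps)
  then show ?case by (simp add: Cons.IH)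
qed simp

lemma fock_cst_mult: "fock R (cst c * F) w = cst c * fock R F w"
proof (induction w arbitrary: F)
  case (Cons j w)
  have "fock_step R (cst c * F) j = cst c * fock_step R F j"
    by (simp add: fock_step_def distrib_left mult.assoc[symmetric] cst_commute)
  then show ?case by (simp add: Cons.IH)
qed simp

text \<open>
Vacuum expectations of products of canonical operators. The series \<open>1\<close> is the vacuum functional. A
prefix that is annihilated by \<open>j\<close> consists of the later members of the block of \<open>j\<close>, so these are the
moments with free cumulants \<open>R\<close>; see \<open>sum_NC_Cf_part\<close>.
\<close>

definition mom :: "'c ser \<Rightarrow> 'c ser" where
  "mom R = Ser (\<lambda>w. cf (fock R 1 w) [])"

lemma cf_mom_Nil [simp]: "cf (mom R) [] = 1"
  by (simp add: mom_def)

text \<open>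
Read the letters that are created and never annihilated: between them stand products of operators
that return to the vacuum. So the value of \<open>F\<close> at the product of operators applied to the vacuum is the
corresponding coefficient of \<open>M F(z\<^sub>1 M, \<dots>, z\<^sub>k M)\<close>, where \<open>M\<close> is the series of moments.
\<close>

lemma fock_vacuum: "Ser (\<lambda>w. cf (fock R F w) []) = mom R * subst F (\<lambda>_. mom R)"
proof (rule agree_all)
  let ?V = "\<lambda>F. Ser (\<lambda>w. cf (fock R F w) [])"
  have dV: "deriv j (?V F) = ?V (fock_step R F j)" for j F
    by (rule ser_eqI) simp
  show "agree n (?V F) (mom R * subst F (\<lambda>_. mom R))" for n
  proof (induction n arbitrary: F)
    case (Suc n)
    have "agree n (deriv j (?V F)) (deriv j (mom R * subst F (\<lambda>_. mom R)))" for j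
    proof -
      have m: "deriv j (mom R) = ?V (deriv j R)"
        using dV[of j 1] by (simp add: mom_def fock_step_def)
      have "deriv j (?V F) = ?V (deriv j R * F) + ?V (deriv j F)"
        by (rule ser_eqI) (simp add: fock_step_def fock_add)
      moreover have "deriv j (mom R * subst F (\<lambda>_. mom R)) =
          ?V (deriv j R) * subst F (\<lambda>_. mom R) + mom R * subst (deriv j F) (\<lambda>_. mom R)"
        by (simp add: deriv_mult m deriv_subst)
      moreover have "agree n (?V (deriv j R * F)) (?V (deriv j R) * subst F (\<lambda>_. mom R))"
      proof -
        have "agree n (?V (deriv j R * F)) (mom R * subst (deriv j R) (\<lambda>_. mom R) * subst F (\<lambda>_. mom R))"
          using Suc.IH[of "deriv j R * F"] by (simp add: subst_mult mult.assoc)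
        moreover have "agree n (?V (deriv j R) * subst F (\<lambda>_. mom R))
            (mom R * subst (deriv j R) (\<lambda>_. mom R) * subst F (\<lambda>_. mom R))"
          by (intro agree_mult Suc.IH) simp
        ultimately show ?thesis by (simp add: agree_def)
      qed
      ultimately show ?thesis
        using Suc.IH by (auto intro!: agree_add)
    qed
    then show ?case by (simp add: agree_Suc)
  qed (simp add: agree_0)
qed

lemma deriv_mom: "deriv j (mom R) = mom R * subst (deriv j R) (\<lambda>_. mom R)"
proof -
  have "deriv j (mom R) = Ser (\<lambda>w. cf (fock R (deriv j R) w) [])"
    by (rule ser_eqI) (simp add: mom_def fock_step_def)
  then show ?thesis by (simp add: fock_vacuum)
qed

text \<open>
The functional equation \<open>M = R(z\<^sub>1 M, \<dots>, z\<^sub>k M)\<close> between moments and free cumulants. Here and below the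
constant term of a cumulant series is normalized to \<open>1\<close>.
\<close>

lemma mom_fixpoint: "cf R [] = 1 \<Longrightarrow> subst R (\<lambda>_. mom R) = mom R"
proof -
  assume 1: "cf R [] = 1"
  show ?thesis
  proof (rule ser_eqI)
    fix w show "cf (subst R (\<lambda>_. mom R)) w = cf (mom R) w"
    proof (cases w)
      case (Cons i v)
      have "deriv i (subst R (\<lambda>_. mom R)) = deriv i (mom R)"
        by (simp add: deriv_mom deriv_subst)
      then show ?thesis by (metis Cons cf_deriv)
    qed (simp add: 1)
  qed
qed

section \<open>Vanishing mixed cumulants imply freeness\<close>

definition fock_poly :: "'c ser \<Rightarrow> 'c ser \<Rightarrow> 'c nc_poly \<Rightarrow> 'c ser" where
  "fock_poly R F p = Ser (\<lambda>v. lin_ext (\<lambda>m. cf (fock R F (letters m)) v) p)"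

lemma fock_poly_add: "fock_poly R F (p + q) = fock_poly R F p + fock_poly R F q"
  by (rule ser_eqI) (simp add: fock_poly_def lin_ext_add)

lemma fock_poly_single: "fock_poly R F (Poly_Mapping.single m c) = cst c * fock R F (letters m)"
  by (rule ser_eqI) (simp add: fock_poly_def)

lemma fock_poly_add_left: "fock_poly R (F + G) p = fock_poly R F p + fock_poly R G p"
  by (rule ser_eqI) (simp add: fock_poly_def lin_ext_def fock_add sum.distrib algebra_simps)

lemma fock_poly_mult: "fock_poly R F (p * q) = fock_poly R (fock_poly R F p) q"
proof (induction p rule: poly_mapping_add_induct)
  case (single k c)
  show ?case
  proof (induction q rule: poly_mapping_add_induct)
    case (single l d)
    have "cst (c * d) * G = cst d * (cst c * G)" for G :: "'a ser"
      by (simp add: mult.assoc[symmetric] cst_mult mult.commute)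
    then show ?case
      by (simp add: mult_single fock_poly_single plus_nc_monom_def fock_append fock_cst_mult)
  qed (simp add: distrib_left fock_poly_add)
qed (simp add: distrib_right fock_poly_add fock_poly_add_left)

lemma functional_mom: "functional (mom R) p = cf (fock_poly R 1 p) []"
  by (simp add: functional_def fock_poly_def mom_def)

definition coloured :: "('c \<Rightarrow> bool) \<Rightarrow> bool \<Rightarrow> 'c nc_poly set" where
  "coloured col i = {p. \<forall>m\<in>Poly_Mapping.keys p. \<forall>x\<in>set (letters m). col x = i}"

lemma unital_subalgebra_coloured: "unital_subalgebra pm_scale (coloured col i)"
proof -
  have "p * q \<in> coloured col i" if "p \<in> coloured col i" "q \<in> coloured col i" for p q
    using that keys_mult[of p q] by (fastforce simp: coloured_def plus_nc_monom_def)
  moreover have "p + q \<in> coloured col i" if "p \<in> coloured col i" "q \<in> coloured col i" for p q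
    using that keys_add[of p q] by (fastforce simp: coloured_def)
  moreover have "pm_scale c p \<in> coloured col i" if "p \<in> coloured col i" for p c
    using that by (auto simp: coloured_def in_keys_iff lookup_pm_scale)
  moreover have "1 \<in> coloured col i"
    by (simp add: coloured_def one_nc_poly X_word_def)
  ultimately show ?thesis
    unfolding unital_subalgebra_def by blast
qed

text \<open>
If mixed cumulants vanish, operators of colour \<open>i\<close> never annihilate beyond the letters of colour \<open>i\<close> at
the front of a word, so the rest \<open>v\<close> of the word is a spectator.
\<close>

lemma fock_restrict:
  assumes mixed: "\<And>w x y. x \<in> set w \<Longrightarrow> y \<in> set w \<Longrightarrow> col x \<noteq> col y \<Longrightarrow> cf R w = 0"
    and v: "v = [] \<or> col (hd v) \<noteq> i"
    and w: "\<forall>x\<in>set w. col x = i"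
    and FG: "\<And>u. \<forall>x\<in>set u. col x = i \<Longrightarrow> cf F (u @ v) = cf G u"
    and u: "\<forall>x\<in>set u. col x = i"
  shows "cf (fock R F w) (u @ v) = cf (fock R G w) u"
  using w FG
proof (induction w arbitrary: F G)
  case (Cons j w)
  have "cf (fock_step R F j) (u @ v) = cf (fock_step R G j) u" if u: "\<forall>x\<in>set u. col x = i" for u
  proof -
    have zero: "cf R (j # take k (u @ v)) = 0" if "k \<in> {..length (u @ v)} - {..length u}" for k
    proof -
      from that obtain y v' where y: "v = y # v'" by (cases v) auto
      with that have "y \<in> set (j # take k (u @ v))" by (cases "k - length u") auto
      then show ?thesis using v y Cons.prems(1) by (intro mixed[of j _ y]) auto
    qed
    have "cf (deriv j R * F) (u @ v) = (\<Sum>k\<le>length u. cf R (j # take k (u @ v)) * cf F (drop k (u @ v)))"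
      unfolding cf_mult by (rule sum.mono_neutral_cong_right) (use zero in auto)
    also have "\<dots> = cf (deriv j R * G) u"
      unfolding cf_mult
    proof (rule sum.cong)
      fix k assume k: "k \<in> {..length u}"
      have "cf F (drop k u @ v) = cf G (drop k u)"
        using u by (intro Cons.prems) (auto dest: in_set_dropD)
      then show "cf R (j # take k (u @ v)) * cf F (drop k (u @ v)) =
          cf (deriv j R) (take k u) * cf G (drop k u)"
        using k by simp
    qed simp
    finally show ?thesis
      using Cons.prems(1) Cons.prems(2)[of "j # u"] u by (simp add: fock_step_def)
  qed
  then show ?case using Cons.prems(1) by (simp add: Cons.IH)
qed (use u in simp)

text \<open>
Let \<open>p\<close> be a centered polynomial of colour \<open>i\<close>, and let \<open>F\<close> vanish on all words starting with colour \<open>i\<close>.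
By \<open>fock_restrict\<close>, \<open>F\<close> composed with \<open>p\<close> vanishes at the empty word and on all words starting with the
other colour. The vacuum functional vanishes on all nonempty words, so an alternating product of centered
polynomials can be removed factor by factor.
\<close>

lemma free_coloured:
  assumes mixed: "\<And>w x y. x \<in> set w \<Longrightarrow> y \<in> set w \<Longrightarrow> col x \<noteq> col y \<Longrightarrow> cf R w = 0"
    and S: "S \<subseteq> coloured col True" and T: "T \<subseteq> coloured col False"
  shows "freely_independent pm_scale (functional (mom R)) S T"
  unfolding freely_independent_def free_subalgebras_def
proof (intro allI impI)
  fix cs :: "(bool \<times> 'a nc_poly) list"
  assume ne: "cs \<noteq> []"
    and cs: "\<forall>(i, c)\<in>set cs. c \<in> (if i then unital_subalgebra pm_scale hull S
         else unital_subalgebra pm_scale hull T) \<and> functional (mom R) c = 0"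
    and alt: "\<forall>j. Suc j < length cs \<longrightarrow> fst (cs ! j) \<noteq> fst (cs ! Suc j)"
  have "unital_subalgebra pm_scale hull S \<subseteq> coloured col True"
    and "unital_subalgebra pm_scale hull T \<subseteq> coloured col False"
    by (intro hull_minimal S T unital_subalgebra_coloured)+
  then have col: "\<forall>(i, c)\<in>set cs. c \<in> coloured col i \<and> functional (mom R) c = 0"
    using cs by (fastforce split: if_splits)
  have kill: "cf (fock_poly R F p) v = 0"
    if F: "\<And>v. v \<noteq> [] \<Longrightarrow> col (hd v) = i \<Longrightarrow> cf F v = 0"
      and p: "p \<in> coloured col i" "functional (mom R) p = 0"
      and v: "v = [] \<or> col (hd v) \<noteq> i" for F p i v
  proof -
    have "cf (fock R F (letters m)) v = cf F v * cf (mom R) (letters m)" if "m \<in> Poly_Mapping.keys p" for m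
    proof -
      have "cf (fock R F (letters m)) ([] @ v) = cf (fock R (cst (cf F v)) (letters m)) []"
      proof (rule fock_restrict[where col = col and i = i, OF mixed v])
        show "\<forall>x\<in>set (letters m). col x = i"
          using p(1) that by (auto simp: coloured_def)
        show "cf F (u @ v) = cf (cst (cf F v)) u" if "\<forall>x\<in>set u. col x = i" for u
          using that F[of "u @ v"] by (cases u) (auto simp: cf_cst)
      qed auto
      also have "cst (cf F v) = cst (cf F v) * 1" by simp
      finally show ?thesis by (simp only: fock_cst_mult) (simp add: mom_def)
    qed
    then have "cf (fock_poly R F p) v = cf F v * functional (mom R) p"
      by (simp add: fock_poly_def functional_def lin_ext_def sum_distrib_left algebra_simps)
    then show ?thesis by (simp add: p(2))
  qed
  have "cf (fock_poly R F (prod_list (map snd cs))) [] = 0"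
    if "\<And>v. v \<noteq> [] \<Longrightarrow> col (hd v) = fst (hd cs) \<Longrightarrow> cf F v = 0" for F
    using ne col alt that
  proof (induction cs arbitrary: F)
    case (Cons ic cs)
    obtain i c where ic: "ic = (i, c)" by (cases ic)
    have k: "cf (fock_poly R F c) v = 0" if "v = [] \<or> col (hd v) \<noteq> i" for v
      using Cons.prems(2,4) ic that by (intro kill[of i]) auto
    show ?case
    proof (cases cs)
      case Nil
      then show ?thesis by (simp add: ic k)
    next
      case (Cons jd cs')
      have "fst jd \<noteq> i"
        using Cons.prems(3)[rule_format, of 0] by (simp add: ic Cons)
      then have "cf (fock_poly R (fock_poly R F c) (prod_list (map snd cs))) [] = 0"
        using Cons.prems(2,3) by (intro Cons.IH) (fastforce simp: Cons intro!: k)+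
      then show ?thesis by (simp add: ic fock_poly_mult)
    qed
  qed simp
  moreover have "cf 1 v = 0" if "v \<noteq> []" for v :: "'a list"
    using that by (simp add: cf_one)
  ultimately show "functional (mom R) (prod_list (map snd cs)) = 0"
    by (simp add: functional_mom)
qed

section \<open>Free realizations determine the convolution\<close>

text \<open>
Induction on the number of factors. Neighbours from the same subalgebra are merged. In an alternating
product the factors are centered from left to right; each centering splits off a shorter product, and
once all factors are centered both functionals vanish by freeness.
\<close>

lemma free_functionals_agree:
  assumes \<phi>: "nc_prob_space scale \<phi>" and \<psi>: "nc_prob_space scale \<psi>"
    and sub: "unital_subalgebra scale A" "unital_subalgebra scale B"
    and free: "free_subalgebras \<phi> A B" "free_subalgebras \<psi> A B"
    and eq: "\<And>x. x \<in> A \<union> B \<Longrightarrow> \<phi> x = \<psi> x"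
    and cs: "\<forall>(i, c)\<in>set cs. c \<in> (if i then A else B)"
  shows "\<phi> (prod_list (map snd cs)) = \<psi> (prod_list (map snd cs))"
  using cs
proof (induction "length cs" arbitrary: cs rule: less_induct)
  case less
  interpret \<phi>: nc_prob_space scale \<phi> by fact
  interpret \<psi>: nc_prob_space scale \<psi> by fact
  have one: "1 \<in> A" "1 \<in> B" using sub by (auto simp: unital_subalgebra_def)
  show ?case
  proof (cases "\<forall>j. Suc j < length cs \<longrightarrow> fst (cs ! j) \<noteq> fst (cs ! Suc j)")
    case False
    then obtain j where j: "Suc j < length cs" "fst (cs ! j) = fst (cs ! Suc j)" by blast
    obtain i a b where interleave: "cs ! j = (i, a)" "cs ! Suc j = (i, b)"
      using j(2) by (cases "cs ! j"; cases "cs ! Suc j") auto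
    have dec: "cs = take j cs @ (i, a) # (i, b) # drop (Suc (Suc j)) cs"
      using j(1) interleave by (metis Cons_nth_drop_Suc Suc_lessD append_take_drop_id)
    let ?ds = "take j cs @ (i, a * b) # drop (Suc (Suc j)) cs"
    have p: "prod_list (map snd cs) = prod_list (map snd ?ds)"
      by (subst dec) (simp add: mult.assoc)
    have "a \<in> (if i then A else B)" "b \<in> (if i then A else B)"
      using less.prems j(1) interleave nth_mem[of j cs] nth_mem[of "Suc j" cs] by auto
    then have "a * b \<in> (if i then A else B)"
      using sub by (auto simp: unital_subalgebra_def)
    then have "\<forall>(i, c)\<in>set ?ds. c \<in> (if i then A else B)"
      using less.prems by (auto dest!: in_set_takeD in_set_dropD)
    moreover have "length ?ds < length cs" using j(1) by simp
    ultimately show ?thesis unfolding p by (intro less.hyps)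
  next
    case alt: True
    have "\<phi> (prod_list (map snd (pre @ post))) = \<psi> (prod_list (map snd (pre @ post)))"
      if "map fst (pre @ post) = map fst cs"
        and "\<forall>(i, c)\<in>set (pre @ post). c \<in> (if i then A else B)"
        and "\<forall>(i, c)\<in>set pre. \<phi> c = 0" for pre post
      using that
    proof (induction post arbitrary: pre)
      case Nil
      have len: "length pre = length cs"
        using Nil(1) by (metis append_Nil2 length_map)
      have nth: "fst (pre ! j) = fst (cs ! j)" if "j < length cs" for j
        using Nil(1) that len by (metis append_Nil2 nth_map)
      show ?case
      proof (cases "pre = []")
        case True
        then show ?thesis by (simp add: \<phi>.unit \<psi>.unit)
      next
        case False
        have alt': "\<forall>j. Suc j < length pre \<longrightarrow> fst (pre ! j) \<noteq> fst (pre ! Suc j)"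
          using alt nth len by auto
        have c: "\<forall>(i, c)\<in>set pre. c \<in> (if i then A else B) \<and> \<phi> c = 0"
          using Nil by auto
        then have c': "\<forall>(i, c)\<in>set pre. c \<in> (if i then A else B) \<and> \<psi> c = 0"
          using eq by (fastforce split: if_splits)
        have "\<phi> (prod_list (map snd pre)) = 0"
          using free(1) False c alt' by (simp add: free_subalgebras_def)
        moreover have "\<psi> (prod_list (map snd pre)) = 0"
          using free(2) False c' alt' by (simp add: free_subalgebras_def)
        ultimately show ?thesis by simp
      qed
    next
      case (Cons ic post)
      obtain i c where ic: "ic = (i, c)" by (cases ic)
      \<comment> \<open>the centered part of the factor \<open>c\<close>\<close>
      define d where "d = c - scale (\<phi> c) 1"
      have cd: "c = d + scale (\<phi> c) 1" by (simp add: d_def)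
      have d: "d = c + scale (- \<phi> c) 1" by (simp add: d_def)
      have cA: "c \<in> (if i then A else B)" using Cons.prems(2) ic by simp
      have "x + scale k 1 \<in> (if i then A else B)" if "x \<in> (if i then A else B)" for x k
        using that sub by (auto simp: unital_subalgebra_def)
      from this[OF cA] have dA: "d \<in> (if i then A else B)"
        unfolding d .
      have d0: "\<phi> d = 0" by (simp add: d_def \<phi>.diff \<phi>.scale \<phi>.unit)
      have IH: "\<phi> (prod_list (map snd ((pre @ [(i, d)]) @ post))) =
          \<psi> (prod_list (map snd ((pre @ [(i, d)]) @ post)))"
        using Cons.prems ic dA d0 by (intro Cons.IH) auto
      have "length (pre @ post) < length cs"
        using arg_cong[OF Cons.prems(1), of length] by simp
      then have short: "\<phi> (prod_list (map snd (pre @ post))) = \<psi> (prod_list (map snd (pre @ post)))"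
        using Cons.prems(2) by (intro less.hyps) auto
      have "prod_list (map snd (pre @ ic # post)) =
          prod_list (map snd ((pre @ [(i, d)]) @ post)) + scale (\<phi> c) (prod_list (map snd (pre @ post)))"
        by (simp add: ic, subst cd)
          (simp add: distrib_left distrib_right \<phi>.scale_mult_left \<phi>.scale_mult_right)
      then show ?case
        using IH short by (simp only: \<phi>.add \<psi>.add \<phi>.scale \<psi>.scale)
    qed
    from this[of "[]" cs] less.prems show ?thesis by simp
  qed
qed

text \<open>
Both the given realization and any competing one pull back to the free algebra on the disjoint union of
two copies of the letters, where by \<open>free_functionals_agree\<close> there is only one free functional with the
given marginals.
\<close>

lemma free_mult_conv_eq:
  fixes \<phi> :: "'a::ring_1 \<Rightarrow> complex" and a b :: "'k \<Rightarrow> 'a"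
  assumes "free_realization scale \<phi> a b \<mu> \<nu>"
  shows "\<mu> \<boxtimes> \<nu> = distribution \<phi> (\<lambda>i. a i * b i)"
proof -
  let ?x = "\<lambda>i. X_word [Inl i] :: ('k + 'k) nc_poly" and ?y = "\<lambda>i. X_word [Inr i] :: ('k + 'k) nc_poly"
  have uniq: "\<psi> = \<psi>'" if 1: "free_realization pm_scale \<psi> ?x ?y \<mu> \<nu>"
    and 2: "free_realization pm_scale \<psi>' ?x ?y \<mu> \<nu>" for \<psi> \<psi>'
  proof (rule linear_functional_eqI)
    have ps: "nc_prob_space pm_scale \<psi>" "nc_prob_space pm_scale \<psi>'"
      using 1 2 by (auto simp: free_realization_def)
    show lin: "Vector_Spaces.linear pm_scale (*) \<psi>" "Vector_Spaces.linear pm_scale (*) \<psi>'"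
      using ps by (auto simp: nc_prob_space_def)
    fix w :: "('k + 'k) list"
    let ?A = "unital_subalgebra pm_scale hull (range ?x)" and ?B = "unital_subalgebra pm_scale hull (range ?y)"
    have sub: "unital_subalgebra pm_scale (unital_subalgebra pm_scale hull S)" for S :: "('k + 'k) nc_poly set"
      by (rule hull_in) (auto simp: unital_subalgebra_def)
    have A: "?A \<subseteq> coloured isl True" and B: "?B \<subseteq> coloured isl False"
      by (intro hull_minimal unital_subalgebra_coloured; auto simp: coloured_def X_word_def)+
    have eqA: "\<psi> p = \<psi>' p" if "p \<in> ?A" for p
    proof -
      have "\<psi> (X_word (letters m)) = \<psi>' (X_word (letters m))" if "m \<in> Poly_Mapping.keys p" for m
      proof -
        have "letters m = map Inl (map projl (letters m))"
          using that \<open>p \<in> ?A\<close> A by (auto simp: coloured_def map_idI)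
        then obtain u where u: "letters m = map Inl u" by blast
        have "X_word (letters m) = prod_list (map ?x u)"
          by (simp add: prod_list_X_word[of "\<lambda>i. [Inl i]"] u)
        moreover have "distribution \<psi> ?x (X_word u) = distribution \<psi>' ?x (X_word u)"
          using 1 2 by (simp add: free_realization_def)
        ultimately show ?thesis by (simp add: distribution_X_word)
      qed
      then show ?thesis
        unfolding linear_eq_lin_ext[OF lin(1), of p] linear_eq_lin_ext[OF lin(2), of p]
        by (auto simp: lin_ext_def intro!: sum.cong)
    qed
    have eqB: "\<psi> p = \<psi>' p" if "p \<in> ?B" for p
    proof -
      have "\<psi> (X_word (letters m)) = \<psi>' (X_word (letters m))" if "m \<in> Poly_Mapping.keys p" for m
      proof -
        have "letters m = map Inr (map projr (letters m))"
          using that \<open>p \<in> ?B\<close> B by (auto simp: coloured_def map_idI)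
        then obtain u where u: "letters m = map Inr u" by blast
        have "X_word (letters m) = prod_list (map ?y u)"
          by (simp add: prod_list_X_word[of "\<lambda>i. [Inr i]"] u)
        moreover have "distribution \<psi> ?y (X_word u) = distribution \<psi>' ?y (X_word u)"
          using 1 2 by (simp add: free_realization_def)
        ultimately show ?thesis by (simp add: distribution_X_word)
      qed
      then show ?thesis
        unfolding linear_eq_lin_ext[OF lin(1), of p] linear_eq_lin_ext[OF lin(2), of p]
        by (auto simp: lin_ext_def intro!: sum.cong)
    qed
    let ?cs = "map (\<lambda>z. (isl z, X_word [z])) w"
    have "\<psi> (prod_list (map snd ?cs)) = \<psi>' (prod_list (map snd ?cs))"
    proof (rule free_functionals_agree[OF ps sub sub])
      show "free_subalgebras \<psi> ?A ?B" "free_subalgebras \<psi>' ?A ?B"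
        using 1 2 by (auto simp: free_realization_def freely_independent_def)
      show "\<psi> p = \<psi>' p" if "p \<in> ?A \<union> ?B" for p
        using that eqA eqB by blast
      have "X_word [z] \<in> (if isl z then ?A else ?B)" for z :: "'k + 'k"
        by (cases z) (auto intro: hull_inc)
      then show "\<forall>(i, c)\<in>set ?cs. c \<in> (if i then ?A else ?B)"
        by auto
    qed
    then show "\<psi> (X_word w) = \<psi>' (X_word w)"
      by (simp add: comp_def prod_list_X_word)
  qed
  let ?\<psi> = "\<lambda>\<phi> a b. distribution \<phi> (case_sum a b)"
  show ?thesis
    unfolding free_mult_conv_def
  proof (rule the_equality)
    show "\<forall>\<phi>' (a' :: 'k \<Rightarrow> ('k + 'k) nc_poly) b'. free_realization pm_scale \<phi>' a' b' \<mu> \<nu> \<longrightarrow>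
        distribution \<phi>' (\<lambda>i. a' i * b' i) = distribution \<phi> (\<lambda>i. a i * b i)"
    proof (intro allI impI)
      fix \<phi>' and a' b' :: "'k \<Rightarrow> ('k + 'k) nc_poly"
      assume r: "free_realization pm_scale \<phi>' a' b' \<mu> \<nu>"
      have n: "nc_prob_space pm_scale \<phi>'" "nc_prob_space scale \<phi>"
        using r assms by (auto simp: free_realization_def)
      note p = nc_prob_space.free_realization_pullback[OF n(1) r]
        nc_prob_space.free_realization_pullback[OF n(2) assms]
      have "?\<psi> \<phi>' a' b' = ?\<psi> \<phi> a b"
        by (rule uniq[OF p(1,3)])
      then show "distribution \<phi>' (\<lambda>i. a' i * b' i) = distribution \<phi> (\<lambda>i. a i * b i)"
        using p(2,4) by simp
    qed
    fix \<rho>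
    assume *: "\<forall>\<phi>' (a' :: 'k \<Rightarrow> ('k + 'k) nc_poly) b'. free_realization pm_scale \<phi>' a' b' \<mu> \<nu> \<longrightarrow>
        distribution \<phi>' (\<lambda>i. a' i * b' i) = \<rho>"
    have n: "nc_prob_space scale \<phi>"
      using assms by (auto simp: free_realization_def)
    note p = nc_prob_space.free_realization_pullback[OF n assms]
    show "\<rho> = distribution \<phi> (\<lambda>i. a i * b i)"
      using *[rule_format, OF p(1)] p(2) by simp
  qed
qed

section \<open>Non-crossing partitions as binary trees\<close>

text \<open>
A binary tree stands for a non-crossing partition of its nodes, numbered in preorder. The root is \<open>0\<close>. The
left subtree lies in the gap between \<open>0\<close> and the next element of the block of \<open>0\<close>; the right subtree begins
with that next element, if there is one, and \<open>0\<close> joins its block.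

The Kreweras complement is dual to this: the last node \<open>s\<close> of the left subtree is the last one before the next
element of the block of \<open>0\<close>, hence \<open>0\<close> joins the block of \<open>s\<close> in the complement, and no block of the complement meets
both subtrees. If the left subtree is empty then \<open>s = 0\<close>, and \<open>{0}\<close> is a block of the complement.
\<close>

datatype btree = Leaf | Node btree btree

definition shift :: "nat \<Rightarrow> nat set set \<Rightarrow> nat set set" where
  "shift d \<pi> = (`) ((+) d) ` \<pi>"

text \<open>
Adds the element \<open>0\<close> to the block of \<open>y\<close>, or as a singleton if \<open>y\<close> is in no block. The latter serves
empty subtrees.
\<close>

definition add0 :: "nat \<Rightarrow> nat set set \<Rightarrow> nat set set" where
  "add0 y \<pi> = (if y \<in> \<Union>\<pi> then (\<lambda>B. if y \<in> B then insert 0 B else B) ` \<pi> else insert {0} \<pi>)"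

primrec tree_part :: "btree \<Rightarrow> nat set set" where
  "tree_part Leaf = {}"
| "tree_part (Node L R) = shift 1 (tree_part L) \<union> add0 (Suc (size L)) (shift (Suc (size L)) (tree_part R))"

primrec tree_kreweras :: "btree \<Rightarrow> nat set set" where
  "tree_kreweras Leaf = {}"
| "tree_kreweras (Node L R) = add0 (size L) (shift 1 (tree_kreweras L)) \<union> shift (Suc (size L)) (tree_kreweras R)"

lemma size_eq_0_iff [simp]: "size t = 0 \<longleftrightarrow> t = Leaf" for t :: btree
  by (cases t) auto

lemma size_pos_iff [simp]: "0 < size t \<longleftrightarrow> t \<noteq> Leaf" for t :: btree
  by (cases t) auto

lemma partition_on_block_unique:
  assumes "partition_on A \<pi>" "B \<in> \<pi>" "C \<in> \<pi>" "x \<in> B" "x \<in> C"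
  shows "B = C"
  using partition_onD2[OF assms(1)] assms(2-5) by (auto dest: pairwiseD simp: disjnt_iff)

lemma Union_shift: "\<Union> (shift d \<pi>) = (+) d ` \<Union>\<pi>"
  by (auto simp: shift_def)

lemma Union_add0: "\<Union> (add0 y \<pi>) = insert 0 (\<Union>\<pi>)"
  by (auto simp: add0_def split: if_splits)

lemma add0_eq_image:
  "y \<in> \<Union>\<pi> \<Longrightarrow> add0 y \<pi> = (\<lambda>B. if y \<in> B then insert 0 B else B) ` \<pi>"
  by (simp add: add0_def)

lemma mem_add0E:
  assumes "p \<in> add0 y \<pi>" "y \<in> \<Union>\<pi>"
  obtains B where "B \<in> \<pi>" "p = (if y \<in> B then insert 0 B else B)"
  using assms(1) that unfolding add0_eq_image[OF assms(2)] by blast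

lemma partition_on_shift: "partition_on A \<pi> \<Longrightarrow> partition_on ((+) d ` A) (shift d \<pi>)"
proof -
  assume P: "partition_on A \<pi>"
  then have "{} \<notin> shift d \<pi>"
    by (auto simp: shift_def partition_on_def)
  with partition_on_inj_image[OF P, of "(+) d"] show ?thesis
    by (simp add: shift_def)
qed

lemma partition_on_union:
  assumes P: "partition_on A P" and Q: "partition_on B Q" and AB: "A \<inter> B = {}"
  shows "partition_on (A \<union> B) (P \<union> Q)"
proof (rule partition_onI)
  show "\<Union> (P \<union> Q) = A \<union> B" and "{} \<notin> P \<union> Q"
    using P Q by (auto simp: partition_on_def)
  have A: "p \<subseteq> A" if "p \<in> P" for p using that P by (auto simp: partition_on_def)
  have B: "p \<subseteq> B" if "p \<in> Q" for p using that Q by (auto simp: partition_on_def)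
  fix p q assume "p \<in> P \<union> Q" "q \<in> P \<union> Q" "p \<noteq> q"
  then consider "p \<in> P" "q \<in> P" | "p \<in> Q" "q \<in> Q" | "p \<subseteq> A" "q \<subseteq> B" | "p \<subseteq> B" "q \<subseteq> A"
    using A B by blast
  then show "disjnt p q"
    using AB \<open>p \<noteq> q\<close> partition_onD2[OF P] partition_onD2[OF Q]
    by cases (auto simp: pairwise_def disjnt_def)
qed

lemma partition_on_add0:
  assumes "partition_on A \<pi>" "0 \<notin> A"
  shows "partition_on (insert 0 A) (add0 y \<pi>)"
proof (rule partition_onI)
  show "\<Union> (add0 y \<pi>) = insert 0 A"
    using assms(1) by (simp add: Union_add0 partition_on_def)
  have dis: "B \<inter> C = {}" if "B \<in> \<pi>" "C \<in> \<pi>" "B \<noteq> C" for B C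
    using assms(1) that by (auto simp: partition_on_def pairwise_def disjnt_def)
  have no0: "0 \<notin> B" if "B \<in> \<pi>" for B
    using assms that by (auto simp: partition_on_def)
  show "{} \<notin> add0 y \<pi>"
    using assms by (auto simp: add0_def partition_on_def split: if_splits)
  show "disjnt p q" if pq: "p \<in> add0 y \<pi>" "q \<in> add0 y \<pi>" "p \<noteq> q" for p q
  proof (cases "y \<in> \<Union>\<pi>")
    case True
    obtain B where B: "B \<in> \<pi>" "p = (if y \<in> B then insert 0 B else B)"
      using mem_add0E[OF pq(1) True] .
    obtain C where C: "C \<in> \<pi>" "q = (if y \<in> C then insert 0 C else C)"
      using mem_add0E[OF pq(2) True] .
    have "B \<noteq> C" using pq(3) B C by auto
    then have "B \<inter> C = {}" using dis[OF B(1) C(1)] by blast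
    then show ?thesis using B C no0 by (auto simp: disjnt_def)
  next
    case False
    then show ?thesis using pq dis no0 by (auto simp: add0_def disjnt_def)
  qed
qed

lemma image_plus_lessThan: "(+) d ` {..<n} = {d..<d + n}" for d n :: nat
  by (metis add.commute add_0 image_add_atLeastLessThan lessThan_atLeast0)

lemma partition_on_tree_part: "partition_on {..<size t} (tree_part t)"
proof (induction t)
  case (Node L R)
  have e: "{..<size (Node L R)} =
      (+) 1 ` {..<size L} \<union> insert 0 ((+) (Suc (size L)) ` {..<size R})"
    unfolding image_plus_lessThan by auto
  show ?case
    unfolding e tree_part.simps
    by (intro partition_on_union partition_on_add0 partition_on_shift Node.IH) auto
qed (simp add: partition_on_empty)

lemma partition_on_tree_kreweras: "partition_on {..<size t} (tree_kreweras t)"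
proof (induction t)
  case (Node L R)
  have e: "{..<size (Node L R)} =
      insert 0 ((+) 1 ` {..<size L}) \<union> (+) (Suc (size L)) ` {..<size R}"
    unfolding image_plus_lessThan by auto
  show ?case
    unfolding e tree_kreweras.simps
    by (intro partition_on_union partition_on_add0 partition_on_shift Node.IH) auto
qed (simp add: partition_on_empty)

lemma Union_tree_part [simp]: "\<Union> (tree_part t) = {..<size t}"
  and Union_tree_kreweras [simp]: "\<Union> (tree_kreweras t) = {..<size t}"
  by (rule partition_onD1[OF partition_on_tree_part, symmetric])
    (rule partition_onD1[OF partition_on_tree_kreweras, symmetric])

lemma tree_part_subset: "B \<in> tree_part t \<Longrightarrow> B \<subseteq> {..<size t}"
  and tree_kreweras_subset: "B \<in> tree_kreweras t \<Longrightarrow> B \<subseteq> {..<size t}"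
  using Union_upper[of B "tree_part t"] Union_upper[of B "tree_kreweras t"] by simp_all

lemma add0_shift_tree_part:
  "add0 (Suc d) (shift (Suc d) (tree_part t)) =
     (if t = Leaf then {{0}}
      else (\<lambda>B. if 0 \<in> B then insert 0 ((+) (Suc d) ` B) else (+) (Suc d) ` B) ` tree_part t)"
proof -
  have mem: "Suc d \<in> (+) (Suc d) ` B \<longleftrightarrow> 0 \<in> B" for B by auto
  show ?thesis
  proof (cases "t = Leaf")
    case False
    then have "Suc d \<in> \<Union> (shift (Suc d) (tree_part t))"
      unfolding Union_shift Union_tree_part mem by simp
    from add0_eq_image[OF this] False show ?thesis
      by (simp only: shift_def image_image mem if_False)
  qed (simp add: add0_def shift_def)
qed

lemma add0_shift_tree_kreweras:
  "add0 (size t) (shift 1 (tree_kreweras t)) =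
     (if t = Leaf then {{0}}
      else (\<lambda>B. if size t - 1 \<in> B then insert 0 ((+) 1 ` B) else (+) 1 ` B) ` tree_kreweras t)"
proof -
  have mem: "size t \<in> (+) 1 ` B \<longleftrightarrow> size t - 1 \<in> B" if "t \<noteq> Leaf" for B
    using that by (cases t) auto
  show ?thesis
  proof (cases "t = Leaf")
    case False
    then have "size t \<in> \<Union> (shift 1 (tree_kreweras t))"
      unfolding Union_shift Union_tree_kreweras mem[OF False] by simp
    from add0_eq_image[OF this] False show ?thesis
      by (simp only: shift_def image_image mem[OF False] if_False)
  qed (simp add: add0_def shift_def)
qed

lemma noncrossingD:
  "noncrossing \<pi> \<Longrightarrow> A \<in> \<pi> \<Longrightarrow> B \<in> \<pi> \<Longrightarrow> a < b \<Longrightarrow> b < c \<Longrightarrow> c < d \<Longrightarrow>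
    a \<in> A \<Longrightarrow> c \<in> A \<Longrightarrow> b \<in> B \<Longrightarrow> d \<in> B \<Longrightarrow> A = B"
  unfolding noncrossing_def by blast

lemma noncrossingI:
  assumes "\<And>A B a b c d. A \<in> \<pi> \<Longrightarrow> B \<in> \<pi> \<Longrightarrow> a < b \<Longrightarrow> b < c \<Longrightarrow> c < d \<Longrightarrow>
    a \<in> A \<Longrightarrow> c \<in> A \<Longrightarrow> b \<in> B \<Longrightarrow> d \<in> B \<Longrightarrow> A = B"
  shows "noncrossing \<pi>"
  unfolding noncrossing_def using assms by blast

lemma noncrossing_pullback:
  assumes "noncrossing \<pi>"
    and "\<And>A. A \<in> Q \<Longrightarrow> F A \<in> \<pi> \<and> (+) k ` A \<subseteq> F A" and "inj_on F Q"
  shows "noncrossing Q"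
proof (rule noncrossingI)
  fix A B a b c d
  assume *: "A \<in> Q" "B \<in> Q" "a < b" "b < c" "c < d" "a \<in> A" "c \<in> A" "b \<in> B" "d \<in> B"
  have "F A = F B"
    by (rule noncrossingD[OF assms(1), where a = "k + a" and b = "k + b" and c = "k + c" and d = "k + d"])
      (use * assms(2) in auto)
  then show "A = B" using assms(3) * by (auto dest: inj_onD)
qed

lemma noncrossing_shift:
  assumes "noncrossing \<pi>" shows "noncrossing (shift d \<pi>)"
proof (rule noncrossingI)
  fix A B a b c e
  assume *: "A \<in> shift d \<pi>" "B \<in> shift d \<pi>" "a < b" "b < c" "c < e" "a \<in> A" "c \<in> A" "b \<in> B" "e \<in> B"
  then obtain A' B' a' b' c' e' where
    "A' \<in> \<pi>" "A = (+) d ` A'" "B' \<in> \<pi>" "B = (+) d ` B'"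
    "a' \<in> A'" "a = d + a'" "b' \<in> B'" "b = d + b'" "c' \<in> A'" "c = d + c'" "e' \<in> B'" "e = d + e'"
    by (auto simp: shift_def)
  with * show "A = B" using noncrossingD[OF assms, of A' B' a' b' c' e'] by auto
qed

lemma noncrossing_union:
  assumes "noncrossing P" "noncrossing Q"
    and "\<Union>P = {l..<h}" and "\<Union>Q \<inter> {l..<h} = {}"
  shows "noncrossing (P \<union> Q)"
proof (rule noncrossingI)
  fix A B a b c d
  assume *: "A \<in> P \<union> Q" "B \<in> P \<union> Q" "a < b" "b < c" "c < d" "a \<in> A" "c \<in> A" "b \<in> B" "d \<in> B"
  have p: "x \<in> {l..<h}" if "x \<in> C" "C \<in> P" for x C using assms(3) that by blast
  have q: "x \<notin> {l..<h}" if "x \<in> C" "C \<in> Q" for x C using assms(4) that by blast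
  consider "A \<in> P" "B \<in> P" | "A \<in> Q" "B \<in> Q" | "A \<in> P" "B \<in> Q" | "A \<in> Q" "B \<in> P"
    using * by blast
  then show "A = B"
  proof cases
    case 3
    then show ?thesis using p[of a A] p[of c A] q[of b B] * by auto
  next
    case 4
    then show ?thesis using p[of b B] p[of d B] q[of c A] * by auto
  qed (use * assms noncrossingD in metis)+
qed

text \<open>
A crossing that uses the new element \<open>0\<close> turns into one that uses \<open>y\<close> instead, because \<open>y\<close> is extremal.
For the minimum \<open>y\<close> replaces \<open>0\<close> as the leftmost point; for the maximum \<open>y\<close> becomes the rightmost point, with
the roles of the two blocks exchanged.
\<close>

lemma noncrossing_add0:
  assumes nc: "noncrossing \<pi>" and pt: "partition_on A \<pi>" and A: "0 \<notin> A"
    and y: "A = {} \<or> y \<in> A \<and> ((\<forall>i\<in>A. y \<le> i) \<or> (\<forall>i\<in>A. i \<le> y))"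
  shows "noncrossing (add0 y \<pi>)"
proof (cases "A = {}")
  case True
  then have "\<pi> = {}" using pt by (simp add: partition_on_empty)
  then show ?thesis by (auto simp: add0_def noncrossing_def)
next
  case False
  then have y: "y \<in> A" "(\<forall>i\<in>A. y \<le> i) \<or> (\<forall>i\<in>A. i \<le> y)" using y by auto
  have U: "y \<in> \<Union>\<pi>" using y pt by (auto simp: partition_on_def)
  have mem: "x \<in> A" if "x \<in> B" "B \<in> \<pi>" for x B using pt that by (auto simp: partition_on_def)
  have uniq: "B = C" if "x \<in> B" "x \<in> C" "B \<in> \<pi>" "C \<in> \<pi>" for x B C
    using pt that by (auto simp: partition_on_def pairwise_def disjnt_def)
  let ?F = "\<lambda>B. if y \<in> B then insert 0 B else B"
  show ?thesis
  proof (rule noncrossingI)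
    fix P Q a b c d
    assume *: "P \<in> add0 y \<pi>" "Q \<in> add0 y \<pi>" "a < b" "b < c" "c < d" "a \<in> P" "c \<in> P" "b \<in> Q" "d \<in> Q"
    obtain P' where P: "P' \<in> \<pi>" "P = ?F P'" using mem_add0E[OF *(1) U] .
    obtain Q' where Q: "Q' \<in> \<pi>" "Q = ?F Q'" using mem_add0E[OF *(2) U] .
    have b: "b \<in> Q'" and d: "d \<in> Q'" and c: "c \<in> P'" using * P Q by (auto split: if_splits)
    have "P' = Q'"
    proof (cases "a \<in> P'")
      case True
      then show ?thesis using noncrossingD[OF nc P(1) Q(1) *(3-5)] b c d by blast
    next
      case False
      then have yP: "y \<in> P'" using *(6) P by (auto split: if_splits)
      from y(2) show ?thesis
      proof
        assume "\<forall>i\<in>A. y \<le> i"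
        then have "y \<le> b" using mem[OF b Q(1)] by blast
        then show ?thesis
          using noncrossingD[OF nc P(1) Q(1), of y b c d] uniq[of y P' Q'] * P Q yP b c d
          by (cases "y = b") auto
      next
        assume "\<forall>i\<in>A. i \<le> y"
        then have "d \<le> y" using mem[OF d Q(1)] by blast
        then show ?thesis
          using noncrossingD[OF nc Q(1) P(1), of b c d y] uniq[of y P' Q'] * P Q yP b c d
          by (cases "y = d") auto
      qed
    qed
    then show "P = Q" using P Q by simp
  qed
qed

lemma noncrossing_tree_part: "noncrossing (tree_part t)"
proof (induction t)
  case (Node L R)
  show ?case unfolding tree_part.simps
  proof (rule noncrossing_union)
    show "noncrossing (shift 1 (tree_part L))" by (intro noncrossing_shift Node.IH)
    have "partition_on ((+) (Suc (size L)) ` {..<size R}) (shift (Suc (size L)) (tree_part R))"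
      by (intro partition_on_shift partition_on_tree_part)
    moreover have "(+) (Suc (size L)) ` {..<size R} = {} \<or>
        Suc (size L) \<in> (+) (Suc (size L)) ` {..<size R}"
      by (cases "size R") auto
    ultimately show "noncrossing (add0 (Suc (size L)) (shift (Suc (size L)) (tree_part R)))"
      by (intro noncrossing_add0[where A = "(+) (Suc (size L)) ` {..<size R}"]
          noncrossing_shift Node.IH) auto
    show "\<Union> (shift 1 (tree_part L)) = {1..<Suc (size L)}"
      unfolding Union_shift Union_tree_part image_plus_lessThan by simp
  qed (auto simp: Union_add0 Union_shift)
qed (simp add: noncrossing_def)

lemma noncrossing_tree_kreweras: "noncrossing (tree_kreweras t)"
proof (induction t)
  case (Node L R)
  show ?case unfolding tree_kreweras.simps
  proof (rule noncrossing_union)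
    have "partition_on ((+) 1 ` {..<size L}) (shift 1 (tree_kreweras L))"
      by (intro partition_on_shift partition_on_tree_kreweras)
    then show "noncrossing (add0 (size L) (shift 1 (tree_kreweras L)))"
      by (rule noncrossing_add0[rotated])
        (auto intro!: noncrossing_shift Node.IH simp: image_iff intro: bexI[of _ "size L - 1"])
    show "noncrossing (shift (Suc (size L)) (tree_kreweras R))" by (intro noncrossing_shift Node.IH)
    show "\<Union> (add0 (size L) (shift 1 (tree_kreweras L))) = {0..<Suc (size L)}"
      unfolding Union_add0 Union_shift Union_tree_kreweras image_plus_lessThan by auto
  qed (auto simp: Union_shift)
qed (simp add: noncrossing_def)

lemma tree_part_in_NC: "tree_part t \<in> NC (size t)"
  and tree_kreweras_in_NC: "tree_kreweras t \<in> NC (size t)"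
  by (simp_all add: NC_def partition_on_tree_part partition_on_tree_kreweras noncrossing_tree_part noncrossing_tree_kreweras)

section \<open>Kreweras complements of trees\<close>

text \<open>
The cyclic successor within a block, as a relation: unlike the minima in the definition of \<open>part_perm\<close>, it
is easily transported along shifts and insertions.
\<close>

definition is_next :: "nat set \<Rightarrow> nat \<Rightarrow> nat \<Rightarrow> bool" where
  "is_next B i r \<longleftrightarrow> r \<in> B \<and>
     (if \<exists>j\<in>B. i < j then i < r \<and> (\<forall>j\<in>B. i < j \<longrightarrow> r \<le> j) else (\<forall>j\<in>B. r \<le> j))"

lemma is_next_unique: "is_next B i r \<Longrightarrow> is_next B i r' \<Longrightarrow> r = r'"
  unfolding is_next_def by (meson dual_order.antisym)

lemma part_perm_eq:
  assumes "partition_on A \<pi>" "B \<in> \<pi>" "i \<in> B" "finite B" "is_next B i r"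
  shows "part_perm \<pi> i = r"
proof -
  have "(THE B. B \<in> \<pi> \<and> i \<in> B) = B"
    using assms by (intro the_equality) (auto simp: partition_on_def pairwise_def disjnt_def)
  moreover have "Min {j \<in> B. i < j} = r" if "\<exists>j\<in>B. i < j"
    using assms that by (intro Min_eqI) (auto simp: is_next_def)
  moreover have "Min B = r" if "\<not> (\<exists>j\<in>B. i < j)"
    using assms that by (intro Min_eqI) (auto simp: is_next_def)
  ultimately show ?thesis
    using assms(2,3) by (auto simp: part_perm_def Let_def)
qed

lemma part_perm_outside: "i \<notin> \<Union>\<pi> \<Longrightarrow> part_perm \<pi> i = i"
  by (simp add: part_perm_def)

lemma is_next_exists:
  assumes "finite B" "i \<in> B"
  shows "\<exists>r. is_next B i r"
proof (cases "\<exists>j\<in>B. i < j")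
  case True
  let ?S = "{j\<in>B. i < j}"
  have "?S \<noteq> {}" "finite ?S" using True assms by auto
  then have "Min ?S \<in> ?S" "\<forall>j\<in>?S. Min ?S \<le> j" by (auto simp del: mem_Collect_eq intro: Min_in)
  then show ?thesis using True by (intro exI[of _ "Min ?S"]) (simp add: is_next_def)
next
  case False
  then show ?thesis
    using assms by (intro exI[of _ "Min B"]) (auto simp: is_next_def intro!: Min_in)
qed

lemma is_next_part_perm:
  assumes "partition_on A \<pi>" "B \<in> \<pi>" "i \<in> B" "finite B"
  shows "is_next B i (part_perm \<pi> i)"
  using part_perm_eq[OF assms] is_next_exists[OF assms(4,3)] by blast

lemma is_next_shift: "is_next ((+) d ` B) (d + i) (d + r) \<longleftrightarrow> is_next B i r"
proof -
  have "d + r \<in> (+) d ` B \<longleftrightarrow> r \<in> B" by auto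
  then show ?thesis by (simp add: is_next_def)
qed

text \<open>
The permutations of \<open>tree_part\<close> and \<open>tree_kreweras\<close>, computed on the tree. The value \<open>0\<close> of a recursive call in
the right subtree of \<open>pnext\<close> means that a cycle closes at the first node of that subtree; as \<open>0\<close> has joined this
block, the cycle now closes at \<open>0\<close>. In \<open>knext\<close> the node \<open>0\<close> is inserted into the cycle of the last node of
the left subtree, just after that node.
\<close>

primrec pnext :: "btree \<Rightarrow> nat \<Rightarrow> nat" where
  "pnext Leaf i = 0"
| "pnext (Node L R) i =
     (if i = 0 then (if R = Leaf then 0 else Suc (size L))
      else if i \<le> size L then Suc (pnext L (i - 1))
      else if pnext R (i - Suc (size L)) = 0 then 0
      else Suc (size L) + pnext R (i - Suc (size L)))"

primrec knext :: "btree \<Rightarrow> nat \<Rightarrow> nat" where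
  "knext Leaf i = 0"
| "knext (Node L R) i =
     (if i = 0 then (if L = Leaf then 0 else Suc (knext L (size L - 1)))
      else if i < size L then Suc (knext L (i - 1))
      else if i = size L then 0
      else Suc (size L) + knext R (i - Suc (size L)))"

lemma is_next_pnext: "B \<in> tree_part t \<Longrightarrow> i \<in> B \<Longrightarrow> is_next B i (pnext t i)"
proof (induction t arbitrary: B i)
  case (Node L R)
  let ?d = "Suc (size L)"
  from Node.prems(1) consider B' where "B' \<in> tree_part L" "B = (+) 1 ` B'"
    | "R = Leaf" "B = {0}"
    | B' where "B' \<in> tree_part R" "0 \<in> B'" "B = insert 0 ((+) ?d ` B')"
    | B' where "B' \<in> tree_part R" "0 \<notin> B'" "B = (+) ?d ` B'"
    unfolding tree_part.simps add0_shift_tree_part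
    by (auto simp: shift_def simp del: One_nat_def add_Suc split: if_splits)
  then show ?case
  proof cases
    case 1
    then obtain i' where i': "i = 1 + i'" "i' \<in> B'" using Node.prems(2) by auto
    moreover have "i' < size L" using tree_part_subset 1 i' by blast
    moreover have "is_next B (1 + i') (1 + pnext L i')"
      unfolding 1 is_next_shift by (intro Node.IH 1 i')
    ultimately show ?thesis by simp
  next
    case 2
    then show ?thesis using Node.prems by (simp add: is_next_def)
  next
    case 3
    then have "R \<noteq> Leaf" by auto
    show ?thesis
    proof (cases "i = 0")
      case True
      then show ?thesis using 3 \<open>R \<noteq> Leaf\<close> by (auto simp: is_next_def)
    next
      case False
      then obtain i' where i': "i = ?d + i'" "i' \<in> B'" using Node.prems(2) 3 by auto
      have "is_next B' i' (pnext R i')" by (intro Node.IH 3 i')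
      then show ?thesis using 3 i' by (force simp: is_next_def split: if_splits)
    qed
  next
    case 4
    then obtain i' where i': "i = ?d + i'" "i' \<in> B'" using Node.prems(2) by auto
    have *: "is_next B' i' (pnext R i')" by (intro Node.IH 4 i')
    then have "pnext R i' \<noteq> 0" using 4 by (metis is_next_def)
    moreover have "is_next B (?d + i') (?d + pnext R i')"
      unfolding 4 is_next_shift by (fact *)
    ultimately show ?thesis using i' by simp
  qed
qed simp

lemma is_next_knext: "B \<in> tree_kreweras t \<Longrightarrow> i \<in> B \<Longrightarrow> is_next B i (knext t i)"
proof (induction t arbitrary: B i)
  case (Node L R)
  let ?d = "Suc (size L)"
  consider "L = Leaf" "B = {0}"
    | B' where "B' \<in> tree_kreweras L" "L \<noteq> Leaf" "size L - 1 \<in> B'" "B = insert 0 ((+) 1 ` B')"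
    | B' where "B' \<in> tree_kreweras L" "L \<noteq> Leaf" "size L - 1 \<notin> B'" "B = (+) 1 ` B'"
    | B' where "B' \<in> tree_kreweras R" "B = (+) ?d ` B'"
    using Node.prems(1) unfolding tree_kreweras.simps add0_shift_tree_kreweras
    by (auto simp: shift_def simp del: One_nat_def add_Suc split: if_splits)
  then show ?case
  proof cases
    case 1
    then show ?thesis using Node.prems by (simp add: is_next_def)
  next
    case 2
    have lt: "x < size L" if "x \<in> B'" for x using that 2 tree_kreweras_subset by blast
    show ?thesis
    proof (cases "i = 0")
      case True
      have "is_next B' (size L - 1) (knext L (size L - 1))" by (intro Node.IH 2)
      moreover have "\<not> (\<exists>j\<in>B'. size L - 1 < j)" using lt by force
      ultimately show ?thesis using True 2 by (auto simp: is_next_def)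
    next
      case False
      then obtain i' where i': "i = 1 + i'" "i' \<in> B'" using Node.prems(2) 2 by auto
      have n: "is_next B' i' (knext L i')" by (intro Node.IH 2 i')
      show ?thesis
      proof (cases "Suc i' = size L")
        case True
        have "j \<le> i" if "j \<in> B" for j
          using that lt True unfolding 2 i' by (auto simp: less_Suc_eq_le Suc_le_eq)
        then have "is_next B i 0" using 2 by (auto simp: is_next_def not_less[symmetric])
        moreover have "knext (Node L R) i = 0" using True i' by simp
        ultimately show ?thesis by simp
      next
        case False
        then have "i' < size L - 1" using lt[OF i'(2)] by simp
        then show ?thesis using 2 i' n by (auto simp: is_next_def split: if_splits)
      qed
    qed
  next
    case 3
    then obtain i' where i': "i = 1 + i'" "i' \<in> B'" using Node.prems(2) by auto
    have "i' < size L" using tree_kreweras_subset 3 i' by blast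
    moreover have "i' \<noteq> size L - 1" using 3 i' by blast
    ultimately have "1 + i' < size L" by linarith
    moreover have "is_next B (1 + i') (1 + knext L i')"
      unfolding 3 is_next_shift by (intro Node.IH 3 i')
    ultimately show ?thesis using i' by simp
  next
    case 4
    then obtain i' where i': "i = ?d + i'" "i' \<in> B'" using Node.prems(2) by auto
    have "is_next B (?d + i') (?d + knext R i')"
      unfolding 4 is_next_shift by (intro Node.IH 4 i')
    then show ?thesis using i' by simp
  qed
qed simp

lemma part_perm_tree_part:
  assumes "i < size t" shows "part_perm (tree_part t) i = pnext t i"
proof -
  have "i \<in> \<Union> (tree_part t)" using assms by simp
  then obtain B where B: "B \<in> tree_part t" "i \<in> B" by (rule UnionE)
  moreover have "finite B" using tree_part_subset[OF B(1)] by (rule finite_subset) simp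
  ultimately show ?thesis by (intro part_perm_eq[OF partition_on_tree_part] is_next_pnext)
qed

lemma part_perm_tree_kreweras:
  assumes "i < size t" shows "part_perm (tree_kreweras t) i = knext t i"
proof -
  have "i \<in> \<Union> (tree_kreweras t)" using assms by simp
  then obtain B where B: "B \<in> tree_kreweras t" "i \<in> B" by (rule UnionE)
  moreover have "finite B" using tree_kreweras_subset[OF B(1)] by (rule finite_subset) simp
  ultimately show ?thesis by (intro part_perm_eq[OF partition_on_tree_kreweras] is_next_knext)
qed

lemma pnext_less: "i < size t \<Longrightarrow> pnext t i < size t"
proof (induction t arbitrary: i)
  case (Node L R)
  consider "i = 0" | "0 < i" "i \<le> size L" | "size L < i" by linarith
  then show ?case
  proof cases
    case 2
    then have "i - 1 < size L" by linarith
    then have "pnext L (i - 1) < size L" by (rule Node.IH)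
    then show ?thesis using 2 by simp
  next
    case 3
    then have "i - Suc (size L) < size R" using Node.prems by simp
    then have "pnext R (i - Suc (size L)) < size R" by (rule Node.IH)
    then show ?thesis using 3 by simp
  qed simp
qed simp

lemma knext_less: "i < size t \<Longrightarrow> knext t i < size t"
proof (induction t arbitrary: i)
  case (Node L R)
  consider "i = 0" | "0 < i" "i < size L" | "i = size L" | "size L < i" by linarith
  then show ?case
  proof cases
    case 1
    then show ?thesis using Node.IH(1)[of "size L - 1"] by (cases "L = Leaf") auto
  next
    case 2
    then have "i - 1 < size L" by linarith
    then have "knext L (i - 1) < size L" by (rule Node.IH)
    then show ?thesis using 2 by simp
  next
    case 4
    then have "i - Suc (size L) < size R" using Node.prems by simp
    then have "knext R (i - Suc (size L)) < size R" by (rule Node.IH)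
    then show ?thesis using 4 by simp
  qed simp
qed simp

text \<open>
The relation \<open>P\<^sub>\<pi> P\<^sub>K\<^sub>(\<^sub>\<pi>\<^sub>) = P\<^sub>1\<close>, with \<open>P\<^sub>1\<close> the full cycle, that determines the Kreweras complement.
\<close>

lemma pnext_knext: "i < size t \<Longrightarrow> pnext t (knext t i) = (if Suc i < size t then Suc i else 0)"
proof (induction t arbitrary: i)
  case (Node L R)
  consider "i = 0" "L = Leaf" | "i = 0" "L \<noteq> Leaf" | "0 < i" "i < size L" | "0 < i" "i = size L" | "size L < i"
    by linarith
  then show ?case
  proof cases
    case 1
    then show ?thesis by simp
  next
    case 2
    then have "size L - 1 < size L" by simp
    with 2 Node.IH(1)[of "size L - 1"] knext_less[of "size L - 1" L] show ?thesis
      by auto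
  next
    case 3
    then have "i - 1 < size L" by linarith
    then have "pnext L (knext L (i - 1)) = i" "Suc (knext L (i - 1)) \<le> size L"
      using 3 Node.IH(1)[of "i - 1"] knext_less[of "i - 1" L] by (simp_all add: Suc_le_eq)
    then show ?thesis using 3 by simp
  next
    case 4
    then show ?thesis by auto
  next
    case 5
    then have "i - Suc (size L) < size R" using Node.prems by simp
    with 5 Node.IH(2)[of "i - Suc (size L)"] knext_less[of "i - Suc (size L)" R] show ?thesis by auto
  qed
qed simp

lemma part_perm_full: "part_perm {{..<n}} i = (if i < n then if Suc i < n then Suc i else 0 else i)"
proof (cases "i < n")
  case True
  then have "partition_on {..<n} {{..<n}}" by (intro partition_on_space) auto
  moreover have "is_next {..<n} i (if Suc i < n then Suc i else 0)"
    using True by (auto simp: is_next_def)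
  ultimately have "part_perm {{..<n}} i = (if Suc i < n then Suc i else 0)"
    using True by (intro part_perm_eq) auto
  then show ?thesis using True by simp
qed (simp add: part_perm_outside)

lemma part_perm_tree_part_kreweras: "part_perm (tree_part t) (part_perm (tree_kreweras t) i) = part_perm {{..<size t}} i"
proof (cases "i < size t")
  case True
  then show ?thesis
    using knext_less pnext_knext by (simp add: part_perm_tree_kreweras part_perm_tree_part part_perm_full)
next
  case False
  then show ?thesis by (simp add: part_perm_outside part_perm_full)
qed

lemma bij_part_perm_tree_part: "bij (part_perm (tree_part t))"
proof -
  let ?P = "part_perm (tree_part t)" and ?n = "size t"
  have "i \<in> ?P ` {..<?n}" if i: "i < ?n" for i
  proof -
    obtain j where j: "j < ?n" "i = (if Suc j < ?n then Suc j else 0)"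
    proof
      show "(if i = 0 then ?n - 1 else i - 1) < ?n" using i by (cases "i = 0") auto
      show "i = (if Suc (if i = 0 then ?n - 1 else i - 1) < ?n
          then Suc (if i = 0 then ?n - 1 else i - 1) else 0)"
        using i by (cases "i = 0") auto
    qed
    then have "i = ?P (knext t j)"
      using knext_less[OF j(1)] by (simp add: part_perm_tree_part pnext_knext)
    then show ?thesis using knext_less[OF j(1)] by blast
  qed
  then have "{..<?n} \<subseteq> ?P ` {..<?n}" by auto
  then have 1: "inj_on ?P {..<?n}" "?P ` {..<?n} = {..<?n}"
    using endo_inj_surj[of "{..<?n}" ?P] finite_surj_inj[of "{..<?n}" ?P]
      pnext_less by (auto simp: part_perm_tree_part)
  have out: "?P i = i" if "\<not> i < ?n" for i using that by (simp add: part_perm_outside)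
  show ?thesis
  proof (rule bijI)
    show "surj ?P" using 1(2) out by (metis imageE lessThan_iff surj_def)
    have m: "?P i < ?n \<longleftrightarrow> i < ?n" for i using 1(2) out by (metis imageI lessThan_iff)
    show "inj ?P"
    proof (rule injI)
      fix x y assume "?P x = ?P y"
      then show "x = y" using 1(1) out m[of x] m[of y]
        by (cases "x < ?n"; cases "y < ?n") (auto dest: inj_onD)
    qed
  qed
qed

text \<open>
Blocks are orbits: the set \<open>B \<inter> C\<close> is closed under the successor. Starting from its largest element, which
therefore has to be the largest of \<open>B\<close>, the successor runs through all of \<open>B\<close>.
\<close>

lemma block_subset_of_perm_eq:
  assumes P: "partition_on A P" "B \<in> P" "finite B" and Q: "partition_on A' Q" "C \<in> Q" "finite C"
    and eq: "part_perm P = part_perm Q" and i: "i \<in> B" "i \<in> C"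
  shows "B \<subseteq> C"
proof (rule ccontr)
  assume "\<not> B \<subseteq> C"
  let ?p = "part_perm P"
  have nB: "is_next B x (?p x)" if "x \<in> B" for x by (rule is_next_part_perm[OF P(1,2) that P(3)])
  have nC: "is_next C x (?p x)" if "x \<in> C" for x
    unfolding eq by (rule is_next_part_perm[OF Q(1,2) that Q(3)])
  have cl: "?p x \<in> B \<inter> C" if "x \<in> B \<inter> C" for x
    using nB[of x] nC[of x] that by (auto simp: is_next_def)
  define z where "z = Max (B \<inter> C)"
  have z: "z \<in> B \<inter> C" "\<And>x. x \<in> B \<inter> C \<Longrightarrow> x \<le> z"
    unfolding z_def using P(3) i Max_in[of "B \<inter> C"] by auto
  have pz: "?p z \<in> B \<inter> C" "\<forall>j\<in>B. ?p z \<le> j"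
    using cl[OF z(1)] z(2)[of "?p z"] nB[of z] z(1) by (auto simp: is_next_def split: if_splits)
  define x where "x = Min (B - C)"
  have x: "x \<in> B" "x \<notin> C" "\<And>y. y \<in> B - C \<Longrightarrow> x \<le> y"
    unfolding x_def using P(3) \<open>\<not> B \<subseteq> C\<close> Min_in[of "B - C"] by auto
  have lt: "?p z < x" using pz x by (metis IntD2 le_neq_implies_less)
  let ?L = "{j \<in> B. j < x}"
  define y where "y = Max ?L"
  have y: "y \<in> ?L" "\<And>j. j \<in> ?L \<Longrightarrow> j \<le> y"
  proof -
    have "finite ?L" "?L \<noteq> {}" using P(3) lt pz by auto
    then show "y \<in> ?L" "\<And>j. j \<in> ?L \<Longrightarrow> j \<le> y"
      unfolding y_def by (rule Max_in) (rule Max_ge[OF \<open>finite ?L\<close>])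
  qed
  then have "y \<in> C" using x(3)[of y] by auto
  have "?p y = x"
  proof (rule is_next_unique[OF nB])
    show "is_next B y x" using y x(1) by (auto simp: is_next_def) (meson not_le y)+
  qed (use y in auto)
  then show False using cl[of y] y(1) \<open>y \<in> C\<close> x(2) by auto
qed

lemma NC_eqI:
  assumes "\<pi> \<in> NC n" "\<sigma> \<in> NC n" "part_perm \<pi> = part_perm \<sigma>"
  shows "\<pi> = \<sigma>"
proof -
  have sub: "\<pi> \<subseteq> \<sigma>" if *: "partition_on {..<n} \<pi>" "partition_on {..<n} \<sigma>" "part_perm \<pi> = part_perm \<sigma>" for \<pi> \<sigma>
  proof
    fix B assume B: "B \<in> \<pi>"
    then have "B \<noteq> {}" using *(1) by (auto simp: partition_on_def)
    then obtain i where i: "i \<in> B" by blast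
    then have "i \<in> \<Union>\<sigma>" using B * by (auto simp: partition_on_def)
    then obtain C where C: "C \<in> \<sigma>" "i \<in> C" by blast
    have fin: "finite B" "finite C"
      using B C * by (auto simp: partition_on_def intro!: finite_subset[of _ "{..<n}"])
    have "B \<subseteq> C"
      by (rule block_subset_of_perm_eq[OF *(1) B fin(1) *(2) C(1) fin(2) *(3) i C(2)])
    moreover have "C \<subseteq> B"
      by (rule block_subset_of_perm_eq[OF *(2) C(1) fin(2) *(1) B fin(1) *(3)[symmetric] C(2) i])
    ultimately show "B \<in> \<sigma>" using C by simp
  qed
  show ?thesis using assms sub[of \<pi> \<sigma>] sub[of \<sigma> \<pi>] by (auto simp: NC_def)
qed

lemma kreweras_tree_part: "kreweras (size t) (tree_part t) = tree_kreweras t"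
proof -
  let ?P = "part_perm (tree_part t)"
  have "inv ?P \<circ> part_perm {{..<size t}} = part_perm (tree_kreweras t)"
    using bij_part_perm_tree_part[of t] by (auto simp: fun_eq_iff bij_def simp flip: part_perm_tree_part_kreweras)
  then show ?thesis
    unfolding kreweras_def
    by (intro the_equality) (auto simp only: tree_kreweras_in_NC intro!: NC_eqI[OF _ tree_kreweras_in_NC])
qed

section \<open>Every non-crossing partition comes from one tree\<close>

text \<open>
The value at \<open>0\<close> reveals the size of the left subtree, and thereby which part of the permutation belongs to
which subtree.
\<close>

lemma pnext_inject:
  "size t = size t' \<Longrightarrow> (\<And>i. i < size t \<Longrightarrow> pnext t i = pnext t' i) \<Longrightarrow> t = t'"
proof (induction t arbitrary: t')
  case Leaf
  then show ?case by simp
next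
  case (Node L R)
  then obtain L' R' where t': "t' = Node L' R'" by (cases t') auto
  have eq: "pnext (Node L R) i = pnext (Node L' R') i" if "i < size (Node L R)" for i
    using Node.prems(2)[OF that] by (simp only: t')
  have s: "size L + size R = size L' + size R'" using Node.prems(1) t' by simp
  have R: "R = Leaf \<longleftrightarrow> R' = Leaf" "R \<noteq> Leaf \<Longrightarrow> size L = size L'"
    using eq[of 0] by (auto split: if_splits)
  then have sL: "size L = size L'" using s by (cases "R = Leaf") auto
  then have sR: "size R = size R'" using s by simp
  have "L = L'"
  proof (rule Node.IH(1)[OF sL])
    fix i assume "i < size L"
    then show "pnext L i = pnext L' i" using eq[of "Suc i"] sL by simp
  qed
  moreover have "R = R'"
  proof (rule Node.IH(2)[OF sR])
    fix i assume "i < size R"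
    then show "pnext R i = pnext R' i" using eq[of "Suc (size L) + i"] sL by (auto split: if_splits)
  qed
  ultimately show ?case by (simp add: t')
qed

lemma tree_part_inject:
  assumes "tree_part t = tree_part t'" shows "t = t'"
proof (rule pnext_inject)
  show s: "size t = size t'"
    using arg_cong[OF assms, of Union] by (metis Union_tree_part lessThan_eq_iff)
  show "pnext t i = pnext t' i" if "i < size t" for i
    using that s assms by (metis part_perm_tree_part)
qed

text \<open>
If \<open>B0\<close> is the block of \<open>0\<close> and \<open>d\<close> its next element, no other block has points on both sides of \<open>d\<close>, because
it would cross \<open>B0\<close> at \<open>0\<close> and \<open>d\<close>. So the partition falls apart into one of the gap before \<open>d\<close> and one of the rest,
to which \<open>B0\<close> contributes its part without \<open>0\<close>.
\<close>

lemma NC_imp_tree_part: "\<pi> \<in> NC n \<Longrightarrow> \<exists>t. size t = n \<and> tree_part t = \<pi>"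
proof (induction n arbitrary: \<pi> rule: less_induct)
  case (less n)
  have pt: "partition_on {..<n} \<pi>" and nc: "noncrossing \<pi>" using less.prems by (auto simp: NC_def)
  have uniq: "B = C" if "x \<in> B" "x \<in> C" "B \<in> \<pi>" "C \<in> \<pi>" for x B C
    using partition_on_block_unique[OF pt that(3,4,1,2)] .
  have lt: "x < n" if "x \<in> B" "B \<in> \<pi>" for x B using that pt by (auto simp: partition_on_def)
  have ne: "B \<noteq> {}" if "B \<in> \<pi>" for B using that pt by (auto simp: partition_on_def)
  have cover: "\<exists>B\<in>\<pi>. x \<in> B" if "x < n" for x using that pt by (auto simp: partition_on_def)
  show ?case
  proof (cases n)
    case 0
    then have "\<pi> = {}" using pt by (simp add: partition_on_empty)
    then show ?thesis using 0 by (intro exI[of _ Leaf]) simp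
  next
    case (Suc m)
    then obtain B0 where B0: "B0 \<in> \<pi>" "0 \<in> B0" using cover[of 0] by auto
    \<comment> \<open>If \<open>0\<close> is a singleton, the gap extends to the end; then \<open>d = n\<close> and \<open>P2\<close> below is empty.\<close>
    define C where "C = B0 - {0}"
    define d where "d = (if C = {} then n else Min C)"
    have finC: "finite C" unfolding C_def using lt[OF _ B0(1)] by (intro finite_Diff finite_subset[of B0 "{..<n}"]) auto
    have dC: "d \<in> C" if "C \<noteq> {}" using that finC by (simp add: d_def)
    have dle: "d \<le> x" if "x \<in> C" for x using that finC by (auto simp: d_def)
    have d: "0 < d" "d \<le> n"
    proof -
      show "0 < d" using dC Suc by (cases "C = {}") (auto simp: d_def C_def)
      show "d \<le> n" using dC lt[OF _ B0(1)] by (cases "C = {}") (auto simp: d_def C_def less_imp_le)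
    qed
    have side: "(\<forall>x\<in>B. x < d) \<or> (\<forall>x\<in>B. d \<le> x)" if B: "B \<in> \<pi>" "B \<noteq> B0" for B
    proof (rule ccontr)
      assume "\<not> ?thesis"
      then obtain x y where xy: "x \<in> B" "x < d" "y \<in> B" "d \<le> y" by (meson not_le)
      then have "C \<noteq> {}" using lt[OF \<open>y \<in> B\<close> B(1)] by (auto simp: d_def)
      then have dB: "d \<in> B0" using dC by (auto simp: C_def)
      have "x \<noteq> 0" using uniq[of 0 B B0] xy(1) B B0 by auto
      moreover have "y \<noteq> d" using uniq[of d B B0] xy(3) B B0(1) dB by auto
      ultimately have "B0 = B"
        using noncrossingD[OF nc B0(1) B(1), of 0 x d y] xy dB B0 by auto
      then show False using B by blast
    qed
    define P1 where "P1 = {B. (+) 1 ` B \<in> \<pi> \<and> (\<forall>x\<in>B. Suc x < d)}"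
    define P2 where "P2 = {B. (+) d ` B \<in> \<pi> \<or> (C \<noteq> {} \<and> (+) d ` B = C)}"
    have notB0: "(+) k ` B \<noteq> B0" if "0 < k" for k B using B0 that by auto
    have un: "\<exists>B. D = (+) k ` B" if "\<forall>x\<in>D. k \<le> x" for D and k :: nat
    proof -
      have "D = (+) k ` ((\<lambda>x. x - k) ` D)" using that by (force simp: image_image)
      then show ?thesis by blast
    qed
    have "P1 \<in> NC (d - 1)"
      unfolding NC_def mem_Collect_eq
    proof (intro conjI partition_onI)
      show "\<Union> P1 = {..<d - 1}"
      proof (intro equalityI subsetI)
        fix x assume x: "x \<in> {..<d - 1}"
        then obtain B where B: "B \<in> \<pi>" "Suc x \<in> B" using cover[of "Suc x"] d by force
        have "B \<noteq> B0" using dle[of "Suc x"] x B by (auto simp: C_def)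
        then have all: "\<forall>y\<in>B. y < d" "0 \<notin> B" using side[OF B(1)] B x B0 uniq by force+
        then obtain B' where B': "B = (+) 1 ` B'" using un[of B 1] by (metis One_nat_def Suc_leI neq0_conv)
        then show "x \<in> \<Union> P1" using B all by (auto simp: P1_def intro!: exI[of _ B'])
      qed (force simp: P1_def)
      show "disjnt p q" if "p \<in> P1" "q \<in> P1" "p \<noteq> q" for p q
      proof -
        have "(+) 1 ` p \<noteq> (+) 1 ` q" using that(3) by (simp add: inj_image_eq_iff)
        then show ?thesis using that uniq[of _ "(+) 1 ` p" "(+) 1 ` q"] by (auto simp: P1_def disjnt_def)
      qed
      show "{} \<notin> P1" using ne by (auto simp: P1_def)
      show "noncrossing P1"
        by (rule noncrossing_pullback[OF nc, of _ "(`) ((+) 1)" 1]) (auto simp: P1_def inj_on_def inj_image_eq_iff)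
    qed
    moreover have "d - 1 < n" using d by linarith
    ultimately obtain L where L: "size L = d - 1" "tree_part L = P1" using less.IH by blast
    \<comment> \<open>Embeds the blocks of \<open>P2\<close> into blocks of \<open>\<pi>\<close>, so that \<open>P2\<close> inherits the non-crossing property.\<close>
    define F where "F B = (if (+) d ` B = C then B0 else (+) d ` B)" for B
    have F: "F B \<in> \<pi> \<and> (+) d ` B \<subseteq> F B" if "B \<in> P2" for B
      using that B0 by (auto simp: P2_def F_def C_def)
    have Finj: "p = q" if "p \<in> P2" "q \<in> P2" "F p = F q" for p q
    proof -
      have "(+) d ` p = (+) d ` q" using that(3) notB0[OF d(1)] by (auto simp: F_def split: if_splits)
      then show ?thesis by (simp add: inj_image_eq_iff)
    qed
    have "P2 \<in> NC (n - d)"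
      unfolding NC_def mem_Collect_eq
    proof (intro conjI partition_onI)
      show "\<Union> P2 = {..<n - d}"
      proof (intro equalityI subsetI)
        fix x assume x: "x \<in> {..<n - d}"
        then obtain B where B: "B \<in> \<pi>" "d + x \<in> B" using cover[of "d + x"] by force
        show "x \<in> \<Union> P2"
        proof (cases "B = B0")
          case True
          then have "d + x \<in> C" using B d by (simp add: C_def)
          moreover obtain B' where "C = (+) d ` B'" using un[of C d] dle by blast
          ultimately show ?thesis by (auto simp: P2_def intro!: exI[of _ B'])
        next
          case False
          then have "\<forall>y\<in>B. d \<le> y" using side[OF B(1)] B by force
          then obtain B' where "B = (+) d ` B'" using un[of B d] by blast
          then show ?thesis using B by (auto simp: P2_def intro!: exI[of _ B'])
        qed
      next
        fix x assume "x \<in> \<Union> P2"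
        then obtain B where "B \<in> P2" "x \<in> B" by blast
        then have "d + x < n" using F[of B] lt[of "d + x" "F B"] by blast
        then show "x \<in> {..<n - d}" by simp
      qed
      show "disjnt p q" if "p \<in> P2" "q \<in> P2" "p \<noteq> q" for p q
        unfolding disjnt_iff
      proof (intro allI notI)
        fix x assume "x \<in> p \<and> x \<in> q"
        then have "F p = F q" using F that(1,2) uniq[of "d + x" "F p" "F q"] by blast
        then show False using Finj that by blast
      qed
      show "{} \<notin> P2" using ne by (auto simp: P2_def)
      show "noncrossing P2"
      proof (rule noncrossing_pullback[OF nc F])
        show "inj_on F P2" by (rule inj_onI) (rule Finj)
      qed
    qed
    then obtain R where R: "size R = n - d" "tree_part R = P2" using less.IH[of "n - d" P2] d Suc by auto
    have dS: "Suc (size L) = d" using L d by simp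
    have 1: "shift 1 P1 = {B \<in> \<pi>. B \<noteq> B0 \<and> (\<forall>x\<in>B. x < d)}"
    proof (intro equalityI subsetI)
      fix B assume B: "B \<in> {B \<in> \<pi>. B \<noteq> B0 \<and> (\<forall>x\<in>B. x < d)}"
      then have "0 \<notin> B" using uniq B0 by blast
      then obtain B' where "B = (+) 1 ` B'" using un[of B 1] by (metis One_nat_def Suc_leI neq0_conv)
      then show "B \<in> shift 1 P1" using B by (auto simp: shift_def P1_def)
    qed (use notB0[of 1] in \<open>auto simp: shift_def P1_def\<close>)
    have 2: "add0 d (shift d P2) = insert B0 {B \<in> \<pi>. B \<noteq> B0 \<and> (\<forall>x\<in>B. d \<le> x)}"
    proof -
      have sh: "shift d P2 = {B \<in> \<pi>. B \<noteq> B0 \<and> (\<forall>x\<in>B. d \<le> x)} \<union> (if C = {} then {} else {C})"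
      proof (intro equalityI subsetI)
        fix B assume "B \<in> {B \<in> \<pi>. B \<noteq> B0 \<and> (\<forall>x\<in>B. d \<le> x)} \<union> (if C = {} then {} else {C})"
        then have B: "B \<in> \<pi> \<or> C \<noteq> {} \<and> B = C" "\<forall>x\<in>B. d \<le> x" using dle by (auto split: if_splits)
        then obtain B' where "B = (+) d ` B'" using un[of B d] by blast
        then show "B \<in> shift d P2" using B by (auto simp: shift_def P2_def)
      qed (use notB0[OF d(1)] in \<open>auto simp: shift_def P2_def\<close>)
      show ?thesis
      proof (cases "C = {}")
        case True
        then have "B0 = {0}" using B0 by (auto simp: C_def)
        moreover have e: "{B \<in> \<pi>. B \<noteq> B0 \<and> (\<forall>x\<in>B. d \<le> x)} = {}"
        proof -
          have "\<not> (\<forall>x\<in>B. d \<le> x)" if B: "B \<in> \<pi>" for B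
          proof -
            obtain x where "x \<in> B" using ne[OF B] by blast
            moreover from this have "x < d" using lt B True by (simp add: d_def)
            ultimately show ?thesis by force
          qed
          then show ?thesis by blast
        qed
        moreover have "shift d P2 = {}" unfolding sh e using True by simp
        ultimately show ?thesis unfolding e by (simp add: add0_def)
      next
        case False
        have "insert 0 C = B0" using B0 by (auto simp: C_def)
        moreover have "d \<notin> B" if "B \<in> \<pi>" "B \<noteq> B0" for B
          using that uniq[of d B B0] dC[OF False] B0 by (auto simp: C_def)
        ultimately show ?thesis using False dC by (auto simp: sh add0_def image_def)
      qed
    qed
    have "tree_part (Node L R) = \<pi>"
      unfolding tree_part.simps L(2) R(2) dS 1 2 using side B0 by blast
    moreover have "size (Node L R) = n" using L R d by simp
    ultimately show ?thesis by blast
  qed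
qed

definition trees :: "nat \<Rightarrow> btree set" where
  "trees n = {t. size t = n}"

lemma bij_betw_tree_part: "bij_betw tree_part (trees n) (NC n)"
  unfolding bij_betw_def
proof
  show "inj_on tree_part (trees n)" by (auto intro: inj_onI tree_part_inject)
  show "tree_part ` trees n = NC n" using NC_imp_tree_part tree_part_in_NC by (force simp: trees_def)
qed

lemma finite_NC: "finite (NC n)"
  by (rule finite_subset[OF _ finitely_many_partition_on[of "{..<n}"]]) (auto simp: NC_def)

lemma finite_trees [simp]: "finite (trees n)"
  using bij_betw_finite[OF bij_betw_tree_part] finite_NC by blast

lemma sum_NC_eq_sum_trees:
  "(\<Sum>\<pi>\<in>NC n. F \<pi> (kreweras n \<pi>)) = (\<Sum>t\<in>trees n. F (tree_part t) (tree_kreweras t))"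
  by (rule sum.reindex_bij_betw[OF bij_betw_tree_part, symmetric, THEN trans])
    (auto intro!: sum.cong simp: trees_def kreweras_tree_part)

lemma trees_0 [simp]: "trees 0 = {Leaf}"
  by (auto simp: trees_def)

lemma sum_trees_Suc:
  "(\<Sum>t\<in>trees (Suc n). F t) = (\<Sum>k\<le>n. \<Sum>L\<in>trees k. \<Sum>R\<in>trees (n - k). F (Node L R))"
proof -
  have "trees (Suc n) = (\<Union>k\<in>{..n}. (\<lambda>(L, R). Node L R) ` (trees k \<times> trees (n - k)))"
  proof (intro equalityI subsetI)
    fix t assume "t \<in> trees (Suc n)"
    then show "t \<in> (\<Union>k\<in>{..n}. (\<lambda>(L, R). Node L R) ` (trees k \<times> trees (n - k)))"
    proof (cases t)
      case (Node L R)
      then have "size L \<le> n" "t \<in> (\<lambda>(L, R). Node L R) ` (trees (size L) \<times> trees (n - size L))"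
        using \<open>t \<in> trees (Suc n)\<close> by (auto simp: trees_def)
      then show ?thesis by blast
    qed (simp add: trees_def)
  qed (auto simp: trees_def)
  also have "sum F \<dots> = (\<Sum>k\<le>n. sum F ((\<lambda>(L, R). Node L R) ` (trees k \<times> trees (n - k))))"
  proof (rule sum.UNION_disjoint)
    show "\<forall>k\<in>{..n}. finite ((\<lambda>(L, R). Node L R) ` (trees k \<times> trees (n - k)))"
      by (intro ballI finite_imageI finite_cartesian_product finite_trees)
  qed (auto simp: trees_def)
  also have "\<dots> = (\<Sum>k\<le>n. \<Sum>L\<in>trees k. \<Sum>R\<in>trees (n - k). F (Node L R))"
    by (subst sum.reindex) (auto simp: inj_on_def sum.cartesian_product comp_def case_prod_beta)
  finally show ?thesis .
qed

section \<open>Block products along a tree\<close>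

text \<open>
The product of \<open>f\<close> over the words cut out of \<open>w\<close> by the blocks of \<open>tree_part\<close>, respectively of
\<open>tree_kreweras\<close>, where one block is still open: for \<open>tree_part\<close> the word \<open>x\<close> is put in front of the block of
the first node, for \<open>tree_kreweras\<close> the word \<open>y\<close> is put in front of the block of the last node. On an empty tree
only the open block remains. The open block makes the products recursive: it receives the root.
\<close>

primrec part_weight :: "('k list \<Rightarrow> complex) \<Rightarrow> btree \<Rightarrow> 'k list \<Rightarrow> 'k list \<Rightarrow> complex" where
  "part_weight f Leaf w x = f x"
| "part_weight f (Node L R) w x =
     part_weight f L (take (size L) (tl w)) [] * part_weight f R (drop (size L) (tl w)) (x @ [hd w])"

primrec kreweras_weight :: "('k list \<Rightarrow> complex) \<Rightarrow> btree \<Rightarrow> 'k list \<Rightarrow> 'k list \<Rightarrow> complex" where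
  "kreweras_weight g Leaf w y = g y"
| "kreweras_weight g (Node L R) w y =
     (if R = Leaf then kreweras_weight g L (tl w) (y @ [hd w])
      else kreweras_weight g L (take (size L) (tl w)) [hd w] * kreweras_weight g R (drop (size L) (tl w)) y)"

lemma nths_Cons_image_Suc: "nths (i # v) ((+) 1 ` B) = nths v B"
proof -
  have "{j. Suc j \<in> (+) 1 ` B} = B" by auto
  then show ?thesis by (simp add: nths_Cons)
qed

lemma nths_Cons_image_plus: "nths (i # v) ((+) (Suc d) ` B) = nths (drop d v) B"
proof -
  have "(+) (Suc d) ` B = (+) 1 ` ((+) d ` B)" by (simp add: image_image)
  then show ?thesis by (simp only: nths_drop nths_Cons_image_Suc)
qed

lemma nths_Cons_0: "nths (i # v) {0} = [i]"
  by (simp add: nths_Cons)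

lemma nths_Cons_insert_0: "nths (i # v) (insert 0 A) = i # nths v {j. Suc j \<in> A}"
  by (simp add: nths_Cons)

lemma nths_take_subset: "B \<subseteq> {..<k} \<Longrightarrow> nths (take k v) B = nths v B"
proof -
  assume B: "B \<subseteq> {..<k}"
  have "nths v B = nths (take k v @ drop k v) B" by simp
  also have "\<dots> = nths (take k v) B"
  proof (cases "k \<le> length v")
    case True
    then have "{j. j + length (take k v) \<in> B} = {}" using B by auto
    then show ?thesis by (simp only: nths_append) simp
  qed simp
  finally show ?thesis ..
qed

lemma prod_disjoint_blocks:
  assumes "finite P" "finite Q" "{} \<notin> P" "\<Union>P \<inter> \<Union>Q = {}"
  shows "prod F (P \<union> Q) = prod F P * prod F Q"
proof (rule prod.union_disjoint)
  show "P \<inter> Q = {}"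
  proof (rule equals0I)
    fix B assume B: "B \<in> P \<inter> Q"
    then have "B \<noteq> {}" using assms(3) by auto
    then obtain x where "x \<in> B" by auto
    then show False using B assms(4) by blast
  qed
qed (use assms in auto)

lemma prod_shift: "prod F (shift d P) = (\<Prod>B\<in>P. F ((+) d ` B))"
  unfolding shift_def by (rule prod.reindex_cong[where l = "(`) ((+) d)"]) (auto simp: inj_on_def inj_image_eq_iff)

lemma prod_insert_shift:
  "prod F ((\<lambda>B. if Q B then insert 0 ((+) (Suc d) ` B) else (+) (Suc d) ` B) ` P) =
    (\<Prod>B\<in>P. F (if Q B then insert 0 ((+) (Suc d) ` B) else (+) (Suc d) ` B))"
proof (rule prod.reindex_cong[OF _ refl refl])
  show "inj_on (\<lambda>B. if Q B then insert 0 ((+) (Suc d) ` B) else (+) (Suc d) ` B) P"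
    by (rule inj_on_inverseI[where g = "\<lambda>X. {j. Suc d + j \<in> X}"]) auto
qed

lemma finite_tree_part: "finite (tree_part t)" and finite_tree_kreweras: "finite (tree_kreweras t)"
  by (rule finite_elements[OF _ partition_on_tree_part], simp)
    (rule finite_elements[OF _ partition_on_tree_kreweras], simp)

lemma empty_notin_tree_part: "{} \<notin> tree_part t" and empty_notin_tree_kreweras: "{} \<notin> tree_kreweras t"
  using partition_onD3 partition_on_tree_part partition_on_tree_kreweras by blast+

lemma prod_tree_part_Node:
  "prod F (tree_part (Node L R)) = (\<Prod>B\<in>tree_part L. F ((+) 1 ` B)) *
     (if R = Leaf then F {0}
      else \<Prod>B\<in>tree_part R. F (if 0 \<in> B then insert 0 ((+) (Suc (size L)) ` B) else (+) (Suc (size L)) ` B))"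
proof -
  have "prod F (tree_part (Node L R)) =
      prod F (shift 1 (tree_part L)) * prod F (add0 (Suc (size L)) (shift (Suc (size L)) (tree_part R)))"
    unfolding tree_part.simps
  proof (rule prod_disjoint_blocks)
    show "finite (shift 1 (tree_part L))" by (simp add: shift_def finite_tree_part)
    show "finite (add0 (Suc (size L)) (shift (Suc (size L)) (tree_part R)))"
      by (simp add: add0_shift_tree_part finite_tree_part)
    show "{} \<notin> shift 1 (tree_part L)" using empty_notin_tree_part by (auto simp: shift_def)
  qed (auto simp: Union_add0 Union_shift)
  then show ?thesis
    unfolding prod_shift add0_shift_tree_part
    by (cases "R = Leaf") (simp, simp only: prod_insert_shift if_False)
qed

lemma prod_tree_kreweras_Node:
  "prod F (tree_kreweras (Node L R)) =
     (if L = Leaf then F {0}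
      else \<Prod>B\<in>tree_kreweras L. F (if size L - 1 \<in> B then insert 0 ((+) 1 ` B) else (+) 1 ` B)) *
     (\<Prod>B\<in>tree_kreweras R. F ((+) (Suc (size L)) ` B))"
proof -
  have "prod F (tree_kreweras (Node L R)) =
      prod F (add0 (size L) (shift 1 (tree_kreweras L))) * prod F (shift (Suc (size L)) (tree_kreweras R))"
    unfolding tree_kreweras.simps Un_commute[of "add0 _ _"] mult.commute[of "prod F (add0 _ _)"]
  proof (rule prod_disjoint_blocks)
    show "finite (shift (Suc (size L)) (tree_kreweras R))" by (simp add: shift_def finite_tree_kreweras)
    show "finite (add0 (size L) (shift 1 (tree_kreweras L)))"
      by (simp add: add0_shift_tree_kreweras finite_tree_kreweras del: One_nat_def)
    show "{} \<notin> shift (Suc (size L)) (tree_kreweras R)" using empty_notin_tree_kreweras by (auto simp: shift_def)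
  qed (auto simp: Union_add0 Union_shift)
  then show ?thesis
    unfolding prod_shift add0_shift_tree_kreweras unfolding One_nat_def
    by (cases "L = Leaf") (simp, simp only: prod_insert_shift if_False)
qed

lemma prod_tree_part:
  assumes "f [] = 1"
  shows "length w = size t \<Longrightarrow>
    (\<Prod>B\<in>tree_part t. f ((if 0 \<in> B then x else []) @ nths w B)) = (if t = Leaf then 1 else part_weight f t w x)"
proof (induction t arbitrary: w x)
  case (Node L R)
  then obtain i v where w: "w = i # v" by (cases w) auto
  have v: "length (take (size L) v) = size L" "length (drop (size L) v) = size R"
    using Node.prems w by auto
  let ?F = "\<lambda>B. f ((if 0 \<in> B then x else []) @ nths w B)"
  have "(\<Prod>B\<in>tree_part L. ?F ((+) 1 ` B)) = (\<Prod>B\<in>tree_part L. f ((if 0 \<in> B then [] else []) @ nths (take (size L) v) B))"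
    by (rule prod.cong)
      (auto simp: w nths_Cons_image_Suc nths_take_subset tree_part_subset simp del: One_nat_def plus_1_eq_Suc)
  also have "\<dots> = part_weight f L (take (size L) v) []"
    unfolding Node.IH(1)[OF v(1)] by (simp add: assms)
  finally have 1: "(\<Prod>B\<in>tree_part L. ?F ((+) 1 ` B)) = part_weight f L (take (size L) v) []" .
  have "(\<Prod>B\<in>tree_part R. ?F (if 0 \<in> B then insert 0 ((+) (Suc (size L)) ` B) else (+) (Suc (size L)) ` B)) =
      (\<Prod>B\<in>tree_part R. f ((if 0 \<in> B then x @ [i] else []) @ nths (drop (size L) v) B))"
  proof (rule prod.cong[OF refl])
    fix B assume "B \<in> tree_part R"
    have "{j. Suc j \<in> (+) (Suc (size L)) ` B} = (+) (size L) ` B" by auto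
    then show "?F (if 0 \<in> B then insert 0 ((+) (Suc (size L)) ` B) else (+) (Suc (size L)) ` B) =
        f ((if 0 \<in> B then x @ [i] else []) @ nths (drop (size L) v) B)"
      by (simp add: w nths_Cons_insert_0 nths_Cons_image_plus nths_drop image_iff del: add_Suc)
  qed
  then have "(\<Prod>B\<in>tree_part R. ?F (if 0 \<in> B then insert 0 ((+) (Suc (size L)) ` B) else (+) (Suc (size L)) ` B)) =
      part_weight f R (drop (size L) v) (x @ [i])" if "R \<noteq> Leaf"
    using Node.IH(2)[OF v(2)] that by simp
  then show ?case
    unfolding prod_tree_part_Node 1 by (auto simp: w nths_Cons_0)
qed simp

text \<open>
If the right subtree is empty, the last node of the tree is the last node of the left subtree, or the root
itself. Its block contains the root, which is therefore appended to \<open>y\<close>. Otherwise the last node is that of the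
right subtree, and the block of the root opens in the left subtree with the root alone.
\<close>

lemma prod_tree_kreweras:
  "length w = size t \<Longrightarrow> t \<noteq> Leaf \<Longrightarrow>
    (\<Prod>B\<in>tree_kreweras t. g ((if size t - 1 \<in> B then y else []) @ nths w B)) = kreweras_weight g t w y"
proof (induction t arbitrary: w y)
  case (Node L R)
  then obtain i v where w: "w = i # v" by (cases w) auto
  have v: "length (take (size L) v) = size L" "length (drop (size L) v) = size R"
    using Node.prems w by auto
  let ?F = "\<lambda>B. g ((if size (Node L R) - 1 \<in> B then y else []) @ nths w B)"
  let ?y = "if R = Leaf then y @ [i] else [i]"
  have 1: "(if L = Leaf then ?F {0}
      else \<Prod>B\<in>tree_kreweras L. ?F (if size L - 1 \<in> B then insert 0 ((+) 1 ` B) else (+) 1 ` B)) =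
      kreweras_weight g L (take (size L) v) ?y"
  proof (cases "L = Leaf")
    case True
    then show ?thesis by (simp add: w nths_Cons_0)
  next
    case False
    have "?F (if size L - 1 \<in> B then insert 0 ((+) 1 ` B) else (+) 1 ` B) =
        g ((if size L - 1 \<in> B then ?y else []) @ nths (take (size L) v) B)" if B: "B \<in> tree_kreweras L" for B
    proof -
      have sub: "B \<subseteq> {..<size L}" using B by (rule tree_kreweras_subset)
      have e: "{j. Suc j \<in> (+) 1 ` B} = B" by auto
      have m: "size (Node L R) - 1 \<in> (+) 1 ` B \<longleftrightarrow> R = Leaf \<and> size L - 1 \<in> B"
      proof
        assume "size (Node L R) - 1 \<in> (+) 1 ` B"
        then obtain b where b: "size L + size R = 1 + b" "b \<in> B" by auto
        then have "b < size L" using sub by blast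
        then have "size R = 0" "b = size L - 1" using b(1) by linarith+
        then show "R = Leaf \<and> size L - 1 \<in> B" using b by simp
      next
        assume "R = Leaf \<and> size L - 1 \<in> B"
        then show "size (Node L R) - 1 \<in> (+) 1 ` B"
          using False by (auto intro!: image_eqI[of _ _ "size L - 1"] simp: Suc_le_eq)
      qed
      have z: "size (Node L R) - 1 \<noteq> 0" using False by simp
      show ?thesis
        using z by (simp only: insert_iff m if_distrib[of "\<lambda>S. _ \<in> S"])
          (auto simp only: w nths_Cons_insert_0 nths_Cons_image_Suc e nths_take_subset[OF sub] if_True if_False
            append_Nil append_Cons append_assoc insert_iff m split: if_splits)
    qed
    then show ?thesis
      using False Node.IH(1)[OF v(1) False, of ?y] by (simp only: if_False) simp
  qed
  have "(\<Prod>B\<in>tree_kreweras R. ?F ((+) (Suc (size L)) ` B)) = (if R = Leaf then 1 else kreweras_weight g R (drop (size L) v) y)"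
  proof (cases "R = Leaf")
    case False
    have "?F ((+) (Suc (size L)) ` B) = g ((if size R - 1 \<in> B then y else []) @ nths (drop (size L) v) B)" for B
    proof -
      have "size (Node L R) - 1 \<in> (+) (Suc (size L)) ` B \<longleftrightarrow> size R - 1 \<in> B"
        using False by (cases R) (auto simp: image_iff)
      then show ?thesis unfolding w nths_Cons_image_plus by simp
    qed
    then show ?thesis using False Node.IH(2)[OF v(2) False, of y] by simp
  qed simp
  then show ?case
    unfolding prod_tree_kreweras_Node 1 using Node.prems by (auto simp: w)
qed simp

section \<open>Boxed convolution as a power series\<close>

definition derivs :: "'k list \<Rightarrow> 'k ser \<Rightarrow> 'k ser" where
  "derivs x A = Ser (\<lambda>w. cf A (x @ w))"

lemma cf_derivs [simp]: "cf (derivs x A) w = cf A (x @ w)"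
  by (simp add: derivs_def)

lemma derivs_Nil [simp]: "derivs [] A = A"
  by (rule ser_eqI) simp

lemma deriv_derivs: "deriv i (derivs x A) = derivs (x @ [i]) A"
  by (rule ser_eqI) simp

text \<open>
The sums \<open>S x\<close> over trees with an open first block satisfy \<open>\<partial>\<^sub>i S(x) = S([]) S(x i)\<close>, and so do the series
\<open>(\<partial>\<^sub>x R)(z\<^sub>1 M, \<dots>, z\<^sub>k M)\<close> by the functional equation of \<open>M\<close>.
\<close>

lemma sum_NC_Cf_part:
  assumes "f [] = 1"
  shows "(\<Sum>\<pi>\<in>NC (length w). Cf_part w \<pi> f) = cf (mom (Ser f)) w"
proof -
  define S where "S x = Ser (\<lambda>w. \<Sum>t\<in>trees (length w). part_weight f t w x)" for x
  have S_Nil: "cf (S x) [] = f x" for x by (simp add: S_def)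
  have dS: "deriv i (S x) = S [] * S (x @ [i])" for i x
  proof (rule ser_eqI)
    fix w
    show "cf (deriv i (S x)) w = cf (S [] * S (x @ [i])) w"
      unfolding S_def cf_mult
      by (simp add: sum_trees_Suc sum_product min_absorb2)
        (auto intro!: sum.cong simp: trees_def)
  qed
  have "agree n (S x) (subst (derivs x (Ser f)) (\<lambda>_. mom (Ser f)))" for n x
  proof (induction n arbitrary: x)
    case (Suc n)
    from Suc[of "[]"] have "agree n (S []) (mom (Ser f))"
      by (simp add: mom_fixpoint assms)
    with Suc show ?case
      by (auto simp: agree_Suc S_Nil dS deriv_subst deriv_derivs intro!: agree_mult)
  qed (simp add: agree_0 S_Nil)
  from agree_all[OF this, of "[]"] have "S [] = mom (Ser f)"
    by (simp add: mom_fixpoint assms)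
  moreover have "(\<Sum>\<pi>\<in>NC (length w). Cf_part w \<pi> f) = (\<Sum>t\<in>trees (length w). part_weight f t w [])"
  proof -
    have "Cf_part w (tree_part t) f = part_weight f t w []" if "t \<in> trees (length w)" for t
      using prod_tree_part[where f = f, OF assms, of w t "[]"] that by (auto simp: Cf_part_def trees_def assms)
    then show ?thesis
      using sum_NC_eq_sum_trees[of "\<lambda>\<pi> _. Cf_part w \<pi> f"] by simp
  qed
  moreover have "cf (S []) w = (\<Sum>t\<in>trees (length w). part_weight f t w [])"
    by (simp add: S_def)
  ultimately show ?thesis by simp
qed

definition box :: "'k nc_series \<Rightarrow> 'k nc_series \<Rightarrow> 'k nc_series" where
  "box f g w = (\<Sum>\<pi>\<in>NC (length w). Cf_part w \<pi> f * Cf_part w (kreweras (length w) \<pi>) g)"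

text \<open>
Boxed convolution with open blocks on both sides.
\<close>

definition box_ext :: "'k nc_series \<Rightarrow> 'k nc_series \<Rightarrow> 'k list \<Rightarrow> 'k list \<Rightarrow> 'k ser" where
  "box_ext f g x y = Ser (\<lambda>w. \<Sum>t\<in>trees (length w). part_weight f t w x * kreweras_weight g t w y)"

lemma cf_box_ext_Nil [simp]: "cf (box_ext f g x y) [] = f x * g y"
  by (simp add: box_ext_def)

text \<open>
The decomposition of a tree at its root. The first summand collects the trees with nonempty right subtree,
from which the constant term, that is the empty right subtree, has been removed; the second collects the trees
with empty right subtree, where the open block of the complement passes to the left subtree.
\<close>

lemma deriv_box_ext:
  "deriv i (box_ext f g x y) =
     box_ext f g [] [i] * (box_ext f g (x @ [i]) y - cst (f (x @ [i]) * g y)) +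
     cst (f (x @ [i])) * box_ext f g [] (y @ [i])"
proof (rule ser_eqI)
  fix w :: "'a list"
  let ?n = "length w"
  define T where "T k = (\<Sum>L\<in>trees k. \<Sum>R\<in>trees (?n - k).
      part_weight f (Node L R) (i # w) x * kreweras_weight g (Node L R) (i # w) y)" for k
  have T: "T k = cf (box_ext f g [] [i]) (take k w) * cf (box_ext f g (x @ [i]) y) (drop k w)" if "k < ?n" for k
    using that unfolding T_def box_ext_def
    by (auto simp: sum_product min_absorb2 trees_def algebra_simps intro!: sum.cong)
  have Tn: "T ?n = f (x @ [i]) * cf (box_ext f g [] (y @ [i])) w"
    unfolding T_def box_ext_def
    by (auto simp: sum_distrib_left trees_def algebra_simps intro!: sum.cong)
  have "cf (deriv i (box_ext f g x y)) w = (\<Sum>k\<le>?n. T k)"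
    by (simp add: box_ext_def sum_trees_Suc T_def del: part_weight.simps kreweras_weight.simps)
  also have "\<dots> = (\<Sum>k<?n. T k) + T ?n"
    by (simp add: lessThan_Suc_atMost[symmetric])
  also have "(\<Sum>k<?n. T k) =
      cf (box_ext f g [] [i] * (box_ext f g (x @ [i]) y - cst (f (x @ [i]) * g y))) w"
    unfolding cf_mult lessThan_Suc_atMost[symmetric] sum.lessThan_Suc
    by (simp add: cf_cst T)
  finally show "cf (deriv i (box_ext f g x y)) w =
      cf (box_ext f g [] [i] * (box_ext f g (x @ [i]) y - cst (f (x @ [i]) * g y)) +
        cst (f (x @ [i])) * box_ext f g [] (y @ [i])) w"
    by (simp add: Tn)
qed

lemma Ser_box_eq:
  assumes "f [] = 1" "g [] = 1"
  shows "Ser (box f g) = box_ext f g [] []"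
proof (rule ser_eqI)
  fix w
  have "Cf_part w (tree_part t) f * Cf_part w (tree_kreweras t) g = part_weight f t w [] * kreweras_weight g t w []"
    if "t \<in> trees (length w)" for t
  proof -
    have len: "length w = size t" using that by (simp add: trees_def)
    show ?thesis
      using prod_tree_part[of f w t "[]", OF assms(1) len] prod_tree_kreweras[of w t g "[]", OF len]
      by (cases "t = Leaf") (simp_all add: Cf_part_def assms)
  qed
  then show "cf (Ser (box f g)) w = cf (box_ext f g [] []) w"
    using sum_NC_eq_sum_trees[of "\<lambda>\<pi> \<sigma>. Cf_part w \<pi> f * Cf_part w \<sigma> g"]
    by (simp add: box_def box_ext_def)
qed

lemma box_eq_cf_box_ext:
  assumes "f [] = 1" "g [] = 1"
  shows "box f g w = cf (box_ext f g [] []) w"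
  unfolding Ser_box_eq[of f g, OF assms, symmetric] by simp

section \<open>Moments of the product of free tuples\<close>

text \<open>
The joint cumulants of two free tuples: all mixed cumulants vanish.
\<close>

definition mix :: "'k nc_series \<Rightarrow> 'k nc_series \<Rightarrow> ('k + 'k) ser" where
  "mix f g = Ser (\<lambda>w. if list_all isl w then f (map projl w)
     else if list_all (Not \<circ> isl) w then g (map projr w) else 0)"

definition interleave :: "'k list \<Rightarrow> ('k + 'k) list" where
  "interleave w = concat (map (\<lambda>i. [Inl i, Inr i]) w)"

lemma interleave_Nil [simp]: "interleave [] = []" and interleave_Cons [simp]: "interleave (i # w) = Inl i # Inr i # interleave w"
  by (simp_all add: interleave_def)

lemma length_interleave [simp]: "length (interleave w) = 2 * length w"
  by (induction w) auto

text \<open>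
A word \<open>a\<^sub>1 b\<^sub>1 \<dots> a\<^sub>n b\<^sub>n\<close> can be cut between two pairs or inside a pair.
\<close>

lemma sum_splits_interleave:
  fixes Z :: "('k + 'k) list \<Rightarrow> ('k + 'k) list \<Rightarrow> complex"
  shows "(\<Sum>k\<le>2 * length w. Z (take k (interleave w)) (drop k (interleave w))) =
    (\<Sum>k\<le>length w. Z (interleave (take k w)) (interleave (drop k w))) +
    (\<Sum>k<length w. Z (interleave (take k w) @ [Inl (w ! k)]) (Inr (w ! k) # interleave (drop (Suc k) w)))"
proof (induction w arbitrary: Z)
  case (Cons i w)
  show ?case
    using Cons.IH[of "\<lambda>u. Z (Inl i # Inr i # u)"]
    by (simp add: sum.atMost_Suc_shift sum.lessThan_Suc_shift del: sum.atMost_Suc sum.lessThan_Suc)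
qed simp

text \<open>
The contribution to the moment of the word \<open>x v\<close> of those non-crossing partitions in which all of \<open>x\<close> and
the first letter of \<open>v\<close>, if any, lie in one block; \<open>open_block_Cons\<close> sums over the next element of this
block.
\<close>

definition open_block :: "'c ser \<Rightarrow> 'c list \<Rightarrow> 'c list \<Rightarrow> complex" where
  "open_block R x v = cf (subst (derivs x R) (\<lambda>_. mom R)) v"

lemma open_block_Nil [simp]: "open_block R x [] = cf R x"
  by (simp add: open_block_def)

lemma open_block_Cons:
  "open_block R x (j # v) = (\<Sum>k\<le>length v. cf (mom R) (take k v) * open_block R (x @ [j]) (drop k v))"
proof -
  have "open_block R x (j # v) = cf (deriv j (subst (derivs x R) (\<lambda>_. mom R))) v"
    by (simp add: open_block_def)
  then show ?thesis
    by (simp add: deriv_subst deriv_derivs cf_mult open_block_def del: cf_deriv)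
qed

lemma open_block_empty: "cf R [] = 1 \<Longrightarrow> open_block R [] v = cf (mom R) v"
  by (simp add: open_block_def mom_fixpoint)

lemma open_block_mixed: "\<exists>i j. Inl i \<in> set x \<and> Inr j \<in> set x \<Longrightarrow> open_block (mix f g) x v = 0"
proof (induction v arbitrary: x rule: length_induct)
  case (1 v)
  show ?case
  proof (cases v)
    case Nil
    then show ?thesis using 1(2) by (fastforce simp: mix_def list_all_iff)
  next
    case (Cons j v')
    have "open_block (mix f g) (x @ [j]) (drop k v') = 0" for k
      using 1(2) Cons by (intro 1(1)[rule_format]) auto
    then show ?thesis by (simp add: Cons open_block_Cons)
  qed
qed

lemma open_block_Inl_Inr [simp]: "x \<noteq> [] \<Longrightarrow> open_block (mix f g) (map Inl x) (Inr j # v) = 0"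
  and open_block_Inr_Inl [simp]: "x \<noteq> [] \<Longrightarrow> open_block (mix f g) (map Inr x) (Inl j # v) = 0"
  by (cases x; auto simp: open_block_Cons intro!: sum.neutral open_block_mixed)+

lemma cf_mix_Inl [simp]: "cf (mix f g) (map Inl w) = f w"
  by (simp add: mix_def list_all_iff comp_def)

lemma cf_mix_Inr [simp]: "w \<noteq> [] \<Longrightarrow> cf (mix f g) (map Inr w) = g w"
  by (cases w) (simp_all add: mix_def list_all_iff comp_def)

lemma cf_mix_Nil [simp]: "cf (mix f g) [] = f []"
  by (simp add: mix_def)

text \<open>
Let \<open>a\<close> and \<open>b\<close> be free with cumulants \<open>f\<close> and \<open>g\<close>. The moments of the words \<open>a b \<dots> a b\<close> do not
satisfy a closed system of equations by themselves: the gaps of a block of letters \<open>b\<close> are words that end in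
a single \<open>a\<close>. Therefore words \<open>a b \<dots> a b a\<close> are treated at the same time; the final letter is the argument
of type \<open>'k option\<close>. The series \<open>Amom\<close> contain an open block of letters \<open>a\<close>, the series \<open>Bmom\<close> an open block
of letters \<open>b\<close> whose next gap has not been read yet.
\<close>

context
  fixes f g :: "'k::finite nc_series"
  assumes fg: "f [] = 1" "g [] = 1"
begin

definition tail_word :: "'k option \<Rightarrow> ('k + 'k) list" where
  "tail_word x = (case x of None \<Rightarrow> [] | Some i \<Rightarrow> [Inl i])"

definition mix_mom :: "('k + 'k) list \<Rightarrow> complex" where
  "mix_mom = cf (mom (mix f g))"

definition Amom :: "'k option \<Rightarrow> 'k list \<Rightarrow> 'k ser" where
  "Amom x y = Ser (\<lambda>w. open_block (mix f g) (map Inl y) (interleave w @ tail_word x))"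

definition Bmom :: "'k option \<Rightarrow> 'k list \<Rightarrow> 'k ser" where
  "Bmom x y = Ser (\<lambda>w. \<Sum>k\<le>length (interleave w @ tail_word x).
     mix_mom (take k (interleave w @ tail_word x)) * open_block (mix f g) (map Inr y) (drop k (interleave w @ tail_word x)))"

lemma mix_mom_Inr: "mix_mom (Inr i # interleave w @ tail_word x) = cf (Bmom x [i]) w"
proof -
  have "mix_mom v = open_block (mix f g) [] v" for v
    by (simp add: mix_mom_def open_block_empty fg)
  then have "mix_mom (Inr i # v) = (\<Sum>k\<le>length v. mix_mom (take k v) * open_block (mix f g) [Inr i] (drop k v))" for v
    by (simp add: open_block_Cons mix_mom_def)
  then show ?thesis by (simp add: Bmom_def)
qed

lemma mix_mom_eq_Amom: "mix_mom (interleave w @ tail_word x) = cf (Amom x []) w"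
  by (simp add: Amom_def open_block_empty fg mix_mom_def)

lemma sum_splits_tail:
  fixes Z :: "('k + 'k) list \<Rightarrow> ('k + 'k) list \<Rightarrow> complex"
  shows "(\<Sum>k\<le>length (interleave w @ tail_word x). Z (take k (interleave w @ tail_word x)) (drop k (interleave w @ tail_word x))) =
    (\<Sum>k\<le>length w. Z (interleave (take k w)) (interleave (drop k w) @ tail_word x)) +
    (\<Sum>k<length w. Z (interleave (take k w) @ [Inl (w ! k)]) (Inr (w ! k) # interleave (drop (Suc k) w) @ tail_word x)) +
    (if x = None then 0 else Z (interleave w @ tail_word x) [])"
proof -
  have "(\<Sum>k\<le>2 * length w. Z (take k (interleave w @ tail_word x)) (drop k (interleave w @ tail_word x))) =
      (\<Sum>k\<le>2 * length w. (\<lambda>u v. Z u (v @ tail_word x)) (take k (interleave w)) (drop k (interleave w)))"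
    by (rule sum.cong) auto
  note this[unfolded sum_splits_interleave[where Z = "\<lambda>u v. Z u (v @ tail_word x)"]]
  then show ?thesis
    by (cases x) (simp_all add: tail_word_def)
qed

lemma Amom_Nil: "cf (Amom x y) [] = (case x of None \<Rightarrow> f y | Some i \<Rightarrow> f (y @ [i]))"
proof (cases x)
  case (Some i)
  then show ?thesis
    using cf_mix_Inl[of f g "y @ [i]"] by (simp add: Amom_def tail_word_def open_block_Cons)
qed (simp add: Amom_def tail_word_def)

text \<open>
The gap up to the next member of the open block starts with \<open>b\<^sub>i\<close> and ends with a letter \<open>b\<close>, or it extends
to the end of the word, in which case a final letter \<open>a\<close> belongs to it.
\<close>

lemma deriv_Amom:
  "deriv i (Amom x y) = Bmom None [i] * Amom x (y @ [i]) +
     (if x = None then 0 else cst (f (y @ [i])) * Bmom x [i])"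
proof (rule ser_eqI)
  fix w
  let ?Z = "\<lambda>u v. mix_mom (Inr i # u) * open_block (mix f g) (map Inl (y @ [i])) v"
  have "cf (deriv i (Amom x y)) w = (\<Sum>k\<le>length (interleave w @ tail_word x).
      ?Z (take k (interleave w @ tail_word x)) (drop k (interleave w @ tail_word x)))"
    unfolding Amom_def
    by (simp add: open_block_Cons[of _ "map Inl y"] sum.atMost_Suc_shift mix_mom_def del: sum.atMost_Suc)
      (use open_block_Inl_Inr[of "y @ [i]" f g i] in simp)
  also have "\<dots> = cf (Bmom None [i] * Amom x (y @ [i])) w +
      (if x = None then 0 else f (y @ [i]) * cf (Bmom x [i]) w)"
    unfolding sum_splits_tail[where Z = ?Z]
    using mix_mom_Inr[of i _ None] mix_mom_Inr[of i _ x] cf_mix_Inl[of f g "y @ [i]"]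
      open_block_Inl_Inr[of "y @ [i]" f g]
    by (simp add: cf_mult Amom_def tail_word_def del: cf_mix_Inl)
  finally show "cf (deriv i (Amom x y)) w =
      cf (Bmom None [i] * Amom x (y @ [i]) + (if x = None then 0 else cst (f (y @ [i])) * Bmom x [i])) w"
    by simp
qed

text \<open>
Either the open block is complete and the whole word is a gap, or the word is cut inside a pair, before the
letter \<open>b\<^sub>j\<close> that continues the block.
\<close>

lemma Bmom_eq:
  assumes "y \<noteq> []"
  shows "Bmom x y = cst (g y) * Amom x [] + (\<Sum>j\<in>UNIV. Amom (Some j) [] * var j * Bmom x (y @ [j]))"
proof (rule ser_eqI)
  fix w
  have even: "open_block (mix f g) (map Inr y) (interleave (drop k w) @ tail_word x) =
      (if k = length w \<and> x = None then g y else 0)" if k: "k \<le> length w" for k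
  proof (cases "k = length w")
    case True
    then show ?thesis using assms by (cases x) (simp_all add: tail_word_def)
  next
    case False
    then obtain j v where "drop k w = j # v" using k by (cases "drop k w") auto
    then show ?thesis using assms False by simp
  qed
  have odd: "open_block (mix f g) (map Inr y) (Inr j # interleave v @ tail_word x) = cf (Bmom x (y @ [j])) v" for j v
    unfolding Bmom_def by (simp add: open_block_Cons mix_mom_def)
  have L: "mix_mom (interleave u @ [Inl j]) = cf (Amom (Some j) []) u" for u j
    using mix_mom_eq_Amom[of u "Some j"] by (simp add: tail_word_def)
  have "(\<Sum>k\<le>length w. mix_mom (interleave (take k w)) * open_block (mix f g) (map Inr y) (interleave (drop k w) @ tail_word x)) =
      (\<Sum>k\<le>length w. if k = length w then if x = None then mix_mom (interleave w) * g y else 0 else 0)"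
    by (rule sum.cong) (auto simp: even)
  also have "\<dots> = (if x = None then mix_mom (interleave w @ tail_word x) * g y else 0)"
    by (simp add: tail_word_def)
  finally have sum_even: "(\<Sum>k\<le>length w. mix_mom (interleave (take k w)) *
      open_block (mix f g) (map Inr y) (interleave (drop k w) @ tail_word x)) =
      (if x = None then mix_mom (interleave w @ tail_word x) * g y else 0)" .
  have "cf (Bmom x y) w = (if x = None then mix_mom (interleave w @ tail_word x) * g y else 0) +
      (\<Sum>k<length w. cf (Amom (Some (w ! k)) []) (take k w) * cf (Bmom x (y @ [w ! k])) (drop (Suc k) w)) +
      (if x = None then 0 else mix_mom (interleave w @ tail_word x) * g y)"
    unfolding Bmom_def[of x y] ser.sel
    unfolding sum_splits_tail[where Z = "\<lambda>u v. mix_mom u * open_block (mix f g) (map Inr y) v"] sum_even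
    using assms by (simp add: odd L)
  also have "(\<Sum>k<length w. cf (Amom (Some (w ! k)) []) (take k w) * cf (Bmom x (y @ [w ! k])) (drop (Suc k) w)) =
      cf (\<Sum>j\<in>UNIV. Amom (Some j) [] * var j * Bmom x (y @ [j])) w"
    by (simp add: cf_mult_var) (subst sum.swap, simp)
  finally show "cf (Bmom x y) w =
      cf (cst (g y) * Amom x [] + (\<Sum>j\<in>UNIV. Amom (Some j) [] * var j * Bmom x (y @ [j]))) w"
    by (simp add: mix_mom_eq_Amom)
qed

text \<open>
The claimed solution. With \<open>M\<close> for \<open>box_mom\<close>, the series of moments with cumulants \<open>box f g\<close>, let \<open>Jser\<close> be
boxed convolution with open blocks at \<open>z\<^sub>i M\<close>, and let \<open>N\<^sub>i = M * Jser [] [i]\<close>; then \<open>N\<^sub>i\<close> is to be the moment series of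
the words \<open>b\<^sub>i a b \<dots> a b\<close>. The series \<open>Lser\<close> is \<open>f\<close> at \<open>z\<^sub>i N\<^sub>i\<close> with a prescribed beginning and end of the word. A word
ending in \<open>a\<^sub>j\<close> has moment series \<open>M * Lser [] j\<close>: the block of the final letter is preceded by an arbitrary
word \<open>a b \<dots> a b\<close>.
\<close>

definition box_mom :: "'k ser" where
  "box_mom = mom (Ser (box f g))"

definition Jser :: "'k list \<Rightarrow> 'k list \<Rightarrow> 'k ser" where
  "Jser x y = subst (box_ext f g x y) (\<lambda>_. box_mom)"

definition Lser :: "'k list \<Rightarrow> 'k \<Rightarrow> 'k ser" where
  "Lser y j = subst (Ser (\<lambda>w. f (y @ w @ [j]))) (\<lambda>i. box_mom * Jser [] [i])"

lemma Jser_Nil [simp]: "cf (Jser x y) [] = f x * g y"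
  by (simp add: Jser_def)

lemma Jser_Nil_Nil: "Jser [] [] = box_mom"
proof -
  have "cf (Ser (box f g)) [] = 1"
    by (simp add: Ser_box_eq[of f g, OF fg] fg)
  from mom_fixpoint[OF this] show ?thesis
    by (simp add: Jser_def box_mom_def Ser_box_eq[of f g, OF fg, symmetric])
qed

lemma deriv_Jser:
  "deriv i (Jser x y) = box_mom * Jser [] [i] * (Jser (x @ [i]) y - cst (f (x @ [i]) * g y)) +
     cst (f (x @ [i])) * (box_mom * Jser [] (y @ [i]))"
proof -
  have "deriv i (Jser x y) = box_mom * (Jser [] [i] * (Jser (x @ [i]) y - cst (f (x @ [i]) * g y)) +
      cst (f (x @ [i])) * Jser [] (y @ [i]))"
    unfolding Jser_def deriv_subst deriv_box_ext
    by (simp add: subst_add subst_mult subst_minus)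
  then show ?thesis
    by (simp add: distrib_left mult.assoc[symmetric] cst_commute)
qed

lemma deriv_Lser: "deriv i (Lser y j) = box_mom * Jser [] [i] * Lser (y @ [i]) j"
  by (simp add: Lser_def deriv_subst) (simp add: deriv_def)

lemma Lser_Nil [simp]: "cf (Lser y j) [] = f (y @ [j])"
  by (simp add: Lser_def)

text \<open>
In boxed convolution with an open block of the complement, this block either ends at once or continues with
the letter \<open>j\<close>; the part of the word before that letter is a sequence of gaps of blocks of letters \<open>a\<close>. This turns
the equation by which \<open>Jser\<close> is defined, a recursion over blocks of \<open>a\<close>, into the shape of \<open>Bmom_eq\<close>, a recursion
over blocks of \<open>b\<close>.
\<close>

lemma Jser_expansion:
  "Jser x y = cst (f x * g y) + (\<Sum>j\<in>UNIV. Lser x j * var j * (box_mom * Jser [] (y @ [j])))"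
proof (rule agree_all)
  fix n
  show "agree n (Jser x y) (cst (f x * g y) + (\<Sum>j\<in>UNIV. Lser x j * var j * (box_mom * Jser [] (y @ [j]))))"
  proof (induction n arbitrary: x)
    case (Suc n)
    have "agree n (deriv i (Jser x y))
       (deriv i (cst (f x * g y) + (\<Sum>j\<in>UNIV. Lser x j * var j * (box_mom * Jser [] (y @ [j])))))" for i
    proof -
      have "deriv i (cst (f x * g y) + (\<Sum>j\<in>UNIV. Lser x j * var j * (box_mom * Jser [] (y @ [j])))) =
          box_mom * Jser [] [i] * (\<Sum>j\<in>UNIV. Lser (x @ [i]) j * var j * (box_mom * Jser [] (y @ [j]))) +
          cst (f (x @ [i])) * (box_mom * Jser [] (y @ [i]))"
        by (simp add: deriv_mult_var deriv_Lser sum.distrib sum_distrib_left) (simp add: mult.assoc)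
      moreover have "agree n (Jser (x @ [i]) y - cst (f (x @ [i]) * g y))
          (\<Sum>j\<in>UNIV. Lser (x @ [i]) j * var j * (box_mom * Jser [] (y @ [j])))"
        using Suc[of "x @ [i]"] by (simp add: agree_def)
      ultimately show ?thesis
        unfolding deriv_Jser by (auto intro!: agree_add agree_mult)
    qed
    then show ?case by (simp add: agree_Suc mult.assoc)
  qed (simp add: agree_0 mult.assoc)
qed

definition Asol :: "'k option \<Rightarrow> 'k list \<Rightarrow> 'k ser" where
  "Asol x y = (case x of None \<Rightarrow> Jser y [] | Some j \<Rightarrow> Lser y j + (Jser y [] - cst (f y)) * Lser [] j)"

definition Bsol :: "'k option \<Rightarrow> 'k list \<Rightarrow> 'k ser" where
  "Bsol x y = box_mom * Jser [] y * (case x of None \<Rightarrow> 1 | Some j \<Rightarrow> Lser [] j)"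

lemma Asol_Nil: "cf (Asol x y) [] = cf (Amom x y) []"
  by (cases x) (simp_all add: Amom_Nil Asol_def fg)

lemma Asol_Some_Nil: "Asol (Some j) [] = box_mom * Lser [] j"
  by (simp add: Asol_def Jser_Nil_Nil fg algebra_simps)

lemma deriv_Asol:
  "deriv i (Asol x y) = Bsol None [i] * Asol x (y @ [i]) +
     (if x = None then 0 else cst (f (y @ [i])) * Bsol x [i])"
proof -
  have c: "box_mom * Jser [] [i] * cst a = cst a * (box_mom * Jser [] [i])" for a
    by (rule cst_commute)
  have dJ: "deriv i (Jser y []) = box_mom * Jser [] [i] * Jser (y @ [i]) []"
    unfolding deriv_Jser right_diff_distrib fg mult_1_right c by simp
  show ?thesis
  proof (cases x)
    case None
    then show ?thesis by (simp add: Asol_def Bsol_def dJ)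
  next
    case (Some j)
    have "deriv i (Asol x y) = box_mom * Jser [] [i] * Lser (y @ [i]) j + box_mom * Jser [] [i] * Jser (y @ [i]) [] * Lser [] j"
      by (simp add: Asol_def Some deriv_Lser deriv_mult dJ fg)
    also have "\<dots> = box_mom * Jser [] [i] * (Lser (y @ [i]) j + (Jser (y @ [i]) [] - cst (f (y @ [i]))) * Lser [] j) +
        box_mom * Jser [] [i] * cst (f (y @ [i])) * Lser [] j"
      by (simp add: algebra_simps)
    finally show ?thesis unfolding c by (simp add: Asol_def Bsol_def Some mult.assoc)
  qed
qed

lemma Bsol_eq:
  "Bsol x y = cst (g y) * Asol x [] + (\<Sum>j\<in>UNIV. Asol (Some j) [] * var j * Bsol x (y @ [j]))"
proof -
  let ?t = "case x of None \<Rightarrow> 1 | Some j \<Rightarrow> Lser [] j"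
  have "box_mom * Jser [] y = cst (g y) * box_mom + (\<Sum>j\<in>UNIV. box_mom * Lser [] j * var j * (box_mom * Jser [] (y @ [j])))"
    by (subst Jser_expansion) (simp add: fg distrib_left cst_commute sum_distrib_left mult.assoc)
  then have "Bsol x y = cst (g y) * (box_mom * ?t) +
      (\<Sum>j\<in>UNIV. box_mom * Lser [] j * var j * (box_mom * Jser [] (y @ [j]))) * ?t"
    by (simp only: Bsol_def distrib_right mult.assoc)
  moreover have "Asol x [] = box_mom * ?t"
    by (cases x) (simp_all add: Asol_Some_Nil, simp add: Asol_def Jser_Nil_Nil)
  ultimately show ?thesis
    by (simp add: Asol_Some_Nil Bsol_def sum_distrib_right mult.assoc)
qed

text \<open>
The equations for \<open>Amom\<close> and \<open>Bmom\<close> determine these series: at length \<open>n + 1\<close> the series \<open>Amom\<close> depend on both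
families up to length \<open>n\<close>, and then \<open>Bmom\<close> depends on \<open>Amom\<close> up to length \<open>n + 1\<close> and on \<open>Bmom\<close> up to length \<open>n\<close>.
\<close>

lemma agree_Amom_Bmom:
  "(\<forall>x y. agree n (Amom x y) (Asol x y)) \<and> (\<forall>x y. y \<noteq> [] \<longrightarrow> agree n (Bmom x y) (Bsol x y))"
proof (induction n)
  case 0
  have "agree 0 (Bmom x y) (Bsol x y)" if "y \<noteq> []" for x y
    unfolding Bmom_eq[OF that] Bsol_eq[of x y] agree_0 by (simp add: Asol_Nil mult.assoc)
  then show ?case by (auto simp: agree_0 Asol_Nil)
next
  case (Suc n)
  have Amom: "agree (Suc n) (Amom x y) (Asol x y)" for x y
    unfolding agree_Suc deriv_Amom deriv_Asol Asol_Nil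
    using Suc by (auto intro!: agree_add agree_mult)
  moreover have "agree (Suc n) (Bmom x y) (Bsol x y)" if "y \<noteq> []" for x y
    unfolding Bmom_eq[OF that] Bsol_eq[of x y]
    using Suc Amom by (intro agree_add agree_mult agree_sum agree_mult_var) auto
  ultimately show ?case by blast
qed

lemma mom_mix_interleave: "cf (mom (mix f g)) (interleave w) = cf (mom (Ser (box f g))) w"
proof -
  have "Amom None [] = Asol None []"
    by (rule agree_all) (use agree_Amom_Bmom in blast)
  then have "cf (Amom None []) w = cf box_mom w"
    by (simp add: Asol_def Jser_Nil_Nil)
  then show ?thesis
    using mix_mom_eq_Amom[of w None] by (simp add: tail_word_def mix_mom_def box_mom_def)
qed

end

section \<open>Free multiplicative convolution in terms of cumulants\<close>

definition relabel :: "('a \<Rightarrow> 'c) \<Rightarrow> 'c ser \<Rightarrow> 'a ser" where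
  "relabel h A = Ser (\<lambda>w. cf A (map h w))"

lemma cf_relabel [simp]: "cf (relabel h A) w = cf A (map h w)"
  by (simp add: relabel_def)

lemma relabel_fock: "relabel h (fock R F (map h w)) = fock (relabel h R) (relabel h F) w"
proof (induction w arbitrary: F)
  case (Cons j w)
  have "relabel h (fock_step R F (h j)) = fock_step (relabel h R) (relabel h F) j"
    by (rule ser_eqI) (simp add: fock_step_def cf_mult take_map drop_map)
  then show ?case by (simp add: Cons.IH)
qed simp

lemma mom_relabel: "cf (mom R) (map h w) = cf (mom (relabel h R)) w"
proof -
  have "relabel h 1 = 1" by (rule ser_eqI) (simp add: cf_one)
  then have "cf (relabel h (fock R 1 (map h w))) [] = cf (fock (relabel h R) 1 w) []"
    by (simp only: relabel_fock)
  then show ?thesis by (simp add: mom_def)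
qed

definition with_cumulants :: "'k nc_series \<Rightarrow> 'k nc_poly \<Rightarrow> complex" where
  "with_cumulants f = functional (mom (Ser f))"

lemma with_cumulants_X_word: "with_cumulants f (X_word w) = cf (mom (Ser f)) w"
  by (simp add: with_cumulants_def)

lemma distribution_letters:
  assumes "relabel h R = Ser f"
  shows "distribution (functional (mom R)) (\<lambda>i. X_word [h i]) = with_cumulants f"
proof -
  have "concat (map (\<lambda>i. [h i]) w) = map h w" for w by (induction w) auto
  then show ?thesis
    by (simp add: distribution_functional mom_relabel assms with_cumulants_def)
qed

text \<open>
The cumulants of \<open>a\<^sub>i b\<^sub>i\<close> for free tuples \<open>a\<close> and \<open>b\<close>, read off from the realization without mixed cumulants.
\<close>

lemma free_mult_conv_with_cumulants:
  fixes f g :: "'k::finite nc_series"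
  assumes "f [] = 1" "g [] = 1"
  shows "with_cumulants f \<boxtimes> with_cumulants g = with_cumulants (box f g)"
proof -
  let ?\<phi> = "functional (mom (mix f g))"
  have "relabel Inl (mix f g) = Ser f" by (rule ser_eqI) simp
  moreover have "relabel Inr (mix f g) = Ser g"
  proof (rule ser_eqI)
    show "cf (relabel Inr (mix f g)) w = cf (Ser g) w" for w
      using assms by (cases "w = []") simp_all
  qed
  moreover have "freely_independent pm_scale ?\<phi> (range (\<lambda>i. X_word [Inl i])) (range (\<lambda>i. X_word [Inr i]))"
  proof (rule free_coloured[where col = isl])
    show "cf (mix f g) w = 0" if "x \<in> set w" "y \<in> set w" "isl x \<noteq> isl y" for w x y
      using that by (auto simp: mix_def list_all_iff)
  qed (auto simp: coloured_def X_word_def)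
  ultimately have "free_realization pm_scale ?\<phi> (\<lambda>i. X_word [Inl i]) (\<lambda>i. X_word [Inr i])
      (with_cumulants f) (with_cumulants g)"
    by (simp add: free_realization_def nc_prob_space_functional distribution_letters)
  from free_mult_conv_eq[OF this] show ?thesis
    using distribution_functional[of "mom (mix f g)" "\<lambda>i. [Inl i, Inr i]"]
    by (simp add: X_word_append with_cumulants_def mom_mix_interleave[of f g, OF assms] flip: interleave_def)
qed

text \<open>
Joint cumulants of a sequence of free tuples; the first component of a letter says to which tuple it belongs.
\<close>

definition multi_mix :: "(nat \<Rightarrow> 'k nc_series) \<Rightarrow> (nat \<times> 'k) ser" where
  "multi_mix F = Ser (\<lambda>w. if w = [] then 1
     else if \<forall>x\<in>set w. fst x = fst (hd w) then F (fst (hd w)) (map snd w) else 0)"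

text \<open>
Three tuples without mixed cumulants realize both sides as the distribution of \<open>a\<^sub>i b\<^sub>i c\<^sub>i\<close>: colouring one or two of the
tuples against the rest shows that \<open>a\<close> is free from \<open>b\<close>, that \<open>a b\<close> is free from \<open>c\<close>, and so on.
\<close>

lemma free_mult_conv_assoc:
  fixes f g h :: "'k::finite nc_series"
  assumes "f [] = 1" "g [] = 1" "h [] = 1"
  shows "(with_cumulants f \<boxtimes> with_cumulants g) \<boxtimes> with_cumulants h =
    with_cumulants f \<boxtimes> (with_cumulants g \<boxtimes> with_cumulants h)"
proof -
  define F where "F c = (if c = 0 then f else if c = 1 then g else h)" for c :: nat
  let ?\<phi> = "functional (mom (multi_mix F))"
  let ?a = "\<lambda>c i. X_word [(c :: nat, i :: 'k)]"
  have ps: "nc_prob_space pm_scale ?\<phi>" by (rule nc_prob_space_functional) simp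
  have dist: "distribution ?\<phi> (?a c) = with_cumulants (F c)" for c
  proof (rule distribution_letters)
    show "relabel (Pair c) (multi_mix F) = Ser (F c)"
    proof (rule ser_eqI)
      show "cf (relabel (Pair c) (multi_mix F)) w = cf (Ser (F c)) w" for w
        using assms by (cases w) (simp_all add: multi_mix_def F_def comp_def)
    qed
  qed
  have free: "freely_independent pm_scale ?\<phi> (range a) (range b)"
    if "range a \<subseteq> coloured (\<lambda>x. fst x \<in> C) True" "range b \<subseteq> coloured (\<lambda>x. fst x \<in> C) False"
    for a b :: "'k \<Rightarrow> (nat \<times> 'k) nc_poly" and C
  proof (rule free_coloured[where col = "\<lambda>x. fst x \<in> C"])
    show "cf (multi_mix F) w = 0" if "x \<in> set w" "y \<in> set w" "(fst x \<in> C) \<noteq> (fst y \<in> C)" for w x y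
    proof -
      have "\<not> (\<forall>z\<in>set w. fst z = fst (hd w))"
      proof
        assume "\<forall>z\<in>set w. fst z = fst (hd w)"
        then have "fst x = fst y" using that(1,2) by simp
        then show False using that(3) by simp
      qed
      moreover have "w \<noteq> []" using that(1) by auto
      ultimately show ?thesis unfolding multi_mix_def ser.sel by (simp only: if_False)
    qed
  qed (use that in auto)
  have conv: "distribution ?\<phi> a \<boxtimes> distribution ?\<phi> b = distribution ?\<phi> (\<lambda>i. a i * b i)"
    if "range a \<subseteq> coloured (\<lambda>x. fst x \<in> C) True" "range b \<subseteq> coloured (\<lambda>x. fst x \<in> C) False"
    for a b :: "'k \<Rightarrow> (nat \<times> 'k) nc_poly" and C
    by (rule free_mult_conv_eq[where scale = pm_scale])
      (simp add: free_realization_def ps free[OF that])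
  have "distribution ?\<phi> (?a 0) \<boxtimes> distribution ?\<phi> (?a 1) = distribution ?\<phi> (\<lambda>i. ?a 0 i * ?a 1 i)"
    by (rule conv[of _ "{0}"]) (auto simp: coloured_def X_word_def)
  moreover have "distribution ?\<phi> (\<lambda>i. ?a 0 i * ?a 1 i) \<boxtimes> distribution ?\<phi> (?a 2) =
      distribution ?\<phi> (\<lambda>i. ?a 0 i * ?a 1 i * ?a 2 i)"
    by (rule conv[of _ "{0, 1}"]) (auto simp: coloured_def X_word_append, auto simp: X_word_def)
  moreover have "distribution ?\<phi> (?a 1) \<boxtimes> distribution ?\<phi> (?a 2) = distribution ?\<phi> (\<lambda>i. ?a 1 i * ?a 2 i)"
    by (rule conv[of _ "{1}"]) (auto simp: coloured_def X_word_def)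
  moreover have "distribution ?\<phi> (?a 0) \<boxtimes> distribution ?\<phi> (\<lambda>i. ?a 1 i * ?a 2 i) =
      distribution ?\<phi> (\<lambda>i. ?a 0 i * (?a 1 i * ?a 2 i))"
    by (rule conv[of _ "{0}"]) (auto simp: coloured_def X_word_append, auto simp: X_word_def)
  ultimately show ?thesis
    by (simp add: dist mult.assoc) (simp add: F_def)
qed

section \<open>Existence and uniqueness of free cumulants\<close>

lemma full_in_NC: "0 < n \<Longrightarrow> {{..<n}} \<in> NC n"
  unfolding NC_def by (auto simp: noncrossing_def intro!: partition_on_space)

lemma NC_block_subset: "\<pi> \<in> NC n \<Longrightarrow> B \<in> \<pi> \<Longrightarrow> B \<subseteq> {..<n}"
  by (auto simp: NC_def partition_on_def)

lemma length_nths_block: "B \<subseteq> {..<length w} \<Longrightarrow> length (nths w B) = card B"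
  by (auto simp: length_nths intro!: arg_cong[of _ _ card])

lemma nths_block_nonempty:
  assumes "\<pi> \<in> NC (length w)" "B \<in> \<pi>"
  shows "nths w B \<noteq> []"
proof -
  have B: "B \<subseteq> {..<length w}" "B \<noteq> {}"
    using assms NC_block_subset by (auto simp: NC_def partition_on_def)
  then have "card B > 0" by (auto simp: card_gt_0_iff intro: finite_subset)
  then show ?thesis using length_nths_block[OF B(1)] by auto
qed

lemma length_nths_block_less:
  assumes \<pi>: "\<pi> \<in> NC (length w)" "\<pi> \<noteq> {{..<length w}}" and B: "B \<in> \<pi>"
  shows "length (nths w B) < length w"
proof -
  have pt: "partition_on {..<length w} \<pi>" using \<pi> by (simp add: NC_def)
  have sub: "B \<subseteq> {..<length w}" using NC_block_subset[OF \<pi>(1) B] .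
  have "B \<noteq> {..<length w}"
  proof
    assume full: "B = {..<length w}"
    have "C = B" if C: "C \<in> \<pi>" for C
    proof -
      have "C \<noteq> {}" using C pt by (auto simp: partition_on_def)
      then obtain x where "x \<in> C" by auto
      moreover from this have "x \<in> B" using NC_block_subset[OF \<pi>(1) C] full by blast
      ultimately show ?thesis using partition_on_block_unique[OF pt C B] by blast
    qed
    then show False using B \<pi>(2) full by blast
  qed
  then have "card B < card {..<length w}" using sub by (intro psubset_card_mono) auto
  then show ?thesis using length_nths_block[OF sub] by simp
qed

lemma sum_NC_split:
  fixes F :: "nat set set \<Rightarrow> complex"
  assumes "0 < n"
  shows "(\<Sum>\<pi>\<in>NC n. F \<pi>) = F {{..<n}} + (\<Sum>\<pi>\<in>NC n - {{{..<n}}}. F \<pi>)"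
  using full_in_NC[OF assms] finite_NC by (simp add: sum.remove)

lemma Cf_part_cong:
  assumes "\<And>B. B \<in> \<pi> \<Longrightarrow> f (nths w B) = g (nths w B)"
  shows "Cf_part w \<pi> f = Cf_part w \<pi> g"
  unfolding Cf_part_def using assms by (rule prod.cong[OF refl])

text \<open>
The partition with one block contributes \<open>f w\<close> to the sum, and all other contributions involve only shorter
words. The same remark lets \<open>cumulant\<close> compute cumulants from moments.
\<close>

lemma cumulants_unique:
  assumes "\<And>w. w \<noteq> [] \<Longrightarrow>
      (\<Sum>\<pi>\<in>NC (length w). Cf_part w \<pi> f) = (\<Sum>\<pi>\<in>NC (length w). Cf_part w \<pi> g)"
  shows "w \<noteq> [] \<Longrightarrow> f w = g w"
proof (induction w rule: length_induct)
  case (1 w)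
  let ?n = "length w"
  have n: "0 < ?n" using 1(2) by simp
  have "(\<Sum>\<pi>\<in>NC ?n - {{{..<?n}}}. Cf_part w \<pi> f) = (\<Sum>\<pi>\<in>NC ?n - {{{..<?n}}}. Cf_part w \<pi> g)"
  proof (rule sum.cong[OF refl], rule Cf_part_cong)
    fix \<pi> B assume \<pi>: "\<pi> \<in> NC ?n - {{{..<?n}}}" and B: "B \<in> \<pi>"
    then show "f (nths w B) = g (nths w B)"
      using length_nths_block_less[of \<pi> w B] nths_block_nonempty[of \<pi> w B] 1(1) by simp
  qed
  then show ?case
    using assms[OF 1(2)] unfolding sum_NC_split[OF n] by (simp add: Cf_part_def)
qed

function cumulant :: "('k list \<Rightarrow> complex) \<Rightarrow> 'k list \<Rightarrow> complex" where
  "cumulant M w = (if w = [] then 1 else M w -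
     (\<Sum>\<pi>\<in>NC (length w) - {{{..<length w}}}. \<Prod>B\<in>\<pi>. cumulant M (nths w B)))"
  by pat_completeness auto
termination
  by (relation "measure (\<lambda>(M, w). length w)") (auto intro!: length_nths_block_less)

declare cumulant.simps [simp del]

lemma mom_cumulant:
  assumes "M [] = 1"
  shows "mom (Ser (cumulant M)) = Ser M"
proof (rule ser_eqI)
  fix w
  have 1: "cumulant M [] = 1" by (simp add: cumulant.simps)
  show "cf (mom (Ser (cumulant M))) w = cf (Ser M) w"
  proof (cases "w = []")
    case False
    then have n: "0 < length w" by simp
    have "cumulant M w = M w - (\<Sum>\<pi>\<in>NC (length w) - {{{..<length w}}}. Cf_part w \<pi> (cumulant M))"
      using False by (subst cumulant.simps) (simp add: Cf_part_def)
    moreover have "cf (mom (Ser (cumulant M))) w = cumulant M w +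
        (\<Sum>\<pi>\<in>NC (length w) - {{{..<length w}}}. Cf_part w \<pi> (cumulant M))"
      unfolding sum_NC_Cf_part[of "cumulant M", OF 1, symmetric] sum_NC_split[OF n]
      by (simp add: Cf_part_def)
    ultimately show ?thesis by simp
  qed (simp add: assms)
qed

lemma with_cumulants_inject:
  assumes "with_cumulants f = with_cumulants g" "f [] = 1" "g [] = 1"
  shows "f = g"
proof
  fix w
  have "cf (mom (Ser f)) w = cf (mom (Ser g)) w" for w
    using fun_cong[OF assms(1), of "X_word w"] by (simp add: with_cumulants_X_word)
  then have "(\<Sum>\<pi>\<in>NC (length w). Cf_part w \<pi> f) = (\<Sum>\<pi>\<in>NC (length w). Cf_part w \<pi> g)" for w
    by (simp only: sum_NC_Cf_part[of f, OF assms(2)] sum_NC_Cf_part[of g, OF assms(3)])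
  from cumulants_unique[of f g, OF this] have "w \<noteq> [] \<Longrightarrow> f w = g w" .
  then show "f w = g w" using assms by (cases "w = []") auto
qed

lemma D_alg_eq_with_cumulants:
  assumes "\<mu> \<in> D_alg"
  obtains f where "f [] = 1" "\<mu> = with_cumulants f"
proof
  let ?M = "\<lambda>w. \<mu> (X_word w)"
  show "cumulant ?M [] = 1" by (simp add: cumulant.simps)
  have "?M [] = 1" using assms by (simp add: D_alg_def one_nc_poly)
  then show "\<mu> = with_cumulants (cumulant ?M)"
    using assms unfolding with_cumulants_def mom_cumulant[of ?M, OF \<open>?M [] = 1\<close>]
    by (intro linear_functional_eqI linear_functional) (auto simp: D_alg_def)
qed

lemma R_transform_with_cumulants:
  assumes "f [] = 1"
  shows "R_transform (with_cumulants f) = f([] := 0)"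
  unfolding R_transform_def with_cumulants_X_word
proof (rule the_equality)
  have "Cf_part w \<pi> (f([] := 0)) = Cf_part w \<pi> f" if "\<pi> \<in> NC (length w)" for w \<pi>
    using nths_block_nonempty[OF that] by (intro Cf_part_cong) auto
  then have e: "(\<Sum>\<pi>\<in>NC (length w). Cf_part w \<pi> (f([] := 0))) = cf (mom (Ser f)) w" for w
    by (simp add: sum_NC_Cf_part[of f, OF assms])
  then show "(f([] := 0)) [] = 0 \<and> (\<forall>w. w \<noteq> [] \<longrightarrow>
      cf (mom (Ser f)) w = (\<Sum>\<pi>\<in>NC (length w). Cf_part w \<pi> (f([] := 0))))"
    by simp
  fix g
  assume g: "g [] = 0 \<and> (\<forall>w. w \<noteq> [] \<longrightarrow> cf (mom (Ser f)) w = (\<Sum>\<pi>\<in>NC (length w). Cf_part w \<pi> g))"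
  have "g w = (f([] := 0)) w" if "w \<noteq> []" for w
    using that by (intro cumulants_unique[of g "f([] := 0)"]) (simp_all add: e g)
  then show "g = f([] := 0)" using g by (auto simp: fun_eq_iff)
qed

section \<open>The monoid of normalized series\<close>

definition unital :: "'k nc_series \<Rightarrow> bool" where
  "unital f \<longleftrightarrow> f [] = 1 \<and> (\<forall>i. f [i] = 1)"

lemma unitalD: "unital f \<Longrightarrow> f [] = 1" "unital f \<Longrightarrow> f [i] = 1"
  by (simp_all add: unital_def)

lemma unital_short: "unital f \<Longrightarrow> length w \<le> 1 \<Longrightarrow> f w = 1"
  by (cases w) (auto simp: unital_def)

lemma unital_box:
  assumes "unital f" "unital g" shows "unital (box f g)"
proof -
  have n: "f [] = 1" "g [] = 1" using assms by (simp_all add: unital_def)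
  have "cf (box_ext f g [] []) [i] = cf (deriv i (box_ext f g [] [])) []" for i by simp
  also have "\<dots> i = 1" for i
    unfolding deriv_box_ext using assms by (simp add: unital_def)
  finally show ?thesis
    unfolding unital_def box_eq_cf_box_ext[of f g, OF n] by (simp add: n)
qed

lemma box_Nil [simp]: "f [] = 1 \<Longrightarrow> g [] = 1 \<Longrightarrow> box f g [] = 1"
  by (simp add: box_eq_cf_box_ext)

lemma box_assoc:
  fixes f g h :: "'k::finite nc_series"
  assumes "f [] = 1" "g [] = 1" "h [] = 1"
  shows "box (box f g) h = box f (box g h)"
  using free_mult_conv_assoc[of f g h, OF assms]
  by (intro with_cumulants_inject) (simp_all add: free_mult_conv_with_cumulants assms)

text \<open>
The unit of boxed convolution; the value at the empty word is the normalization of constant terms.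
\<close>

definition delta :: "'k nc_series" where
  "delta w = (if length w \<le> 1 then 1 else 0)"

lemma delta_Nil: "delta [] = 1"
  by (simp add: delta_def)

lemma unital_delta: "unital delta"
  by (simp add: unital_def delta_def)

text \<open>
With \<open>f = delta\<close> an open block of \<open>f\<close> cannot grow, so the summands with a nonempty open block \<open>x\<close> are constants and
the equation of \<open>deriv_box_ext\<close> collapses to appending the letter \<open>i\<close> to \<open>y\<close>.
\<close>

lemma box_delta_left:
  assumes "g [] = 1" shows "box delta g = g"
proof -
  have 1: "box_ext delta g x y = cst (delta x * g y)" if "x \<noteq> []" for x y
  proof (rule agree_all)
    show "agree n (box_ext delta g x y) (cst (delta x * g y))" for n
      using that
    proof (induction n arbitrary: x y)
      case (Suc n)
      have d0: "delta (x @ [i]) = 0" for i using Suc.prems by (cases x) (auto simp: delta_def)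
      have "agree n (deriv i (box_ext delta g x y)) 0" for i
      proof -
        have "agree n (box_ext delta g [] [i] * box_ext delta g (x @ [i]) y) (box_ext delta g [] [i] * 0)"
          using Suc.IH[of "x @ [i]" y] by (intro agree_mult) (simp_all add: d0)
        then show ?thesis by (simp add: deriv_box_ext d0)
      qed
      then show ?case by (simp add: agree_Suc)
    qed (simp add: agree_0)
  qed
  have "box_ext delta g [] y = Ser (\<lambda>w. g (y @ w))" for y
  proof (rule agree_all)
    show "agree n (box_ext delta g [] y) (Ser (\<lambda>w. g (y @ w)))" for n
    proof (induction n arbitrary: y)
      case (Suc n)
      have "deriv i (Ser (\<lambda>w. g (y @ w))) = Ser (\<lambda>w. g ((y @ [i]) @ w))" for i
        by (rule ser_eqI) simp
      moreover have "deriv i (box_ext delta g [] y) = box_ext delta g [] (y @ [i])" for i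
        by (simp add: deriv_box_ext 1) (simp add: delta_def)
      ultimately show ?case using Suc[of "y @ [i]" for i] by (simp add: agree_Suc delta_Nil)
    qed (simp add: agree_0 delta_Nil)
  qed
  then show ?thesis
    using assms by (simp add: fun_eq_iff box_eq_cf_box_ext delta_def)
qed

text \<open>
With \<open>g = delta\<close> open blocks of the complement of length at least two contribute nothing, and those of length one
only the empty word.
\<close>

lemma box_delta_right:
  assumes "f [] = 1" shows "box f delta = f"
proof -
  have 2: "box_ext f delta x y = 0" if "2 \<le> length y" for x y
  proof (rule agree_all)
    show "agree n (box_ext f delta x y) 0" for n
      using that
    proof (induction n arbitrary: x y)
      case (Suc n)
      have d0: "delta y = 0" using Suc.prems by (simp add: delta_def)
      have "agree n (box_ext f delta [] [i] * box_ext f delta (x @ [i]) y +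
          cst (f (x @ [i])) * box_ext f delta [] (y @ [i])) (box_ext f delta [] [i] * 0 + cst (f (x @ [i])) * 0)" for i
        using Suc.prems by (intro agree_add agree_mult Suc.IH) auto
      then show ?case by (simp add: agree_Suc deriv_box_ext d0)
    qed (simp add: agree_0 delta_def)
  qed
  have 1: "box_ext f delta x [j] = cst (f x)" for x j
  proof (rule agree_all)
    show "agree n (box_ext f delta x [j]) (cst (f x))" for n
    proof (induction n arbitrary: x j)
      case (Suc n)
      have d1: "delta [j] = 1" by (simp add: delta_def)
      have "agree n (box_ext f delta [] [i] * (box_ext f delta (x @ [i]) [j] - cst (f (x @ [i]))))
          (box_ext f delta [] [i] * (cst (f (x @ [i])) - cst (f (x @ [i]))))" for i
        by (intro agree_mult agree_minus Suc.IH) auto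
      then show ?case by (simp add: agree_Suc deriv_box_ext d1 2)
    qed (simp add: agree_0 delta_def)
  qed
  have "box_ext f delta x [] = Ser (\<lambda>w. f (x @ w))" for x
  proof (rule agree_all)
    show "agree n (box_ext f delta x []) (Ser (\<lambda>w. f (x @ w)))" for n
    proof (induction n arbitrary: x)
      case (Suc n)
      have "deriv i (Ser (\<lambda>w. f (x @ w))) = Ser (\<lambda>w. f ((x @ [i]) @ w))" for i
        by (rule ser_eqI) simp
      moreover have "deriv i (box_ext f delta x []) = box_ext f delta (x @ [i]) []" for i
        by (simp add: deriv_box_ext 1 assms) (simp add: delta_def)
      ultimately show ?case using Suc[of "x @ [i]" for i] by (simp add: agree_Suc delta_Nil)
    qed (simp add: agree_0 delta_Nil)
  qed
  then show ?thesis
    using assms by (simp add: fun_eq_iff box_eq_cf_box_ext delta_def)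
qed

lemma G_group_eq_with_cumulants:
  assumes "\<mu> \<in> G_group"
  obtains f where "unital f" "\<mu> = with_cumulants f"
proof -
  from assms have "\<mu> \<in> D_alg" by (simp add: G_group_def)
  then obtain f where f: "f [] = 1" "\<mu> = with_cumulants f" by (rule D_alg_eq_with_cumulants)
  have "f [i] = 1" for i
  proof -
    have "\<mu> (X_word [i]) = 1" using assms by (simp add: G_group_def)
    moreover have "cf (mom (Ser f)) [i] = cf (deriv i (mom (Ser f))) []" by simp
    ultimately show ?thesis
      by (simp only: f(2) with_cumulants_X_word deriv_mom) simp
  qed
  then show thesis by (intro that[OF _ f(2)]) (simp add: unital_def f(1))
qed

section \<open>Characters of the Hopf algebra\<close>

definition monom_val :: "('k list \<Rightarrow> 'b::comm_ring_1) \<Rightarrow> 'k monom \<Rightarrow> 'b" where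
  "monom_val F m = (\<Prod>x\<in>Poly_Mapping.keys m. F (Rep_long_word x) ^ Poly_Mapping.lookup m x)"

lemma monom_val_superset:
  assumes "finite S" "Poly_Mapping.keys m \<subseteq> S"
  shows "monom_val F m = (\<Prod>x\<in>S. F (Rep_long_word x) ^ Poly_Mapping.lookup m x)"
  unfolding monom_val_def
  by (rule prod.mono_neutral_left) (use assms in \<open>auto simp: in_keys_iff\<close>)

lemma monom_val_0 [simp]: "monom_val F 0 = 1"
  by (simp add: monom_val_def)

lemma monom_val_add: "monom_val F (m + n) = monom_val F m * monom_val F n"
proof -
  let ?S = "Poly_Mapping.keys m \<union> Poly_Mapping.keys n"
  have "Poly_Mapping.keys (m + n) \<subseteq> ?S" by (rule keys_add)
  then show ?thesis
    by (simp add: monom_val_superset[of ?S] lookup_add power_add prod.distrib)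
qed

lemma monom_val_cong:
  assumes "\<And>w. 2 \<le> length w \<Longrightarrow> F w = G w"
  shows "monom_val F m = monom_val G m"
proof -
  have "F (Rep_long_word x) = G (Rep_long_word x)" for x
    using Rep_long_word[of x] assms by simp
  then show ?thesis by (simp add: monom_val_def)
qed

definition character :: "'k nc_series \<Rightarrow> 'k Y_alg \<Rightarrow> complex" where
  "character f = lin_ext (monom_val f)"

lemma Y_hom_eq_monom_val:
  "Y_hom \<iota> F p =
    (\<Sum>m\<in>Poly_Mapping.keys p. \<iota> (Poly_Mapping.lookup p m) * monom_val F m)"
  by (simp add: Y_hom_def monom_val_def)

lemma Y_hom_id: "Y_hom id f = character f"
  by (rule ext) (simp add: Y_hom_def character_def lin_ext_def monom_val_def)

lemma character_cong:
  "(\<And>w. 2 \<le> length w \<Longrightarrow> f w = g w) \<Longrightarrow> character f = character g"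
  unfolding character_def by (rule arg_cong[of _ _ lin_ext]) (rule ext, rule monom_val_cong)

lemma character_single: "character f (Poly_Mapping.single m c) = c * monom_val f m"
  by (simp add: character_def)

lemma character_mult: "character f (p * q) = character f p * character f q"
  unfolding character_def by (rule lin_ext_mult) (rule monom_val_add)

lemma character_one: "character f 1 = 1"
  using character_single[of f 0 1] by simp

lemma character_prod: "character f (prod F A) = (\<Prod>x\<in>A. character f (F x))"
  by (induction A rule: infinite_finite_induct) (simp_all add: character_one character_mult)

lemma character_Y:
  assumes "unital f" shows "character f (Y w) = f w"
proof (cases "2 \<le> length w")
  case True
  then show ?thesis
    by (simp add: Y_def character_single monom_val_def Abs_long_word_inverse)
next
  case False
  then show ?thesis
    using unital_short[OF assms, of w] by (simp add: Y_def character_one)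
qed

lemma character_Y_part: "unital f \<Longrightarrow> character f (Y_part w \<pi>) = Cf_part w \<pi> f"
  by (simp add: Y_part_def Cf_part_def character_prod character_Y)

lemma counit_eq_character: "counit = character delta"
  unfolding counit_def Y_hom_id by (rule character_cong) (simp add: delta_def)

text \<open>
The product of two characters as a multiplicative function on pairs of monomials. It turns \<open>tensor_functional\<close>
into a linear extension of a multiplicative function, that is into an algebra homomorphism.
\<close>

definition pair_val :: "'k nc_series \<Rightarrow> 'k nc_series \<Rightarrow> 'k monom \<times> 'k monom \<Rightarrow> complex" where
  "pair_val f g = (\<lambda>(m, n). monom_val f m * monom_val g n)"

lemma tensor_functional_character:
  "tensor_functional (character f) (character g) = lin_ext (pair_val f g)"
  by (rule ext) (auto simp: tensor_functional_def lin_ext_def pair_val_def character_single mult.assoc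
      intro!: sum.cong)

lemma lin_ext_pair_val_mult:
  "lin_ext (pair_val f g) (s * t) = lin_ext (pair_val f g) s * lin_ext (pair_val f g) t"
  by (rule lin_ext_mult) (auto simp: pair_val_def monom_val_add)

lemma pair_val_0: "pair_val f g 0 = 1"
  by (simp add: pair_val_def zero_prod_def)

lemma lin_ext_pair_val_one: "lin_ext (pair_val f g) 1 = 1"
  using lin_ext_single[of "pair_val f g" 0 1] by (simp add: pair_val_0)

lemma lin_ext_pair_val_tensor:
  "lin_ext (pair_val f g) (tensor p q) = character f p * character g q"
  by (simp add: tensor_def lin_ext_sum pair_val_def character_def lin_ext_def[of "monom_val _"]
      sum_product algebra_simps)

lemma lin_ext_pair_val_prod:
  "lin_ext (pair_val f g) (prod G A) = (\<Prod>x\<in>A. lin_ext (pair_val f g) (G x))"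
  by (induction A rule: infinite_finite_induct)
    (simp_all add: lin_ext_pair_val_one lin_ext_pair_val_mult)

lemma lin_ext_pair_val_monom_val:
  fixes f g :: "'k nc_series"
  shows "lin_ext (pair_val f g) (monom_val F m) = monom_val (\<lambda>w. lin_ext (pair_val f g) (F w)) m"
proof -
  have pow: "lin_ext (pair_val f g) (t ^ k) = lin_ext (pair_val f g) t ^ k" for t k
    by (induction k) (simp_all add: lin_ext_pair_val_one lin_ext_pair_val_mult)
  then show ?thesis by (simp add: monom_val_def lin_ext_pair_val_prod pow)
qed

text \<open>
Both sides are algebra homomorphisms, and they agree on the generators \<open>Y\<^sub>w\<close> by the formula for the
comultiplication.
\<close>

lemma convolution_character:
  assumes "unital f" "unital g"
  shows "convolution (character f) (character g) = character (box f g)"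
proof
  fix p
  have "convolution (character f) (character g) p =
      character (\<lambda>w. lin_ext (pair_val f g)
        (\<Sum>\<pi>\<in>NC (length w). tensor (Y_part w \<pi>) (Y_part w (kreweras (length w) \<pi>)))) p"
    unfolding convolution_def comp_def comult_def Y_hom_eq_monom_val tensor_functional_character
    by (simp add: lin_ext_sum lin_ext_pair_val_mult pair_val_0
        lin_ext_pair_val_monom_val character_def lin_ext_def[of "monom_val _"])
  also have "\<dots> = character (box f g) p"
    by (simp add: box_def[abs_def] lin_ext_sum lin_ext_pair_val_tensor character_Y_part assms)
  finally show "convolution (character f) (character g) p = character (box f g) p" .
qed

lemma convolution_diff_left:
  "convolution (\<lambda>q. \<xi> q - \<xi>' q) \<eta> p = convolution \<xi> \<eta> p - convolution \<xi>' \<eta> p"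
  by (simp add: convolution_def tensor_functional_def case_prod_beta algebra_simps sum_subtractf)

lemma convolution_diff_right:
  "convolution \<xi> (\<lambda>q. \<eta> q - \<eta>' q) p = convolution \<xi> \<eta> p - convolution \<xi> \<eta>' p"
  by (simp add: convolution_def tensor_functional_def case_prod_beta algebra_simps sum_subtractf)

primrec box_power :: "'k nc_series \<Rightarrow> nat \<Rightarrow> 'k nc_series" where
  "box_power f 0 = delta"
| "box_power f (Suc n) = box f (box_power f n)"

lemma unital_box_power: "unital f \<Longrightarrow> unital (box_power f n)"
  by (induction n) (simp_all add: unital_delta unital_box)

text \<open>
Iterated differences with the sign \<open>a(n) - a(n + 1)\<close>, which matches \<open>\<epsilon> - \<chi>\<close>.
\<close>

primrec neg_diff :: "nat \<Rightarrow> (nat \<Rightarrow> complex) \<Rightarrow> nat \<Rightarrow> complex" where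
  "neg_diff 0 a n = a n"
| "neg_diff (Suc l) a n = neg_diff l a n - neg_diff l a (Suc n)"

lemma neg_diff_shift: "neg_diff l (\<lambda>j. a (Suc j)) n = neg_diff l a (Suc n)"
  by (induction l arbitrary: n) simp_all

lemma convolution_neg_diff:
  "convolution \<xi> (\<lambda>q. neg_diff l (\<lambda>j. \<eta> j q) n) p = neg_diff l (\<lambda>j. convolution \<xi> (\<eta> j) p) n"
  by (induction l arbitrary: n) (simp_all add: convolution_diff_right)

text \<open>
Convolution is bilinear, \<open>\<epsilon>\<close> is a unit for characters, and the convolution of \<open>\<chi>\<close> with a power of \<open>\<chi>\<close> is the next
power. So each factor \<open>\<epsilon> - \<chi>\<close> acts on the sequence of powers as a difference.
\<close>

lemma conv_power_eq_neg_diff: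
  assumes "unital f"
  shows "conv_power (\<lambda>q. counit q - character f q) l p = neg_diff l (\<lambda>j. character (box_power f j) p) 0"
proof (induction l arbitrary: p)
  case 0
  show ?case by (simp add: counit_eq_character)
next
  case (Suc l)
  have 1: "convolution counit (character (box_power f j)) = character (box_power f j)" for j
    unfolding counit_eq_character convolution_character[OF unital_delta unital_box_power[OF assms]]
    using unital_box_power[OF assms, of j] by (simp add: box_delta_left unital_def)
  have 2: "convolution (character f) (character (box_power f j)) = character (box_power f (Suc j))" for j
    by (simp add: convolution_character assms unital_box_power)
  have IH: "conv_power (\<lambda>q. counit q - character f q) l = (\<lambda>q. neg_diff l (\<lambda>j. character (box_power f j) q) 0)"
    using Suc by blast
  show ?case
    by (simp add: IH convolution_diff_left convolution_neg_diff 1 2 del: box_power.simps)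
      (rule neg_diff_shift[where a = "\<lambda>j. character (box_power f j) p"])
qed

section \<open>The logarithm as a derivative\<close>

text \<open>
The binomial coefficient \<open>x choose m\<close> as a polynomial in \<open>x\<close>.
\<close>

primrec binom_poly :: "nat \<Rightarrow> complex poly" where
  "binom_poly 0 = 1"
| "binom_poly (Suc m) = smult (1 / of_nat (Suc m)) (binom_poly m * [:- of_nat m, 1:])"

lemma poly_binom_poly: "poly (binom_poly m) (of_nat n) = of_nat (n choose m)"
proof -
  have "poly (binom_poly m) x = x gchoose m" for x
  proof (induction m)
    case (Suc m)
    have "x gchoose Suc m = (x gchoose m) * (x - of_nat m) / of_nat (Suc m)"
      by (simp add: gbinomial_prod_rev del: of_nat_Suc)
    moreover have "poly (binom_poly (Suc m)) x = (x gchoose m) * (x - of_nat m) / of_nat (Suc m)"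
      by (simp add: Suc algebra_simps diff_divide_distrib del: of_nat_Suc)
    ultimately show ?case by (simp only:)
  qed simp
  then show ?thesis by (simp add: binomial_gbinomial)
qed

lemma pderiv_binom_poly:
  "poly (pderiv (binom_poly (Suc m))) 0 = (- 1) ^ m / of_nat (Suc m)"
proof (induction m)
  case (Suc m)
  have "poly (binom_poly (Suc m)) 0 = 0"
    using poly_binom_poly[of "Suc m" 0] by simp
  then have "poly (pderiv (binom_poly (Suc (Suc m)))) 0 =
      1 / of_nat (Suc (Suc m)) * (poly (pderiv (binom_poly (Suc m))) 0 * - of_nat (Suc m))"
    by (simp only: binom_poly.simps(2)[of "Suc m"] pderiv_smult pderiv_mult poly_smult poly_add poly_mult)
      (simp add: pderiv_pCons)
  then show ?case unfolding Suc by (simp add: field_simps del: of_nat_Suc)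
qed (simp add: pderiv_pCons)

text \<open>
The linear span of the binomial polynomials. It consists of all polynomials, as it is closed under
multiplication by \<open>x\<close>; so linear identities need to be checked for binomial polynomials only.
\<close>

inductive newton_basis_span :: "complex poly \<Rightarrow> bool" where
  binom: "newton_basis_span (binom_poly m)"
| add: "newton_basis_span p \<Longrightarrow> newton_basis_span q \<Longrightarrow> newton_basis_span (p + q)"
| scale: "newton_basis_span p \<Longrightarrow> newton_basis_span (smult c p)"

lemma newton_basis_span_times_X: "newton_basis_span p \<Longrightarrow> newton_basis_span (pCons 0 p)"
proof (induction rule: newton_basis_span.induct)
  case (binom m)
  have "smult (of_nat (Suc m)) (binom_poly (Suc m)) + smult (of_nat m) (binom_poly m) =
      binom_poly m * [:- of_nat m, 1:] + smult (of_nat m) (binom_poly m)"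
    by (simp del: of_nat_Suc)
  also have "\<dots> = pCons 0 (binom_poly m)"
    by (simp add: mult.commute[of "binom_poly m"])
  finally have "pCons 0 (binom_poly m) =
      smult (of_nat (Suc m)) (binom_poly (Suc m)) + smult (of_nat m) (binom_poly m)" ..
  then show ?case by (simp only:) (intro newton_basis_span.intros)
next
  case (add p q)
  then show ?case using newton_basis_span.add by fastforce
next
  case (scale p c)
  then show ?case using newton_basis_span.scale[of "pCons 0 p" c] by simp
qed

lemma newton_basis_span: "newton_basis_span p"
proof (induction p rule: pCons_induct)
  case 0
  show ?case using newton_basis_span.scale[OF newton_basis_span.binom, of 0] by simp
next
  case (pCons a p)
  have "pCons a p = smult a (binom_poly 0) + pCons 0 p" by simp
  then show ?case
    using newton_basis_span_times_X[OF pCons(2)] by (simp only:) (intro newton_basis_span.intros)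
qed

lemma neg_diff_binomial:
  "neg_diff l (\<lambda>j. of_nat (j choose m)) n = (if l \<le> m then (- 1) ^ l * of_nat (n choose (m - l)) else 0)"
proof (induction l arbitrary: n)
  case (Suc l)
  show ?case
  proof (cases "Suc l \<le> m")
    case True
    then have "m - l = Suc (m - Suc l)" by simp
    then show ?thesis using True by (simp add: Suc algebra_simps)
  next
    case False
    then show ?thesis
      using Suc.IH[of n] Suc.IH[of "Suc n"] by (cases "l = m") simp_all
  qed
qed simp

lemma neg_diff_add: "neg_diff l (\<lambda>j. a j + b j) n = neg_diff l a n + neg_diff l b n"
  by (induction l arbitrary: n) simp_all

lemma neg_diff_cmult: "neg_diff l (\<lambda>j. c * a j) n = c * neg_diff l a n"
  by (induction l arbitrary: n) (simp_all add: algebra_simps)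

text \<open>
The identity \<open>d/dx = log (1 + \<Delta>)\<close>. On \<open>x choose m\<close> only the \<open>m\<close>-th difference is nonzero at \<open>0\<close>, and the derivative at
\<open>0\<close> is \<open>(- 1)\<^bsup>m - 1\<^esup> / m\<close>.
\<close>

lemma log_series_poly:
  "(\<lambda>l. 1 / of_nat (Suc l) * neg_diff (Suc l) (\<lambda>j. poly p (of_nat j)) 0) sums (- poly (pderiv p) 0)"
  using newton_basis_span[of p]
proof (induction rule: newton_basis_span.induct)
  case (binom m)
  show ?case
  proof (cases m)
    case 0
    have "neg_diff (Suc l) (\<lambda>j. poly (binom_poly m) (of_nat j)) 0 = 0" for l
      unfolding poly_binom_poly neg_diff_binomial 0 by simp
    then show ?thesis by (simp only: mult_zero_right) (simp add: 0)
  next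
    case (Suc k)
    have "1 / of_nat (Suc l) * neg_diff (Suc l) (\<lambda>j. poly (binom_poly m) (of_nat j)) 0 =
        (if l = k then - poly (pderiv (binom_poly m)) 0 else 0)" for l
      unfolding poly_binom_poly neg_diff_binomial Suc pderiv_binom_poly by (auto simp: binomial_eq_0_iff)
    then show ?thesis
      using sums_single[of k "\<lambda>_. - poly (pderiv (binom_poly m)) 0"] by (simp only:)
  qed
next
  case (add p q)
  from sums_add[OF add(3,4)] show ?case
    by (simp only: poly_add neg_diff_add pderiv_add minus_add_distrib distrib_left)
next
  case (scale p c)
  from sums_mult[OF scale(2), of c] show ?case
    by (simp only: poly_smult neg_diff_cmult pderiv_smult mult_minus_right mult.left_commute)
qed

text \<open>
Summation raises \<open>x choose m\<close> to \<open>x choose (m + 1)\<close>.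
\<close>

lemma sum_of_values_poly:
  "\<exists>q. \<forall>n. (\<Sum>k<n. poly p (of_nat k)) = poly q (of_nat n)" for p :: "complex poly"
  using newton_basis_span[of p]
proof (induction rule: newton_basis_span.induct)
  case (binom m)
  have "(\<Sum>k<n. poly (binom_poly m) (of_nat k)) = poly (binom_poly (Suc m)) (of_nat n)" for n
    unfolding poly_binom_poly by (induction n) simp_all
  then show ?case by blast
next
  case (add p q)
  then show ?case by (metis (no_types, lifting) poly_add sum.distrib sum.cong)
next
  case (scale p c)
  then obtain q where "\<forall>n. (\<Sum>k<n. poly p (of_nat k)) = poly q (of_nat n)" by blast
  then show ?case by (intro exI[of _ "smult c q"]) (simp flip: sum_distrib_left)
qed

lemma pderiv_sum: "pderiv (\<Sum>x\<in>A. p x) = (\<Sum>x\<in>A. pderiv (p x))"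
  by (induction A rule: infinite_finite_induct) (simp_all add: pderiv_add)

lemma poly_eq_of_nat:
  fixes p q :: "complex poly"
  assumes "\<And>n. poly p (of_nat n) = poly q (of_nat n)"
  shows "p = q"
proof (rule ccontr)
  assume "p \<noteq> q"
  then have "finite {x. poly (p - q) x = 0}" by (intro poly_roots_finite) simp
  moreover have "range (of_nat :: nat \<Rightarrow> complex) \<subseteq> {x. poly (p - q) x = 0}"
    using assms by auto
  ultimately have "finite (range (of_nat :: nat \<Rightarrow> complex))" by (rule finite_subset[rotated])
  then show False using finite_imageD[of "of_nat :: nat \<Rightarrow> complex" UNIV] by (simp add: inj_on_def)
qed

section \<open>Powers depend polynomially on the exponent\<close>

text \<open>
If \<open>P\<^sub>K\<^sub>(\<^sub>\<pi>\<^sub>)\<close> is the full cycle then \<open>P\<^sub>\<pi>\<close> is the identity, hence all blocks of \<open>\<pi>\<close> are singletons.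
\<close>

lemma Cf_part_kreweras_full:
  assumes \<pi>: "\<pi> \<in> NC (length w)" and full: "kreweras (length w) \<pi> = {{..<length w}}" and f: "unital f"
  shows "Cf_part w \<pi> f = 1"
proof -
  obtain t where t: "size t = length w" "tree_part t = \<pi>" using NC_imp_tree_part[OF \<pi>] by blast
  have k: "tree_kreweras t = {{..<size t}}" using full kreweras_tree_part[of t] t by simp
  have fix_pt: "part_perm (tree_part t) i = i" if i: "i < size t" for i
  proof -
    have "part_perm (tree_part t) (part_perm {{..<size t}} j) = part_perm {{..<size t}} j" for j
      using part_perm_tree_part_kreweras[of t j] unfolding k .
    moreover obtain j where "part_perm {{..<size t}} j = i"
    proof
      show "part_perm {{..<size t}} (if i = 0 then size t - 1 else i - 1) = i"
        using i unfolding part_perm_full by (cases "i = 0") auto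
    qed
    ultimately show ?thesis by metis
  qed
  have "f (nths w B) = 1" if B: "B \<in> tree_part t" for B
  proof -
    have sub: "B \<subseteq> {..<length w}" using tree_part_subset[OF B] t by simp
    then have fin: "finite B" by (rule finite_subset) simp
    have all: "j \<le> i" if "i \<in> B" "j \<in> B" for i j
    proof -
      have "i < size t" using that(1) sub t(1) by auto
      then have "is_next B i i"
        using is_next_part_perm[OF partition_on_tree_part B that(1) fin] fix_pt by simp
      then show ?thesis using that(2) by (auto simp: is_next_def split: if_splits)
    qed
    have "card B \<le> 1"
      unfolding One_nat_def card_le_Suc0_iff_eq[OF fin] using all by (meson order_antisym)
    then show ?thesis using unital_short[OF f] length_nths_block[OF sub] by simp
  qed
  then show ?thesis unfolding t(2)[symmetric] by (simp add: Cf_part_def)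
qed

lemma kreweras_in_NC: "\<pi> \<in> NC n \<Longrightarrow> kreweras n \<pi> \<in> NC n"
  using NC_imp_tree_part[of \<pi> n] kreweras_tree_part tree_kreweras_in_NC by metis

text \<open>
Since \<open>delta\<close> is the unit, the increment of the sequence \<open>n \<mapsto> f\<^bsup>n\<^esup>(w)\<close> is the sum over \<open>\<pi>\<close> of \<open>Cf_part w \<pi> f - Cf_part w \<pi> delta\<close>
times a product of values of \<open>f\<^bsup>n\<^esup>\<close> at the blocks of \<open>K(\<pi>)\<close>. The first factor vanishes if \<open>K(\<pi>)\<close> has just one
block, and otherwise these blocks are shorter than \<open>w\<close>. So the increments are polynomial in \<open>n\<close> by induction, and
the sums of a polynomial sequence are polynomial.
\<close>

lemma box_power_poly:
  assumes "unital f"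
  shows "\<exists>p. \<forall>n. box_power f n w = poly p (of_nat n)"
proof (induction w rule: length_induct)
  case (1 w)
  let ?N = "length w"
  let ?S = "{\<pi> \<in> NC ?N. kreweras ?N \<pi> \<noteq> {{..<?N}}}"
  from 1 obtain P where P: "\<And>v n. length v < ?N \<Longrightarrow> box_power f n v = poly (P v) (of_nat n)"
    by metis
  define D where "D = (\<Sum>\<pi>\<in>?S. smult (Cf_part w \<pi> f - Cf_part w \<pi> delta)
      (\<Prod>B\<in>kreweras ?N \<pi>. P (nths w B)))"
  have "box_power f (Suc n) w - box_power f n w = poly D (of_nat n)" for n
  proof -
    have "box_power f n = box delta (box_power f n)"
      using unital_box_power[OF assms, of n] by (simp add: box_delta_left unital_def)
    then have "box_power f (Suc n) w - box_power f n w =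
        box f (box_power f n) w - box delta (box_power f n) w" by simp
    also have "\<dots> = (\<Sum>\<pi>\<in>NC ?N. (Cf_part w \<pi> f - Cf_part w \<pi> delta) *
        Cf_part w (kreweras ?N \<pi>) (box_power f n))"
      by (simp add: box_def sum_subtractf algebra_simps)
    also have "\<dots> = (\<Sum>\<pi>\<in>?S. (Cf_part w \<pi> f - Cf_part w \<pi> delta) *
        Cf_part w (kreweras ?N \<pi>) (box_power f n))"
      by (rule sum.mono_neutral_right)
        (auto simp: finite_NC Cf_part_kreweras_full assms unital_delta)
    also have "\<dots> = poly D (of_nat n)"
      unfolding D_def poly_sum poly_smult poly_prod
    proof (rule sum.cong[OF refl])
      fix \<pi> assume \<pi>: "\<pi> \<in> ?S"
      then have "kreweras ?N \<pi> \<in> NC ?N" "kreweras ?N \<pi> \<noteq> {{..<?N}}"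
        using kreweras_in_NC by auto
      then have "Cf_part w (kreweras ?N \<pi>) (box_power f n) =
          (\<Prod>B\<in>kreweras ?N \<pi>. poly (P (nths w B)) (of_nat n))"
        unfolding Cf_part_def by (intro prod.cong P length_nths_block_less) auto
      then show "(Cf_part w \<pi> f - Cf_part w \<pi> delta) * Cf_part w (kreweras ?N \<pi>) (box_power f n) =
          (Cf_part w \<pi> f - Cf_part w \<pi> delta) * (\<Prod>B\<in>kreweras ?N \<pi>. poly (P (nths w B)) (of_nat n))"
        by simp
    qed
    finally show ?thesis .
  qed
  then have step: "box_power f n w = box_power f 0 w + (\<Sum>k<n. poly D (of_nat k))" for n
    by (induction n) (simp_all add: algebra_simps del: box_power.simps)
  obtain q where "\<And>n. (\<Sum>k<n. poly D (of_nat k)) = poly q (of_nat n)"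
    using sum_of_values_poly[of D] by blast
  then have "box_power f n w = poly ([:box_power f 0 w:] + q) (of_nat n)" for n
    unfolding step[of n] by simp
  then show ?case by blast
qed

text \<open>
The defining series of the logarithm at \<open>Y\<^sub>w\<close> is the series of \<open>log_series_poly\<close>.
\<close>

lemma LS_eq_derivative:
  assumes f: "unital f" and w: "2 \<le> length w"
    and p: "\<And>n. box_power f n w = poly p (of_nat n)"
  shows "LS (with_cumulants f) w = poly (pderiv p) 0"
proof -
  have "chi (with_cumulants f) = character f"
    unfolding chi_def Y_hom_id R_transform_with_cumulants[of f, OF unitalD(1)[OF f]]
    by (rule character_cong) auto
  then have "LS (with_cumulants f) w =
      - suminf (\<lambda>l. 1 / of_nat (Suc l) * neg_diff (Suc l) (\<lambda>j. character (box_power f j) (Y w)) 0)"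
    using w by (simp only: LS_def conv_log_def conv_power_eq_neg_diff[OF f] if_True)
  also have "\<dots> = - suminf (\<lambda>l. 1 / of_nat (Suc l) * neg_diff (Suc l) (\<lambda>j. poly p (of_nat j)) 0)"
    by (simp only: character_Y[OF unital_box_power[OF f]] p)
  also have "\<dots> = poly (pderiv p) 0"
    unfolding sums_unique[OF log_series_poly, symmetric] by simp
  finally show ?thesis .
qed

lemma box_power_commute:
  fixes f g :: "'k::finite nc_series"
  assumes "unital f" "unital g" "box f g = box g f"
  shows "box g (box_power f n) = box (box_power f n) g"
proof (induction n)
  case 0
  show ?case using assms by (simp add: box_delta_left box_delta_right unital_def)
next
  case (Suc n)
  have u: "f [] = 1" "g [] = 1" "box_power f n [] = 1"
    using assms unital_box_power[of f n] by (simp_all add: unital_def)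
  have "box g (box f (box_power f n)) = box f (box g (box_power f n))"
    using box_assoc[of g f "box_power f n"] box_assoc[of f g "box_power f n"] u assms(3) by simp
  also have "\<dots> = box (box f (box_power f n)) g"
    using Suc box_assoc[of f "box_power f n" g] u by simp
  finally show ?case by simp
qed

lemma box_power_box:
  fixes f g :: "'k::finite nc_series"
  assumes "unital f" "unital g" "box f g = box g f"
  shows "box_power (box f g) n = box (box_power f n) (box_power g n)"
proof (induction n)
  case 0
  show ?case by (simp add: box_delta_left delta_Nil)
next
  case (Suc n)
  let ?F = "box_power f n" and ?G = "box_power g n"
  have u: "f [] = 1" "g [] = 1" "?F [] = 1" "?G [] = 1"
    using assms unital_box_power[of f n] unital_box_power[of g n] by (simp_all add: unital_def)
  have "box (box f g) (box ?F ?G) = box f (box (box g ?F) ?G)"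
    using u by (simp add: box_assoc)
  also have "\<dots> = box (box f ?F) (box g ?G)"
    using u by (simp add: box_power_commute[OF assms] box_assoc)
  finally show ?case by (simp add: Suc)
qed

theorem corollary1p5:
  fixes \<mu> \<nu> :: "'k::finite nc_poly \<Rightarrow> complex"
  assumes "\<mu> \<in> G_group" and "\<nu> \<in> G_group"
    and "\<mu> \<boxtimes> \<nu> = \<nu> \<boxtimes> \<mu>"
  shows "LS (\<mu> \<boxtimes> \<nu>) = (\<lambda>w. LS \<mu> w + LS \<nu> w)"
proof
  fix w
  obtain f where f: "unital f" "\<mu> = with_cumulants f"
    using assms(1) by (rule G_group_eq_with_cumulants)
  obtain g where g: "unital g" "\<nu> = with_cumulants g"
    using assms(2) by (rule G_group_eq_with_cumulants)
  note u = unitalD(1)[OF f(1)] unitalD(1)[OF g(1)]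
  have conv: "\<mu> \<boxtimes> \<nu> = with_cumulants (box f g)" "\<nu> \<boxtimes> \<mu> = with_cumulants (box g f)"
    unfolding f(2) g(2) by (simp_all add: free_mult_conv_with_cumulants u)
  have comm: "box f g = box g f"
    using assms(3) unfolding conv by (rule with_cumulants_inject) (simp_all add: u)
  show "LS (\<mu> \<boxtimes> \<nu>) w = LS \<mu> w + LS \<nu> w"
  proof (cases "2 \<le> length w")
    case False
    then show ?thesis by (simp add: LS_def)
  next
    case True
    obtain P where P: "\<And>v n. box_power f n v = poly (P v) (of_nat n)"
      using box_power_poly[OF f(1)] by metis
    obtain Q where Q: "\<And>v n. box_power g n v = poly (Q v) (of_nat n)"
      using box_power_poly[OF g(1)] by metis
    let ?K = "kreweras (length w)"
    \<comment> \<open>The sum over \<open>\<pi>\<close> of \<open>p \<pi>\<close> in one variable times \<open>q \<pi>\<close> in another is the polynomial in two variables that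
      interpolates the boxed convolutions of powers of \<open>f\<close> and \<open>g\<close>. The facts \<open>1\<close> and \<open>2\<close> say that on the axes it
      reduces to \<open>P w\<close> and \<open>Q w\<close>.\<close>
    define p q where "p \<pi> = (\<Prod>B\<in>\<pi>. P (nths w B))" and "q \<pi> = (\<Prod>B\<in>?K \<pi>. Q (nths w B))" for \<pi>
    have p: "poly (p \<pi>) (of_nat n) = Cf_part w \<pi> (box_power f n)"
      and q: "poly (q \<pi>) (of_nat n) = Cf_part w (?K \<pi>) (box_power g n)" for \<pi> n
      by (simp_all add: p_def q_def poly_prod Cf_part_def P Q)
    have p0: "poly (p \<pi>) 0 = Cf_part w \<pi> delta" and q0: "poly (q \<pi>) 0 = Cf_part w (?K \<pi>) delta" for \<pi>
      using p[of \<pi> 0] q[of \<pi> 0] by simp_all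
    have 1: "(\<Sum>\<pi>\<in>NC (length w). smult (poly (q \<pi>) 0) (p \<pi>)) = P w"
    proof (rule poly_eq_of_nat)
      fix n
      have "poly (\<Sum>\<pi>\<in>NC (length w). smult (poly (q \<pi>) 0) (p \<pi>)) (of_nat n) = box (box_power f n) delta w"
        by (simp add: poly_sum p q0 box_def mult.commute)
      then show "poly (\<Sum>\<pi>\<in>NC (length w). smult (poly (q \<pi>) 0) (p \<pi>)) (of_nat n) = poly (P w) (of_nat n)"
        by (simp add: box_delta_right[of "box_power f n", OF unitalD(1)[OF unital_box_power[OF f(1)]]] P)
    qed
    have 2: "(\<Sum>\<pi>\<in>NC (length w). smult (poly (p \<pi>) 0) (q \<pi>)) = Q w"
    proof (rule poly_eq_of_nat)
      fix n
      have "poly (\<Sum>\<pi>\<in>NC (length w). smult (poly (p \<pi>) 0) (q \<pi>)) (of_nat n) = box delta (box_power g n) w"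
        by (simp add: poly_sum q p0 box_def)
      then show "poly (\<Sum>\<pi>\<in>NC (length w). smult (poly (p \<pi>) 0) (q \<pi>)) (of_nat n) = poly (Q w) (of_nat n)"
        by (simp add: box_delta_left[of "box_power g n", OF unitalD(1)[OF unital_box_power[OF g(1)]]] Q)
    qed
    have "box_power (box f g) n w = poly (\<Sum>\<pi>\<in>NC (length w). p \<pi> * q \<pi>) (of_nat n)" for n
      by (simp add: box_power_box[OF f(1) g(1) comm] box_def poly_sum p q)
    from LS_eq_derivative[OF unital_box[OF f(1) g(1)] True this]
    have "LS (\<mu> \<boxtimes> \<nu>) w = poly (pderiv (\<Sum>\<pi>\<in>NC (length w). p \<pi> * q \<pi>)) 0"
      by (simp only: conv)
    also have "\<dots> = poly (pderiv (P w)) 0 + poly (pderiv (Q w)) 0"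
      unfolding 1[symmetric] 2[symmetric]
      by (simp add: pderiv_sum poly_sum pderiv_mult pderiv_smult sum.distrib algebra_simps)
    also have "\<dots> = LS \<mu> w + LS \<nu> w"
      using LS_eq_derivative[OF f(1) True P] LS_eq_derivative[OF g(1) True Q] by (simp add: f(2) g(2))
    finally show ?thesis .
  qed
qed

end
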